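(* Let $\mathcal A$ be the arrangement of the six planes $x=0$, $y=0$, $z=0$, $y-z-t=0$, $z-x-t=0$, $x-y-t=0$ in $\mathbb{P}^3=\mathbb{P}^3(\mathbb{R})$ with homogeneous coordinates $x:y:z:t$, and let $G\cong\mathfrak S_3\times\mathbb{Z}_2$ be the group of orientation preserving projective transformations generated by $\rho,\sigma,\tau$ given in the context; $G$ preserves $\mathcal A$. Then $G$ acts on the 26 chambers cut out by $\mathcal A$ with four orbits: 12 triangular prisms, 6 tetrahedra, 6 (pentagonal) dumplings, and 2 cubes. Moreover: (i) the orbit of a prism together with the orbit of a cube (i.e. the union $U_1$ of the 12 prisms and the 2 cubes) is a solid torus; (ii) the orbit of a dumpling (i.e. the union $U_2$ of the 6 dumplings) is a second solid torus, linked with the first one; (iii) the orbit of a tetrahedron (i.e. the union $U_3$ of the 6 tetrahedra) is the complement of the two solid tori, that is, the closure of $\mathbb{P}^3\setminus(U_1\cup U_2)$; (iv) the union of either one of these solid tori with the orbit of a tetrahedron, i.e. $U_1\cup U_3$ and $U_2\cup U_3$, is a solid torus as well.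
   Context: The generators of $G$ act on column vectors ${}^t(x,y,z,t)$ by $$\rho=\begin{pmatrix}0&1&0&0\\0&0&1&0\\1&0&0&0\\0&0&0&1\end{pmatrix},\quad \sigma=\begin{pmatrix}0&-1&0&0\\-1&0&0&0\\0&0&-1&0\\0&0&0&1\end{pmatrix},\quad \tau=\begin{pmatrix}0&1&-1&-1\\-1&0&1&-1\\1&-1&0&-1\\1&1&1&0\end{pmatrix}.$$ As a group of projective transformations (matrices up to scalar multiplication) $G=\langle\rho,\sigma\rangle\times\langle\tau\rangle\cong\mathfrak S_3\times\mathbb{Z}_2$, of order 12. A chamber of an arrangement is the closure of a connected component of the complement of the union of its planes; names of chambers refer to combinatorial types of polytopes. A (pentagonal) dumpling is the 3-polytope obtained from a pentagonal prism (pentagon times $[0,1]$) by crushing one rectangular face $s\times[0,1]$ ($s$ a side of the pentagon) onto $s$ via the projection $(p,u)\mapsto p$; it is bounded by two pentagons (sharing an edge), two triangles and two quadrilaterals. A solid torus is a space homeomorphic to $\mathbb{S}^1\times\mathbb{D}^2$. "Linked" is used as an informal description of the position of the two solid tori in $\mathbb{P}^3$. *)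

theory Defs
  imports "HOL-Analysis.Analysis"
    "HOL-Algebra.Bij" "HOL-Algebra.Group_Action" "HOL-Algebra.Sym_Groups" "HOL-Algebra.Elementary_Groups"
begin

section \<open>Real projective 3-space\<close>

text \<open>A point \<open>x:y:z:t\<close> is the line spanned by \<open>(x,y,z,t)\<close> in \<open>real ^ 4\<close>;
  the topology is the quotient topology from the nonzero vectors (lemma \<open>quotient_map_proj_pt\<close>).\<close>

definition proj_pt :: "real ^ 4 \<Rightarrow> (real ^ 4) set" where
  "proj_pt v = span {v}"

definition proj_space :: "(real ^ 4) set topology" where
  "proj_space = topology (\<lambda>U. U \<subseteq> proj_pt ` (- {0}) \<and> open {v. v \<noteq> 0 \<and> proj_pt v \<in> U})"

lemma openin_proj_space:
  "openin proj_space U \<longleftrightarrow> U \<subseteq> proj_pt ` (- {0}) \<and> open {v. v \<noteq> 0 \<and> proj_pt v \<in> U}"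
proof -
  have "istopology (\<lambda>U. U \<subseteq> proj_pt ` (- {0}) \<and> open {v. v \<noteq> 0 \<and> proj_pt v \<in> U})"
    unfolding istopology_def
  proof (intro conjI allI impI)
    fix S T :: "(real ^ 4) set set"
    assume S: "S \<subseteq> proj_pt ` (- {0}) \<and> open {v. v \<noteq> 0 \<and> proj_pt v \<in> S}"
      and T: "T \<subseteq> proj_pt ` (- {0}) \<and> open {v. v \<noteq> 0 \<and> proj_pt v \<in> T}"
    show "S \<inter> T \<subseteq> proj_pt ` (- {0})" using S by blast
    have "{v. v \<noteq> 0 \<and> proj_pt v \<in> S \<inter> T}
        = {v. v \<noteq> 0 \<and> proj_pt v \<in> S} \<inter> {v. v \<noteq> 0 \<and> proj_pt v \<in> T}" by auto
    then show "open {v. v \<noteq> 0 \<and> proj_pt v \<in> S \<inter> T}" using S T by auto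
  next
    fix \<K> :: "(real ^ 4) set set set"
    assume K: "\<forall>K\<in>\<K>. K \<subseteq> proj_pt ` (- {0}) \<and> open {v. v \<noteq> 0 \<and> proj_pt v \<in> K}"
    show "\<Union>\<K> \<subseteq> proj_pt ` (- {0})" using K by blast
    have "{v. v \<noteq> 0 \<and> proj_pt v \<in> \<Union>\<K>} = (\<Union>K\<in>\<K>. {v. v \<noteq> 0 \<and> proj_pt v \<in> K})" by auto
    then show "open {v. v \<noteq> 0 \<and> proj_pt v \<in> \<Union>\<K>}" using K by auto
  qed
  then show ?thesis by (simp add: proj_space_def topology_inverse')
qed

lemma topspace_proj_space: "topspace proj_space = proj_pt ` (- {0})"
proof -
  have "{v. v \<noteq> 0 \<and> proj_pt v \<in> proj_pt ` (- {0})} = - {0}" by auto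
  then have "openin proj_space (proj_pt ` (- {0}))"
    unfolding openin_proj_space by (simp add: open_Compl)
  then have "proj_pt ` (- {0}) \<subseteq> topspace proj_space" by (rule openin_subset)
  moreover have "topspace proj_space \<subseteq> proj_pt ` (- {0})"
    using openin_topspace[of proj_space] unfolding openin_proj_space by blast
  ultimately show ?thesis by blast
qed

lemma quotient_map_proj_pt: "quotient_map (top_of_set (- {0})) proj_space proj_pt"
proof -
  have "openin (top_of_set (- {0})) {v. v \<in> - {0} \<and> proj_pt v \<in> U}
      \<longleftrightarrow> open {v. v \<noteq> 0 \<and> proj_pt v \<in> U}" for U
  proof -
    have "{v. v \<in> - {0} \<and> proj_pt v \<in> U} = {v. v \<noteq> 0 \<and> proj_pt v \<in> U}" by auto
    then show ?thesis by (auto simp: openin_open_eq open_Compl)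
  qed
  then show ?thesis
    unfolding quotient_map_def by (simp add: topspace_proj_space openin_proj_space)
qed


section \<open>Projective transformations\<close>

text \<open>Transformations are made undefined off the point set so that they are elements of
  \<open>BijGroup\<close>; proportional matrices give the same map.\<close>

definition proj_map :: "real ^ 4 ^ 4 \<Rightarrow> (real ^ 4) set \<Rightarrow> (real ^ 4) set" where
  "proj_map M = (\<lambda>p\<in>topspace proj_space. (*v) M ` p)"

lemma proj_map_pt:
  assumes "v \<noteq> 0"
  shows "proj_map M (proj_pt v) = proj_pt (M *v v)"
  using assms
  by (simp add: proj_map_def topspace_proj_space proj_pt_def linear_span_image[symmetric])

lemma proj_map_Bij:
  assumes "invertible M"
  shows "proj_map M \<in> carrier (BijGroup (topspace proj_space))"
proof -
  obtain N where N: "M ** N = mat 1" "N ** M = mat 1"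
    using assms by (auto simp: invertible_def)
  have mem: "proj_pt v \<in> topspace proj_space" if "v \<noteq> 0" for v
    using that by (auto simp: topspace_proj_space)
  have nz: "A *v v \<noteq> 0" if "B ** A = mat 1" "v \<noteq> 0" for A B :: "real ^ 4 ^ 4" and v
  proof
    assume "A *v v = 0"
    then have "(B ** A) *v v = 0"
      by (simp add: matrix_vector_mul_assoc[symmetric] matrix_vector_mult_0_right)
    then show False using that by simp
  qed
  have inv: "proj_map A (proj_map B p) = p" "proj_map B p \<in> topspace proj_space"
    if AB: "A ** B = mat 1" and p: "p \<in> topspace proj_space" for A B p
  proof -
    obtain v where v: "v \<noteq> 0" "p = proj_pt v"
      using p by (auto simp: topspace_proj_space)
    have "B *v v \<noteq> 0" using nz AB v(1) by blast
    then show "proj_map A (proj_map B p) = p" "proj_map B p \<in> topspace proj_space"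
      using v AB mem by (simp_all add: proj_map_pt matrix_vector_mul_assoc)
  qed
  have "bij_betw (proj_map M) (topspace proj_space) (topspace proj_space)"
    by (rule bij_betw_byWitness[where f' = "proj_map N"]) (use inv N in auto)
  then show ?thesis
    by (simp add: BijGroup_def Bij_def proj_map_def)
qed

text \<open>On \<open>\<real>\<^sup>4\<close> scaling a matrix does not change the sign of its determinant, and a projective
  transformation of the projective 3-space preserves the orientation iff this sign is positive.\<close>

definition orientation_preserving_proj :: "((real ^ 4) set \<Rightarrow> (real ^ 4) set) \<Rightarrow> bool" where
  "orientation_preserving_proj g \<longleftrightarrow> (\<exists>M. det M > 0 \<and> g = proj_map M)"

definition rho :: "real ^ 4 ^ 4" where
  "rho = vector [vector [0, 1, 0, 0],
                 vector [0, 0, 1, 0],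
                 vector [1, 0, 0, 0],
                 vector [0, 0, 0, 1]]"

definition sigma :: "real ^ 4 ^ 4" where
  "sigma = vector [vector [ 0, -1,  0, 0],
                   vector [-1,  0,  0, 0],
                   vector [ 0,  0, -1, 0],
                   vector [ 0,  0,  0, 1]]"

definition tau :: "real ^ 4 ^ 4" where
  "tau = vector [vector [ 0,  1, -1, -1],
                 vector [-1,  0,  1, -1],
                 vector [ 1, -1,  0, -1],
                 vector [ 1,  1,  1,  0]]"

definition G :: "((real ^ 4) set \<Rightarrow> (real ^ 4) set) monoid" where
  "G = subgroup_generated (BijGroup (topspace proj_space))
         {proj_map rho, proj_map sigma, proj_map tau}"


section \<open>The arrangement and its chambers\<close>

definition proj_plane :: "real ^ 4 \<Rightarrow> (real ^ 4) set set" where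
  "proj_plane a = {proj_pt v | v. v \<noteq> 0 \<and> a \<bullet> v = 0}"

definition arrangement :: "(real ^ 4) set set set" where
  "arrangement = proj_plane `
     {vector [1, 0, 0, 0], vector [0, 1, 0, 0], vector [0, 0, 1, 0],
      vector [0, 1, -1, -1], vector [-1, 0, 1, -1], vector [1, -1, 0, -1]}"

definition chambers :: "(real ^ 4) set set set" where
  "chambers = (\<lambda>C. proj_space closure_of C) `
     connected_components_of (subtopology proj_space (topspace proj_space - \<Union>arrangement))"

definition chamber_action ::
    "((real ^ 4) set \<Rightarrow> (real ^ 4) set) \<Rightarrow> (real ^ 4) set set \<Rightarrow> (real ^ 4) set set" where
  "chamber_action g = (\<lambda>K\<in>chambers. g ` K)"


section \<open>Combinatorial types\<close>

definition comb_equiv :: "'a::real_vector set \<Rightarrow> 'b::real_vector set \<Rightarrow> bool" where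
  "comb_equiv P Q \<longleftrightarrow>
     (\<exists>f. bij_betw f {F. F face_of P} {F. F face_of Q} \<and>
          (\<forall>F F'. F face_of P \<longrightarrow> F' face_of P \<longrightarrow> (F \<subseteq> F' \<longleftrightarrow> f F \<subseteq> f F')))"

text \<open>The affine chart \<open>p \<mapsto> M (p, 1)\<close>; every affine chart of the projective space,
  that is, every complement of a plane, arises in this way.\<close>

definition affine_chart :: "real ^ 4 ^ 4 \<Rightarrow> real ^ 3 \<Rightarrow> (real ^ 4) set" where
  "affine_chart M p = proj_pt (M *v vector [p $ 1, p $ 2, p $ 3, 1])"

definition has_comb_type :: "(real ^ 4) set set \<Rightarrow> 'b::real_vector set \<Rightarrow> bool" where
  "has_comb_type K Q \<longleftrightarrow>
     (\<exists>M P. invertible M \<and> polytope P \<and> K = affine_chart M ` P \<and> comb_equiv P Q)"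

definition tetrahedron :: "((real \<times> real) \<times> real) set" where
  "tetrahedron = convex hull {((0, 0), 0), ((1, 0), 0), ((0, 1), 0), ((0, 0), 1)}"

definition cube :: "((real \<times> real) \<times> real) set" where
  "cube = ({0..1} \<times> {0..1}) \<times> {0..1}"

definition triangular_prism :: "((real \<times> real) \<times> real) set" where
  "triangular_prism = (convex hull {(0, 0), (1, 0), (0, 1)}) \<times> {0..1}"

definition pentagon :: "(real \<times> real) set" where
  "pentagon = convex hull {(0, 0), (2, 0), (3, 1), (1, 2), (- 1, 1)}"

text \<open>The crushed side is \<open>s = {p \<in> pentagon. snd p = 0}\<close>. Multiplying the height by \<open>snd p\<close>
  identifies \<open>(p, u)\<close> with \<open>(p, u')\<close> for \<open>p \<in> s\<close>, makes no other identification, and has a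
  polytope as its image.\<close>

definition dumpling :: "((real \<times> real) \<times> real) set" where
  "dumpling = (\<lambda>(p, u). (p, u * snd p)) ` (pentagon \<times> {0..1})"

definition chambers_of_type :: "'b::real_vector set \<Rightarrow> (real ^ 4) set set set" where
  "chambers_of_type Q = {K \<in> chambers. has_comb_type K Q}"


section \<open>Solid tori and linking\<close>

definition solid_torus_in :: "'a topology \<Rightarrow> 'a set \<Rightarrow> bool" where
  "solid_torus_in X S \<longleftrightarrow> S \<subseteq> topspace X \<and>
     subtopology X S homeomorphic_space
       prod_topology (top_of_set (sphere (0::complex) 1)) (top_of_set (cball (0::complex) 1))"

definition contractible_within :: "'a topology \<Rightarrow> 'a set \<Rightarrow> 'a set \<Rightarrow> bool" where
  "contractible_within X S T \<longleftrightarrow>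
     (\<exists>c. homotopic_with (\<lambda>_. True) (subtopology X S) (subtopology X T) (\<lambda>x. x) (\<lambda>_. c))"

text \<open>Linked: neither set can be contracted to a point without meeting the other.
  Interiors are used because the two solid tori in question share part of their boundaries.\<close>

definition linked_in :: "'a topology \<Rightarrow> 'a set \<Rightarrow> 'a set \<Rightarrow> bool" where
  "linked_in X S T \<longleftrightarrow>
     disjnt (X interior_of S) (X interior_of T) \<and>
     \<not> contractible_within X (X interior_of S) (topspace X - X interior_of T) \<and>
     \<not> contractible_within X (X interior_of T) (topspace X - X interior_of S)"

end

theory Submission
  imports Defs "HOL-Complex_Analysis.Winding_Numbers"
begin

text \<open>A chamber is given by the signs, up to a common factor \<open>-1\<close>, of the two triples
  \<open>(x, y, z)\<close> and \<open>(y - z - t, z - x - t, x - y - t)\<close>, which \<open>G\<close> permutes up to signs. Cubes have both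
  triples of constant sign, prisms exactly one of them, tetrahedra and dumplings neither. Hence the
  union of prisms and cubes is the set where one of the triples has weakly constant sign.

  Write \<open>v = v\<^sub>1 + v\<^sub>2\<close> with \<open>v\<^sub>1\<close> in the plane spanned by \<open>(1,1,1,0)\<close> and \<open>(0,0,0,1)\<close> and \<open>v\<^sub>2\<close> in
  \<open>{x + y + z = 0, t = 0}\<close>, so that the projective space is the join of two skew lines.
  Scaling \<open>v\<^sub>2\<close> from \<open>0\<close> to infinity, one passes once through prisms and cubes, then tetrahedra, then
  dumplings. So each of the unions in question is a star-shaped neighbourhood of one of the
  two lines, and as such homeomorphic to \<open>{|v\<^sub>2| \<le> |v\<^sub>1|}\<close>, a solid torus. The solid tori are
  linked because either line projects, from the other one, onto a projective line.\<close>

section \<open>Combinatorial equivalence of polyhedra\<close>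

text \<open>\<open>has_comb_type\<close> only asserts that some chart and some polytope exist, so
  identifying the chambers of a type takes two arguments: each chamber has its type, and it has no
  other. The first is settled on one representative per orbit, in a chart, where faces are encoded
  by the sets of inequalities that become equalities simultaneously; this makes the face lattice a
  finite computation. For the second, a change of chart defined on a whole convex polytope preserves
  open segments, hence faces, and an invariant of the face lattice separates the four models.

  The number 26 arises from 64 sign patterns: 12 are contradictory, and the other 52 are identified
  in opposite pairs.

  The obstacle in the homeomorphism with a solid torus is that a normalised representative (e, w)
  with |e| = 1 is unique only up to a common sign. Squaring e, and multiplying the disc coordinate
  by e, removes the ambiguity. That a ray leaves the prisms and cubes only once follows because
  zero-sum deviations are amplified along it; for the dumplings an ordering of the coordinates is
  needed.\<close>

lemma comb_equiv_sym:
  assumes "comb_equiv P Q" shows "comb_equiv Q P"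
proof -
  let ?P = "{F. F face_of P}" and ?Q = "{F. F face_of Q}"
  obtain f where f: "bij_betw f ?P ?Q"
    and mono: "\<And>F F'. F face_of P \<Longrightarrow> F' face_of P \<Longrightarrow> F \<subseteq> F' \<longleftrightarrow> f F \<subseteq> f F'"
    using assms unfolding comb_equiv_def by blast
  let ?g = "the_inv_into ?P f"
  have g: "bij_betw ?g ?Q ?P" by (rule bij_betw_the_inv_into[OF f])
  have fg: "f (?g F) = F" "?g F face_of P" if "F face_of Q" for F
    using that f g by (auto simp: f_the_inv_into_f_bij_betw bij_betw_def)
  have "F \<subseteq> F' \<longleftrightarrow> ?g F \<subseteq> ?g F'" if "F face_of Q" "F' face_of Q" for F F'
    using mono[of "?g F" "?g F'"] fg that by simp
  then show ?thesis unfolding comb_equiv_def using g by blast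
qed

lemma comb_equiv_trans:
  assumes "comb_equiv P Q" "comb_equiv Q R" shows "comb_equiv P R"
proof -
  obtain f where f: "bij_betw f {F. F face_of P} {F. F face_of Q}"
    and f': "\<And>F F'. F face_of P \<Longrightarrow> F' face_of P \<Longrightarrow> F \<subseteq> F' \<longleftrightarrow> f F \<subseteq> f F'"
    using assms(1) unfolding comb_equiv_def by blast
  obtain g where g: "bij_betw g {F. F face_of Q} {F. F face_of R}"
    and g': "\<And>F F'. F face_of Q \<Longrightarrow> F' face_of Q \<Longrightarrow> F \<subseteq> F' \<longleftrightarrow> g F \<subseteq> g F'"
    using assms(2) unfolding comb_equiv_def by blast
  have "f F face_of Q" if "F face_of P" for F
    using f that by (auto simp: bij_betw_def)
  then have "\<forall>F F'. F face_of P \<longrightarrow> F' face_of P \<longrightarrow> (F \<subseteq> F' \<longleftrightarrow> (g \<circ> f) F \<subseteq> (g \<circ> f) F')"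
    using f' g' by simp
  with bij_betw_trans[OF f g] show ?thesis unfolding comb_equiv_def by blast
qed

text \<open>Faces are defined through open segments alone, so it is enough to pull segments back
  along \<open>\<psi>\<close>. Affinity of the bijection is replaced by this weaker property because
  changes of projective chart are only fractional linear.\<close>

lemma face_of_image_open_segment:
  assumes \<psi>\<phi>: "\<And>x. x \<in> P \<Longrightarrow> \<psi> (\<phi> x) = x" and \<phi>\<psi>: "\<And>y. y \<in> P' \<Longrightarrow> \<phi> (\<psi> y) = y"
    and \<phi>: "\<phi> ` P \<subseteq> P'" and \<psi>: "\<psi> ` P' \<subseteq> P"
    and seg: "\<And>a b y. a \<in> P' \<Longrightarrow> b \<in> P' \<Longrightarrow> y \<in> open_segment a b \<Longrightarrow> \<psi> y \<in> open_segment (\<psi> a) (\<psi> b)"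
    and conv: "convex P'" and T: "T face_of P"
  shows "\<phi> ` T face_of P'"
  unfolding face_of_def
proof (intro conjI ballI impI)
  have TP: "T \<subseteq> P" using T face_of_imp_subset by blast
  show "\<phi> ` T \<subseteq> P'" using TP \<phi> by blast
  show "convex (\<phi> ` T)"
    unfolding convex_contains_open_segment
  proof (intro ballI subsetI)
    fix a b y assume "a \<in> \<phi> ` T" "b \<in> \<phi> ` T" and y: "y \<in> open_segment a b"
    then obtain a' b' where ab: "a' \<in> T" "b' \<in> T" "a = \<phi> a'" "b = \<phi> b'" by blast
    then have mem: "a \<in> P'" "b \<in> P'" using TP \<phi> by auto
    then have "y \<in> P'" using y conv by (auto simp: convex_contains_open_segment)
    moreover have "\<psi> y \<in> open_segment a' b'"
      using seg[OF mem y] ab \<psi>\<phi> TP by (auto simp: subset_iff)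
    then have "\<psi> y \<in> T"
      using ab face_of_imp_convex[OF T] by (auto simp: convex_contains_open_segment)
    ultimately show "y \<in> \<phi> ` T" using \<phi>\<psi> by force
  qed
  fix a b x assume ab: "a \<in> P'" "b \<in> P'" and x: "x \<in> \<phi> ` T" "x \<in> open_segment a b"
  have "\<psi> x \<in> T" using x \<psi>\<phi> TP by (auto simp: subset_iff)
  moreover have "\<psi> x \<in> open_segment (\<psi> a) (\<psi> b)" using seg ab x by blast
  moreover have "\<psi> a \<in> P" "\<psi> b \<in> P" using ab \<psi> by auto
  ultimately have "\<psi> a \<in> T" "\<psi> b \<in> T" using T unfolding face_of_def by blast+
  then show "a \<in> \<phi> ` T" "b \<in> \<phi> ` T" using \<phi>\<psi> ab by force+
qed

lemma comb_equiv_open_segment: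
  assumes \<psi>\<phi>: "\<And>x. x \<in> P \<Longrightarrow> \<psi> (\<phi> x) = x" and \<phi>\<psi>: "\<And>y. y \<in> P' \<Longrightarrow> \<phi> (\<psi> y) = y"
    and \<phi>: "\<phi> ` P \<subseteq> P'" and \<psi>: "\<psi> ` P' \<subseteq> P"
    and seg\<phi>: "\<And>a b y. a \<in> P \<Longrightarrow> b \<in> P \<Longrightarrow> y \<in> open_segment a b \<Longrightarrow> \<phi> y \<in> open_segment (\<phi> a) (\<phi> b)"
    and seg\<psi>: "\<And>a b y. a \<in> P' \<Longrightarrow> b \<in> P' \<Longrightarrow> y \<in> open_segment a b \<Longrightarrow> \<psi> y \<in> open_segment (\<psi> a) (\<psi> b)"
    and conv: "convex P" "convex P'"
  shows "comb_equiv P P'"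
proof -
  have im: "\<psi> ` \<phi> ` T = T" if "T \<subseteq> P" for T using that \<psi>\<phi> by (force simp: image_comp)
  have im': "\<phi> ` \<psi> ` T = T" if "T \<subseteq> P'" for T using that \<phi>\<psi> by (force simp: image_comp)
  have "bij_betw ((`) \<phi>) {F. F face_of P} {F. F face_of P'}"
  proof (rule bij_betw_byWitness[where f' = "(`) \<psi>"])
    show "\<forall>F\<in>{F. F face_of P}. \<psi> ` \<phi> ` F = F" by (simp add: im face_of_imp_subset)
    show "\<forall>F\<in>{F. F face_of P'}. \<phi> ` \<psi> ` F = F" by (simp add: im' face_of_imp_subset)
    show "(`) \<phi> ` {F. F face_of P} \<subseteq> {F. F face_of P'}"
      using face_of_image_open_segment[OF \<psi>\<phi> \<phi>\<psi> \<phi> \<psi> seg\<psi> conv(2)] by blast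
    show "(`) \<psi> ` {F. F face_of P'} \<subseteq> {F. F face_of P}"
      using face_of_image_open_segment[OF \<phi>\<psi> \<psi>\<phi> \<psi> \<phi> seg\<phi> conv(1)] by blast
  qed
  moreover have "F \<subseteq> F' \<longleftrightarrow> \<phi> ` F \<subseteq> \<phi> ` F'" if "F face_of P" "F' face_of P" for F F'
    using im[OF face_of_imp_subset[OF that(1)]] im[OF face_of_imp_subset[OF that(2)]]
    by (metis image_mono)
  ultimately show ?thesis unfolding comb_equiv_def by blast
qed

section \<open>Homogeneous coordinates and changes of affine chart\<close>

definition hom_coords :: "real ^ 3 \<Rightarrow> real ^ 4" where
  "hom_coords p = vector [p $ 1, p $ 2, p $ 3, 1]"

lemma vector_4_nth [simp]:
  "(vector [a, b, c, d] :: 'a::zero ^ 4) $ 1 = a" "(vector [a, b, c, d] :: 'a ^ 4) $ 2 = b"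
  "(vector [a, b, c, d] :: 'a ^ 4) $ 3 = c" "(vector [a, b, c, d] :: 'a ^ 4) $ 4 = d"
  unfolding vector_def by auto

lemma hom_coords_affine:
  "hom_coords ((1 - u) *\<^sub>R p + u *\<^sub>R q) = (1 - u) *\<^sub>R hom_coords p + u *\<^sub>R hom_coords q"
  by (simp add: hom_coords_def vec_eq_iff forall_4)

lemma hom_coords_nonzero: "hom_coords p \<noteq> 0"
  by (auto simp: hom_coords_def vec_eq_iff forall_4)

lemma proj_pt_eq_iff:
  assumes "v \<noteq> 0" "w \<noteq> 0"
  shows "proj_pt v = proj_pt w \<longleftrightarrow> (\<exists>c. c \<noteq> 0 \<and> v = c *\<^sub>R w)"
proof
  assume "proj_pt v = proj_pt w"
  then have "v \<in> span {w}" unfolding proj_pt_def using span_base by blast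
  then obtain c where "v = c *\<^sub>R w" by (auto simp: span_singleton)
  then show "\<exists>c. c \<noteq> 0 \<and> v = c *\<^sub>R w" using assms by auto
next
  assume "\<exists>c. c \<noteq> 0 \<and> v = c *\<^sub>R w"
  then obtain c where c: "c \<noteq> 0" "v = c *\<^sub>R w" by blast
  have "k *\<^sub>R w \<in> range (\<lambda>k. k *\<^sub>R v)" for k
    using c by (intro image_eqI[of _ _ "k / c"]) auto
  then show "proj_pt v = proj_pt w"
    unfolding proj_pt_def span_singleton using c by auto
qed

lemma matrix_vector_mul_lid_inv:
  fixes A B :: "real ^ 'n ^ 'n"
  assumes "A ** B = mat 1" shows "A *v (B *v x) = x"
  using assms by (simp add: matrix_vector_mul_assoc)

lemma invertible_mult_nonzero:
  fixes M :: "real ^ 'n ^ 'n"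
  assumes "invertible M" "v \<noteq> 0" shows "M *v v \<noteq> 0"
  using assms invertible_def matrix_left_invertible_ker by blast

text \<open>In the other chart a point of \<open>P\<close> is \<open>\<phi> p\<close>, with denominator \<open>d p = (N *v hom_coords p) $ 4\<close>
  that vanishes nowhere on the convex set \<open>P\<close>, hence has constant sign there.\<close>

lemma chart_transition_open_segment:
  fixes N :: "real ^ 4 ^ 4"
  assumes conv: "convex P" and d0: "\<And>p. p \<in> P \<Longrightarrow> d p \<noteq> 0"
    and N: "\<And>p. p \<in> P \<Longrightarrow> N *v hom_coords p = d p *\<^sub>R hom_coords (\<phi> p)"
    and inj: "inj_on \<phi> P"
    and ab: "a \<in> P" "b \<in> P" and y: "y \<in> open_segment a b"
  shows "\<phi> y \<in> open_segment (\<phi> a) (\<phi> b)"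
proof -
  have d_eq: "d p = (N *v hom_coords p) $ 4" if "p \<in> P" for p
    using N[OF that] by (simp add: hom_coords_def)
  have lin: "N *v hom_coords ((1 - u) *\<^sub>R a + u *\<^sub>R b) =
      (1 - u) *\<^sub>R (N *v hom_coords a) + u *\<^sub>R (N *v hom_coords b)" for u
    by (simp only: hom_coords_affine matrix_vector_right_distrib matrix_vector_mult_scaleR)
  have inP: "(1 - u) *\<^sub>R a + u *\<^sub>R b \<in> P" if "0 \<le> u" "u \<le> 1" for u
    using conv ab that by (simp add: convex_alt)
  have dlin: "d ((1 - u) *\<^sub>R a + u *\<^sub>R b) = (1 - u) * d a + u * d b" if "0 \<le> u" "u \<le> 1" for u
    using d_eq[OF inP[OF that]] d_eq ab by (simp add: lin)
  have same: "0 < d a * d b"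
  proof (rule ccontr)
    assume "\<not> 0 < d a * d b"
    then have neg: "d a * d b < 0" using d0 ab by (metis linorder_neqE_linordered_idom mult_eq_0_iff)
    then have ne: "d a - d b \<noteq> 0" by (auto simp: mult_less_0_iff)
    \<comment> \<open>This is the zero on the segment of the affine function that interpolates
      \<open>d a\<close> and \<open>d b\<close>.\<close>
    let ?u = "d a / (d a - d b)"
    have "0 \<le> ?u" "?u \<le> 1" using neg by (auto simp: mult_less_0_iff divide_simps)
    then have "d ((1 - ?u) *\<^sub>R a + ?u *\<^sub>R b) = (1 - ?u) * d a + ?u * d b" by (rule dlin)
    also have "\<dots> = 0" using ne by (simp add: field_simps)
    finally show False using d0 inP[OF \<open>0 \<le> ?u\<close> \<open>?u \<le> 1\<close>] by blast
  qed
  obtain u where u: "a \<noteq> b" "0 < u" "u < 1" "y = (1 - u) *\<^sub>R a + u *\<^sub>R b"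
    using y by (auto simp: in_segment)
  have yP: "y \<in> P" using inP u by simp
  have dy: "d y = (1 - u) * d a + u * d b" using dlin u by simp
  \<comment> \<open>The weight of the endpoint \<open>b\<close> after dividing by \<open>d y\<close>
    to make the last homogeneous coordinate 1 again.\<close>
  let ?w = "u * d b / d y"
  have w1: "1 - ?w = (1 - u) * d a / d y" using d0[OF yP] dy by (simp add: field_simps)
  have pos: "0 < ?w \<and> 0 < (1 - u) * d a / d y"
  proof (cases "0 < d a")
    case True
    then have "0 < d b" using same by (simp add: zero_less_mult_iff)
    then show ?thesis using True u dy by (simp add: add_pos_pos)
  next
    case False
    then have "d a < 0" "d b < 0" using same by (auto simp: zero_less_mult_iff)
    moreover from this have "d y < 0" using u dy
      by (simp add: add_neg_neg mult_pos_neg)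
    ultimately show ?thesis using u by (simp add: zero_less_divide_iff mult_pos_neg)
  qed
  have "d y *\<^sub>R hom_coords (\<phi> y) =
      ((1 - u) * d a) *\<^sub>R hom_coords (\<phi> a) + (u * d b) *\<^sub>R hom_coords (\<phi> b)"
    using N[OF yP] N[OF ab(1)] N[OF ab(2)] lin[of u] u(4) by simp
  then have "(1 / d y) *\<^sub>R (d y *\<^sub>R hom_coords (\<phi> y)) =
      (1 / d y) *\<^sub>R (((1 - u) * d a) *\<^sub>R hom_coords (\<phi> a) + (u * d b) *\<^sub>R hom_coords (\<phi> b))" by simp
  then have "hom_coords (\<phi> y) = (1 - ?w) *\<^sub>R hom_coords (\<phi> a) + ?w *\<^sub>R hom_coords (\<phi> b)"
    unfolding w1 using d0[OF yP] by (simp add: scaleR_add_right)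
  then have "hom_coords (\<phi> y) = hom_coords ((1 - ?w) *\<^sub>R \<phi> a + ?w *\<^sub>R \<phi> b)"
    by (simp add: hom_coords_affine)
  then have "\<phi> y = (1 - ?w) *\<^sub>R \<phi> a + ?w *\<^sub>R \<phi> b"
    by (simp add: hom_coords_def vec_eq_iff forall_4 forall_3)
  moreover have "\<phi> a \<noteq> \<phi> b" using inj ab u by (auto dest: inj_onD)
  ultimately show ?thesis using pos w1 by (auto simp: in_segment)
qed

lemma affine_chart_eq: "affine_chart M p = proj_pt (M *v hom_coords p)"
  by (simp add: affine_chart_def hom_coords_def)

lemma chart_transition:
  assumes M: "invertible M" and M': "invertible M'"
    and sub: "affine_chart M ` P \<subseteq> affine_chart M' ` P'"
  obtains d \<phi> where "\<And>p. p \<in> P \<Longrightarrow> d p \<noteq> (0::real)" "\<phi> ` P \<subseteq> P'"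
    "\<And>p. p \<in> P \<Longrightarrow> M *v hom_coords p = d p *\<^sub>R (M' *v hom_coords (\<phi> p))"
proof -
  have "\<exists>c q. c \<noteq> 0 \<and> q \<in> P' \<and> M *v hom_coords p = c *\<^sub>R (M' *v hom_coords q)" if "p \<in> P" for p
  proof -
    obtain q where q: "q \<in> P'" "affine_chart M p = affine_chart M' q" using sub \<open>p \<in> P\<close> by blast
    then show ?thesis
      using proj_pt_eq_iff invertible_mult_nonzero hom_coords_nonzero M M'
      unfolding affine_chart_eq by metis
  qed
  then obtain d \<phi> where "\<forall>p\<in>P. d p \<noteq> 0 \<and> \<phi> p \<in> P' \<and> M *v hom_coords p = d p *\<^sub>R (M' *v hom_coords (\<phi> p))"
    by metis
  then show thesis using that by (metis image_subsetI)
qed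

text \<open>The two transition maps are mutually inverse and lift to the linear maps
  \<open>N' ** M\<close> and \<open>N ** M'\<close> on homogeneous coordinates. Both are defined on
  an entire convex set, so both preserve open segments.\<close>

lemma comb_equiv_charts:
  assumes M: "invertible M" and M': "invertible M'" and conv: "convex P" "convex P'"
    and eq: "affine_chart M ` P = affine_chart M' ` P'"
  shows "comb_equiv P P'"
proof -
  obtain d \<phi> where d: "\<And>p. p \<in> P \<Longrightarrow> d p \<noteq> (0::real)" "\<phi> ` P \<subseteq> P'"
    "\<And>p. p \<in> P \<Longrightarrow> M *v hom_coords p = d p *\<^sub>R (M' *v hom_coords (\<phi> p))"
    using chart_transition[OF M M', of P P'] eq by blast
  obtain e \<psi> where e: "\<And>p. p \<in> P' \<Longrightarrow> e p \<noteq> (0::real)" "\<psi> ` P' \<subseteq> P"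
    "\<And>p. p \<in> P' \<Longrightarrow> M' *v hom_coords p = e p *\<^sub>R (M *v hom_coords (\<psi> p))"
    using chart_transition[OF M' M, of P' P] eq by blast
  obtain N N' where N: "N ** M = mat 1" and N': "N' ** M' = mat 1"
    using M M' unfolding invertible_def by blast
  \<comment> \<open>The last entry of \<open>hom_coords\<close> is 1, which forces
    \<open>c = 1\<close>.\<close>
  have lift: "p = q" if "A ** B = mat 1" "B *v hom_coords p = c *\<^sub>R (B *v hom_coords q)"
    for A B :: "real ^ 4 ^ 4" and c p q
  proof -
    have "A *v (B *v hom_coords p) = A *v (c *\<^sub>R (B *v hom_coords q))" using that by simp
    then have "hom_coords p = c *\<^sub>R hom_coords q"
      by (simp only: matrix_vector_mul_lid_inv[OF that(1)] matrix_vector_mult_scaleR)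
    then show ?thesis by (simp add: hom_coords_def vec_eq_iff forall_4 forall_3)
  qed
  have \<psi>\<phi>: "\<psi> (\<phi> p) = p" if "p \<in> P" for p
  proof -
    have "\<phi> p \<in> P'" using that d(2) by blast
    then have "M *v hom_coords p = (d p * e (\<phi> p)) *\<^sub>R (M *v hom_coords (\<psi> (\<phi> p)))"
      using d(3)[OF that] e(3)[of "\<phi> p"] by simp
    then show ?thesis using lift[OF N] by metis
  qed
  have \<phi>\<psi>: "\<phi> (\<psi> p) = p" if "p \<in> P'" for p
  proof -
    have "\<psi> p \<in> P" using that e(2) by blast
    then have "M' *v hom_coords p = (e p * d (\<psi> p)) *\<^sub>R (M' *v hom_coords (\<phi> (\<psi> p)))"
      using e(3)[OF that] d(3)[of "\<psi> p"] by simp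
    then show ?thesis using lift[OF N'] by metis
  qed
  have tr: "(N' ** M) *v hom_coords p = d p *\<^sub>R hom_coords (\<phi> p)" if "p \<in> P" for p
    by (simp only: matrix_vector_mul_assoc[symmetric] d(3)[OF that] matrix_vector_mult_scaleR
        matrix_vector_mul_lid_inv[OF N'])
  have tr': "(N ** M') *v hom_coords p = e p *\<^sub>R hom_coords (\<psi> p)" if "p \<in> P'" for p
    by (simp only: matrix_vector_mul_assoc[symmetric] e(3)[OF that] matrix_vector_mult_scaleR
        matrix_vector_mul_lid_inv[OF N])
  have inj: "inj_on \<phi> P" "inj_on \<psi> P'" using \<psi>\<phi> \<phi>\<psi> by (metis inj_onI)+
  show ?thesis
  proof (rule comb_equiv_open_segment[OF \<psi>\<phi> \<phi>\<psi> d(2) e(2) _ _ conv])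
    show "\<phi> y \<in> open_segment (\<phi> a) (\<phi> b)" if "a \<in> P" "b \<in> P" "y \<in> open_segment a b" for a b y
      using chart_transition_open_segment[OF conv(1) d(1) tr inj(1) that] .
    show "\<psi> y \<in> open_segment (\<psi> a) (\<psi> b)" if "a \<in> P'" "b \<in> P'" "y \<in> open_segment a b" for a b y
      using chart_transition_open_segment[OF conv(2) e(1) tr' inj(2) that] .
  qed
qed

lemma has_comb_type_unique:
  assumes "has_comb_type K Q" "has_comb_type K Q'" shows "comb_equiv Q Q'"
proof -
  obtain M P where P: "invertible M" "polytope P" "K = affine_chart M ` P" "comb_equiv P Q"
    using assms(1) unfolding has_comb_type_def by blast
  obtain M' P' where P': "invertible M'" "polytope P'" "K = affine_chart M' ` P'" "comb_equiv P' Q'"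
    using assms(2) unfolding has_comb_type_def by blast
  have "comb_equiv P P'"
    using comb_equiv_charts[OF P(1) P'(1) polytope_imp_convex[OF P(2)] polytope_imp_convex[OF P'(2)]]
      P(3) P'(3) by simp
  from comb_equiv_trans[OF this P'(4)] show ?thesis
    by (rule comb_equiv_trans[OF comb_equiv_sym[OF P(4)]])
qed

lemma has_comb_type_proj_map:
  assumes "has_comb_type K Q" "invertible A"
  shows "has_comb_type (proj_map A ` K) Q"
proof -
  obtain M P where P: "invertible M" "polytope P" "K = affine_chart M ` P" "comb_equiv P Q"
    using assms(1) unfolding has_comb_type_def by blast
  have "proj_map A (affine_chart M p) = affine_chart (A ** M) p" for p
    using proj_map_pt invertible_mult_nonzero[OF P(1) hom_coords_nonzero]
    by (simp add: affine_chart_eq matrix_vector_mul_assoc)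
  then have "proj_map A ` K = affine_chart (A ** M) ` P" using P(3) by (simp add: image_image)
  then show ?thesis
    unfolding has_comb_type_def using P(2,4) invertible_mult[OF assms(2) P(1)] by blast
qed

section \<open>The face lattice of a polyhedron given by inequalities\<close>

definition affine_fun :: "('a::real_vector \<Rightarrow> real) \<Rightarrow> bool" where
  "affine_fun c \<longleftrightarrow> (\<forall>x y u. c ((1 - u) *\<^sub>R x + u *\<^sub>R y) = (1 - u) * c x + u * c y)"

definition polyh :: "('a \<Rightarrow> real) list \<Rightarrow> 'a set" where
  "polyh cs = {x. \<forall>i<length cs. 0 \<le> (cs ! i) x}"

definition active :: "('a \<Rightarrow> real) list \<Rightarrow> 'a \<Rightarrow> nat set" where
  "active cs x = {i. i < length cs \<and> (cs ! i) x = 0}"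

definition face_at :: "('a \<Rightarrow> real) list \<Rightarrow> nat set \<Rightarrow> 'a set" where
  "face_at cs A = {x \<in> polyh cs. A \<subseteq> active cs x}"

text \<open>Every nonempty face is coded by the inequalities tight on all of it. The full index set
  is added as the code of the empty face, which \<open>face_of\<close> admits.\<close>

definition face_codes :: "('a \<Rightarrow> real) list \<Rightarrow> nat set set" where
  "face_codes cs = insert {..<length cs} (active cs ` polyh cs)"

lemma affine_funD:
  "affine_fun c \<Longrightarrow> c ((1 - u) *\<^sub>R x + u *\<^sub>R y) = (1 - u) * c x + u * c y"
  by (simp add: affine_fun_def)

text \<open>With strictly positive weights a sum of two nonnegative terms vanishes only if both
  terms do.\<close>

lemma polyh_segment:
  assumes "\<forall>c\<in>set cs. affine_fun c" "x \<in> polyh cs" "y \<in> polyh cs" "0 < u" "u < 1"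
  shows "(1 - u) *\<^sub>R x + u *\<^sub>R y \<in> polyh cs"
    and "active cs ((1 - u) *\<^sub>R x + u *\<^sub>R y) = active cs x \<inter> active cs y"
proof -
  have eq: "(cs ! i) ((1 - u) *\<^sub>R x + u *\<^sub>R y) = (1 - u) * (cs ! i) x + u * (cs ! i) y"
    if "i < length cs" for i
    using assms(1) that by (simp add: affine_funD)
  have nn: "0 \<le> (cs ! i) x" "0 \<le> (cs ! i) y" if "i < length cs" for i
    using assms(2,3) that by (auto simp: polyh_def)
  show "(1 - u) *\<^sub>R x + u *\<^sub>R y \<in> polyh cs"
    unfolding polyh_def using eq nn assms by simp
  have "(1 - u) * (cs ! i) x + u * (cs ! i) y = 0 \<longleftrightarrow> (cs ! i) x = 0 \<and> (cs ! i) y = 0"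
    if "i < length cs" for i
    using nn[OF that] assms(4,5) by (subst add_nonneg_eq_0_iff) auto
  then show "active cs ((1 - u) *\<^sub>R x + u *\<^sub>R y) = active cs x \<inter> active cs y"
    unfolding active_def using eq by auto
qed

text \<open>A midpoint realises the intersection of two active sets; iterating handles any finite
  nonempty family.\<close>

lemma active_Inter:
  assumes aff: "\<forall>c\<in>set cs. affine_fun c"
    and T: "finite T" "T \<noteq> {}" "T \<subseteq> active cs ` polyh cs"
  shows "\<Inter>T \<in> active cs ` polyh cs"
  using T
proof (induction T rule: finite_ne_induct)
  case (insert A T)
  then obtain x y where "x \<in> polyh cs" "A = active cs x" "y \<in> polyh cs" "\<Inter>T = active cs y" by auto
  then have "\<Inter>(insert A T) = active cs ((1 - 1/2) *\<^sub>R x + (1/2) *\<^sub>R y)"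
    "(1 - 1/2) *\<^sub>R x + (1/2) *\<^sub>R y \<in> polyh cs"
    using polyh_segment[OF aff, of x y "1/2"] by auto
  then show ?case by blast
qed auto

lemma convex_polyh:
  assumes "\<forall>c\<in>set cs. affine_fun c" shows "convex (polyh cs)"
  unfolding convex_contains_open_segment
  using polyh_segment(1)[OF assms] by (auto simp: in_segment)

lemma face_at_face_of:
  assumes aff: "\<forall>c\<in>set cs. affine_fun c" shows "face_at cs A face_of polyh cs"
  unfolding face_of_def
proof (intro conjI ballI impI)
  show "face_at cs A \<subseteq> polyh cs" by (auto simp: face_at_def)
  show "convex (face_at cs A)"
    unfolding convex_contains_open_segment
  proof (intro ballI subsetI)
    fix a b x assume ab: "a \<in> face_at cs A" "b \<in> face_at cs A" and "x \<in> open_segment a b"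
    then obtain u where "0 < u" "u < 1" "x = (1 - u) *\<^sub>R a + u *\<^sub>R b" by (auto simp: in_segment)
    then show "x \<in> face_at cs A" using polyh_segment[OF aff, of a b u] ab by (simp add: face_at_def)
  qed
  fix a b x assume "a \<in> polyh cs" "b \<in> polyh cs" "x \<in> face_at cs A" "x \<in> open_segment a b"
  moreover then obtain u where "0 < u" "u < 1" "x = (1 - u) *\<^sub>R a + u *\<^sub>R b"
    by (auto simp: in_segment)
  ultimately have "A \<subseteq> active cs a \<inter> active cs b"
    using polyh_segment(2)[OF aff] unfolding face_at_def by auto
  then show "a \<in> face_at cs A" "b \<in> face_at cs A"
    using \<open>a \<in> polyh cs\<close> \<open>b \<in> polyh cs\<close> by (auto simp: face_at_def)
qed

text \<open>The segment from \<open>y\<close> to \<open>x\<close> can be prolonged a little beyond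
  \<open>x\<close>: constraints tight at \<open>x\<close> vanish at both points and stay zero, and
  the remaining ones have slack at \<open>x\<close>.\<close>

lemma polyh_extend:
  assumes aff: "\<forall>c\<in>set cs. affine_fun c"
    and x: "x \<in> polyh cs" and y: "y \<in> polyh cs" and sub: "active cs x \<subseteq> active cs y"
  obtains e where "0 < e" "(1 - (- e)) *\<^sub>R x + (- e) *\<^sub>R y \<in> polyh cs"
proof -
  have "\<exists>e>0. \<forall>i<length cs. e * (cs ! i) y \<le> (cs ! i) x"
  proof -
    have ex: "\<exists>e>0. \<forall>d. 0 < d \<and> d \<le> e \<longrightarrow> d * (cs ! i) y \<le> (cs ! i) x" if i: "i < length cs" for i
    proof (cases "i \<in> active cs x")
      case True
      then have "(cs ! i) y = 0" "(cs ! i) x = 0" using sub by (auto simp: active_def)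
      then show ?thesis by (intro exI[of _ 1]) simp
    next
      case False
      then have pos: "0 < (cs ! i) x" using x i by (force simp: active_def polyh_def)
      have nn: "0 \<le> (cs ! i) y" using y i by (auto simp: polyh_def)
      \<comment> \<open>The added 1 keeps the denominator positive when the constraint vanishes at
        \<open>y\<close>.\<close>
      let ?e = "(cs ! i) x / ((cs ! i) y + 1)"
      have "d * (cs ! i) y \<le> (cs ! i) x" if "0 < d" "d \<le> ?e" for d
      proof -
        have "d * ((cs ! i) y + 1) \<le> (cs ! i) x" using that nn by (simp add: pos_le_divide_eq)
        then show ?thesis using that by (simp add: algebra_simps)
      qed
      moreover have "0 < ?e" using pos nn by simp
      ultimately show ?thesis by blast
    qed
    then obtain f where f: "\<And>i. i < length cs \<Longrightarrow> 0 < f i"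
      "\<And>i d. i < length cs \<Longrightarrow> 0 < d \<Longrightarrow> d \<le> f i \<Longrightarrow> d * (cs ! i) y \<le> (cs ! i) x"
      by metis
    let ?e = "Min (insert 1 (f ` {..<length cs}))"
    have "0 < ?e" using f(1) by (subst Min_gr_iff) auto
    moreover have "?e \<le> f i" if "i < length cs" for i using that by (intro Min_le) auto
    ultimately show ?thesis using f(2) by blast
  qed
  then obtain e where e: "e > 0" "\<And>i. i < length cs \<Longrightarrow> e * (cs ! i) y \<le> (cs ! i) x" by blast
  have "0 \<le> (cs ! i) ((1 - (- e)) *\<^sub>R x + (- e) *\<^sub>R y)" if i: "i < length cs" for i
  proof -
    have "(cs ! i) ((1 - (- e)) *\<^sub>R x + (- e) *\<^sub>R y) = (1 - (- e)) * (cs ! i) x + (- e) * (cs ! i) y"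
      using aff i affine_funD by (metis nth_mem)
    moreover have "0 \<le> e * (cs ! i) x" using x i e(1) by (auto simp: polyh_def)
    ultimately show ?thesis using e(2)[OF i] by (simp add: algebra_simps)
  qed
  then show thesis using that[OF e(1)] by (simp add: polyh_def)
qed

text \<open>A point \<open>x\<close> of \<open>F\<close> with the fewest active constraints behaves
  like a relative interior point: by minimality its midpoint with any \<open>y\<close> in
  \<open>F\<close> shows that what is tight at \<open>x\<close> is tight at \<open>y\<close>.
  Conversely, if \<open>y\<close> satisfies these equations, prolonging the segment beyond
  \<open>x\<close> puts \<open>x\<close> in the open segment from \<open>y\<close> to a point of the
  polyhedron, so the face property gives \<open>y\<close> in \<open>F\<close>.\<close>

lemma face_of_polyh_eq:
  assumes aff: "\<forall>c\<in>set cs. affine_fun c" and F: "F face_of polyh cs" "F \<noteq> {}"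
  obtains x where "x \<in> polyh cs" "F = face_at cs (active cs x)"
proof -
  have FP: "F \<subseteq> polyh cs" using F face_of_imp_subset by blast
  obtain x where x: "x \<in> F" and min: "\<And>y. y \<in> F \<Longrightarrow> card (active cs x) \<le> card (active cs y)"
    using arg_min_nat_lemma[of "\<lambda>x. x \<in> F" _ "\<lambda>x. card (active cs x)"] F(2) by blast
  have fin: "finite (active cs z)" for z by (simp add: active_def)
  have sub: "active cs x \<subseteq> active cs y" if y: "y \<in> F" for y
  proof -
    let ?m = "(1 - 1/2) *\<^sub>R x + (1/2) *\<^sub>R y"
    have "?m \<in> F"
      by (rule convexD_alt[OF face_of_imp_convex[OF F(1)] x y]) auto
    moreover have "active cs ?m = active cs x \<inter> active cs y"
      using polyh_segment(2)[OF aff, of x y "1/2"] x y FP by auto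
    ultimately have "card (active cs x) \<le> card (active cs x \<inter> active cs y)" using min by metis
    then show ?thesis using fin by (metis card_seteq inf_le1 inf.absorb_iff1)
  qed
  have "F = face_at cs (active cs x)"
  proof
    show "F \<subseteq> face_at cs (active cs x)" using FP sub by (auto simp: face_at_def)
    show "face_at cs (active cs x) \<subseteq> F"
    proof
      fix y assume y: "y \<in> face_at cs (active cs x)"
      show "y \<in> F"
      proof (cases "y = x")
        case False
        have yP: "y \<in> polyh cs" and "active cs x \<subseteq> active cs y" using y by (auto simp: face_at_def)
        then obtain e where e: "0 < e" "(1 - (- e)) *\<^sub>R x + (- e) *\<^sub>R y \<in> polyh cs" (is "?z \<in> _")
          using polyh_extend[OF aff] x FP by blast
        \<comment> \<open>Solves x = (1 - u) y + u z for z = (1 + e) x - e y.\<close>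
        define u where "u = 1 / (1 + e)"
        have u: "u * (1 + e) = 1" "1 - u - u * e = 0" "0 < u" "u < 1"
          using e(1) by (simp_all add: u_def field_simps)
        have "x = (1 - u) *\<^sub>R y + u *\<^sub>R ?z"
        proof -
          have "(1 - u) *\<^sub>R y + u *\<^sub>R ?z = (1 - u - u * e) *\<^sub>R y + (u * (1 + e)) *\<^sub>R x"
            by (simp add: algebra_simps)
          then show ?thesis using u by simp
        qed
        moreover have "y \<noteq> ?z"
        proof
          assume "y = ?z"
          then have "(1 + e) *\<^sub>R (y - x) = 0" by (simp add: algebra_simps)
          then show False using e(1) False by simp
        qed
        ultimately have "x \<in> open_segment y ?z" unfolding in_segment using u(3,4) by blast
        then show ?thesis using F(1) yP e(2) x unfolding face_of_def by blast
      qed (use x in simp)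
    qed
  qed
  then show thesis using that x FP by blast
qed

lemma face_at_subset_iff:
  assumes "A \<in> face_codes cs" "B \<in> face_codes cs" and I: "{..<length cs} \<notin> active cs ` polyh cs"
  shows "face_at cs A \<subseteq> face_at cs B \<longleftrightarrow> B \<subseteq> A"
proof
  assume sub: "face_at cs A \<subseteq> face_at cs B"
  have B: "B \<subseteq> {..<length cs}" using assms(2) by (auto simp: face_codes_def active_def)
  consider "A = {..<length cs}" | x where "x \<in> polyh cs" "A = active cs x"
    using assms(1) by (auto simp: face_codes_def)
  then show "B \<subseteq> A"
  proof cases
    case 2
    then have "x \<in> face_at cs A" by (simp add: face_at_def)
    then show ?thesis using sub 2 by (auto simp: face_at_def)
  qed (use B in simp)
qed (auto simp: face_at_def)

lemma bij_betw_face_at: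
  assumes aff: "\<forall>c\<in>set cs. affine_fun c" and I: "{..<length cs} \<notin> active cs ` polyh cs"
  shows "bij_betw (face_at cs) (face_codes cs) {F. F face_of polyh cs}"
  unfolding bij_betw_def
proof
  show "inj_on (face_at cs) (face_codes cs)"
    using face_at_subset_iff[OF _ _ I] by (auto intro!: inj_onI)
  have empty: "face_at cs {..<length cs} = {}"
  proof -
    have "x \<notin> face_at cs {..<length cs}" for x
    proof
      assume "x \<in> face_at cs {..<length cs}"
      then have "x \<in> polyh cs" "active cs x = {..<length cs}" by (auto simp: face_at_def active_def)
      then show False using I by (metis imageI)
    qed
    then show ?thesis by blast
  qed
  show "face_at cs ` face_codes cs = {F. F face_of polyh cs}"
  proof
    show "face_at cs ` face_codes cs \<subseteq> {F. F face_of polyh cs}"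
      using face_at_face_of[OF aff] by auto
    show "{F. F face_of polyh cs} \<subseteq> face_at cs ` face_codes cs"
    proof
      fix F assume F: "F \<in> {F. F face_of polyh cs}"
      show "F \<in> face_at cs ` face_codes cs"
      proof (cases "F = {}")
        case True
        then show ?thesis using empty unfolding face_codes_def by blast
      next
        case False
        then show ?thesis using F face_of_polyh_eq[OF aff, of F] unfolding face_codes_def
          by (metis image_eqI insertI2 mem_Collect_eq)
      qed
    qed
  qed
qed

text \<open>The family of codes, ordered by reverse inclusion, is the face lattice. Equality of the
  two families presupposes that corresponding facets are listed at the same index.\<close>

lemma comb_equiv_polyh:
  assumes cs: "\<forall>c\<in>set cs. affine_fun c" and ds: "\<forall>d\<in>set ds. affine_fun d"
    and len: "length cs = length ds" and eq: "active cs ` polyh cs = active ds ` polyh ds"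
    and I: "{..<length cs} \<notin> active cs ` polyh cs"
  shows "comb_equiv (polyh cs) (polyh ds)"
proof -
  have codes: "face_codes ds = face_codes cs" and I': "{..<length ds} \<notin> active ds ` polyh ds"
    using len eq I by (simp_all add: face_codes_def)
  let ?g = "the_inv_into (face_codes cs) (face_at cs)"
  have b: "bij_betw (face_at cs) (face_codes cs) {F. F face_of polyh cs}"
    by (rule bij_betw_face_at[OF cs I])
  have g: "bij_betw ?g {F. F face_of polyh cs} (face_codes cs)"
    by (rule bij_betw_the_inv_into[OF b])
  have "bij_betw (face_at ds \<circ> ?g) {F. F face_of polyh cs} {F. F face_of polyh ds}"
    using bij_betw_trans[OF g] bij_betw_face_at[OF ds I'] codes by simp
  moreover have "F \<subseteq> F' \<longleftrightarrow> (face_at ds \<circ> ?g) F \<subseteq> (face_at ds \<circ> ?g) F'"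
    if F: "F face_of polyh cs" "F' face_of polyh cs" for F F'
  proof -
    have mem: "?g F \<in> face_codes cs" "?g F' \<in> face_codes cs"
      using F g by (auto simp: bij_betw_def)
    have "F \<subseteq> F' \<longleftrightarrow> face_at cs (?g F) \<subseteq> face_at cs (?g F')"
      using F by (simp add: f_the_inv_into_f_bij_betw[OF b])
    also have "\<dots> \<longleftrightarrow> ?g F' \<subseteq> ?g F" by (rule face_at_subset_iff[OF mem I])
    also have "\<dots> \<longleftrightarrow> face_at ds (?g F) \<subseteq> face_at ds (?g F')"
      using mem by (intro face_at_subset_iff[OF _ _ I', symmetric]) (simp_all add: codes)
    finally show ?thesis by simp
  qed
  ultimately show ?thesis unfolding comb_equiv_def by blast
qed

section \<open>Face codes as finite simplicial complexes that can be evaluated\<close>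

definition nonface_free :: "nat list list \<Rightarrow> nat list \<Rightarrow> bool" where
  "nonface_free ms A \<longleftrightarrow> list_all (\<lambda>m. \<not> list_all (\<lambda>i. i \<in> set A) m) ms"

text \<open>The abstract simplicial complex on n vertices whose generating nonfaces are
  \<open>ms\<close>; its vertices stand for the facets of the polytope.\<close>

definition nerve :: "nat \<Rightarrow> nat list list \<Rightarrow> nat set set" where
  "nerve n ms = set ` {A \<in> set (subseqs [0..<n]). nonface_free ms A}"

text \<open>An executable test that each simplex of the complex is the intersection of a nonempty
  set of members of \<open>vs\<close>: one member contains it, and each index outside it is missed
  by some member containing it.\<close>

definition nerve_generated :: "nat \<Rightarrow> nat list list \<Rightarrow> nat list list \<Rightarrow> bool" where
  "nerve_generated n vs ms \<longleftrightarrow> list_all (\<lambda>A. nonface_free ms A \<longrightarrow>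
     list_ex (\<lambda>V. list_all (\<lambda>j. j \<in> set V) A) vs \<and>
     list_all (\<lambda>i. i \<in> set A \<or> list_ex (\<lambda>V. list_all (\<lambda>j. j \<in> set V) A \<and> i \<notin> set V) vs) [0..<n])
     (subseqs [0..<n])"

text \<open>The nonfaces bound the active sets from above, by inconsistency of inequalities. From
  below, each simplex is an intersection of active sets of the sample points \<open>xs\<close>,
  which \<open>active_Inter\<close> realises. Thus no enumeration of faces by geometry is
  involved.\<close>

lemma active_eq_nerve:
  assumes aff: "\<forall>c\<in>set cs. affine_fun c" and n: "length cs = n"
    and xs: "\<forall>x\<in>set xs. x \<in> polyh cs"
    and vs: "map (\<lambda>x. filter (\<lambda>i. (cs ! i) x = 0) [0..<n]) xs = vs"
    and ms: "\<forall>m\<in>set ms. \<forall>x\<in>polyh cs. \<not> (\<forall>i\<in>set m. (cs ! i) x = 0)"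
    and gen: "nerve_generated n vs ms"
  shows "active cs ` polyh cs = nerve n ms"
proof
  show "active cs ` polyh cs \<subseteq> nerve n ms"
  proof
    fix S assume "S \<in> active cs ` polyh cs"
    then obtain x where x: "x \<in> polyh cs" "S = active cs x" by blast
    then have "S \<in> Pow (set [0..<n])" using n by (auto simp: active_def)
    then obtain A where A: "A \<in> set (subseqs [0..<n])" "S = set A"
      unfolding subseqs_powset[symmetric] by blast
    have "\<not> (\<forall>i\<in>set m. i \<in> set A)" if "m \<in> set ms" for m
      using ms that x A(2)[symmetric] unfolding active_def by blast
    then have "nonface_free ms A" by (auto simp: nonface_free_def list_all_iff)
    then show "S \<in> nerve n ms" using A by (auto simp: nerve_def)
  qed
  show "nerve n ms \<subseteq> active cs ` polyh cs"
  proof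
    fix S assume "S \<in> nerve n ms"
    then obtain A where A: "A \<in> set (subseqs [0..<n])" "nonface_free ms A" "S = set A"
      by (auto simp: nerve_def)
    let ?T = "{V \<in> set ` set vs. set A \<subseteq> V}"
    have V: "V \<in> active cs ` polyh cs" if V: "V \<in> set ` set vs" for V
    proof -
      obtain v where v: "v \<in> set vs" "V = set v" using V by blast
      then obtain x where "x \<in> set xs" "filter (\<lambda>i. (cs ! i) x = 0) [0..<n] = v"
        unfolding vs[symmetric] by auto
      with xs have x: "x \<in> polyh cs" "filter (\<lambda>i. (cs ! i) x = 0) [0..<n] = v" by auto
      then have "set (filter (\<lambda>i. (cs ! i) x = 0) [0..<n]) = V" using v by simp
      then have "V = active cs x" using n by (auto simp: active_def)
      then show ?thesis using x by blast
    qed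
    have gen': "list_ex (\<lambda>V. list_all (\<lambda>j. j \<in> set V) A) vs"
      "list_all (\<lambda>i. i \<in> set A \<or> list_ex (\<lambda>V. list_all (\<lambda>j. j \<in> set V) A \<and> i \<notin> set V) vs) [0..<n]"
      using gen A(1,2) unfolding nerve_generated_def list_all_iff[of _ "subseqs _"] by blast+
    have ne: "?T \<noteq> {}"
    proof -
      obtain V where "V \<in> set vs" "\<forall>j\<in>set A. j \<in> set V"
        using gen'(1) by (auto simp: list_ex_iff list_all_iff)
      then have "set V \<in> ?T" by auto
      then show ?thesis by blast
    qed
    have sep: "\<exists>V\<in>?T. i \<notin> V" if i: "i < n" "i \<notin> set A" for i
    proof -
      obtain V where "V \<in> set vs" "\<forall>j\<in>set A. j \<in> set V" "i \<notin> set V"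
        using gen'(2) i by (auto simp: list_ex_iff list_all_iff)
      then have "set V \<in> ?T" "i \<notin> set V" by auto
      then show ?thesis by blast
    qed
    have sub: "V \<subseteq> {..<n}" if "V \<in> ?T" for V
      using V[of V] that n by (auto simp: active_def)
    have "\<Inter>?T = set A"
    proof
      show "\<Inter>?T \<subseteq> set A"
      proof
        fix i assume i: "i \<in> \<Inter>?T"
        then have "i < n" using ne sub by blast
        then show "i \<in> set A" using sep i by blast
      qed
    qed auto
    moreover have "\<Inter>?T \<in> active cs ` polyh cs"
      using V ne by (intro active_Inter[OF aff]) auto
    ultimately show "S \<in> active cs ` polyh cs" using A by simp
  qed
qed

text \<open>This invariant separates the four types; the \<open>f\<close>-vector does not, as cube and dumpling share it.\<close>

definition face_counts :: "'a::real_vector set \<Rightarrow> nat set" where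
  "face_counts P = (\<lambda>F. card {F'. F' face_of P \<and> F' \<subseteq> F}) ` {F. F face_of P}"

lemma comb_equiv_face_counts:
  assumes "comb_equiv P Q" shows "face_counts P = face_counts Q"
proof -
  obtain f where f: "bij_betw f {F. F face_of P} {F. F face_of Q}"
    and mono: "\<And>F F'. F face_of P \<Longrightarrow> F' face_of P \<Longrightarrow> F \<subseteq> F' \<longleftrightarrow> f F \<subseteq> f F'"
    using assms unfolding comb_equiv_def by blast
  have fim: "f ` {F. F face_of P} = {F. F face_of Q}" and inj: "inj_on f {F. F face_of P}"
    using f by (auto simp: bij_betw_def)
  have "card {F'. F' face_of P \<and> F' \<subseteq> F} = card {F'. F' face_of Q \<and> F' \<subseteq> f F}"
    if F: "F face_of P" for F
  proof -
    have "f ` {F'. F' face_of P \<and> F' \<subseteq> F} = {F'. F' face_of Q \<and> F' \<subseteq> f F}"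
    proof
      show "f ` {F'. F' face_of P \<and> F' \<subseteq> F} \<subseteq> {F'. F' face_of Q \<and> F' \<subseteq> f F}"
        using fim mono F by blast
      show "{F'. F' face_of Q \<and> F' \<subseteq> f F} \<subseteq> f ` {F'. F' face_of P \<and> F' \<subseteq> F}"
      proof
        fix E assume E: "E \<in> {F'. F' face_of Q \<and> F' \<subseteq> f F}"
        then have "E \<in> f ` {F. F face_of P}" unfolding fim by blast
        then obtain E' where "E' face_of P" "E = f E'" by blast
        then show "E \<in> f ` {F'. F' face_of P \<and> F' \<subseteq> F}" using E mono F by blast
      qed
    qed
    then show ?thesis by (metis (no_types, lifting) card_image inj inj_on_subset mem_Collect_eq subsetI)
  qed
  then have "face_counts P = (\<lambda>F. card {F'. F' face_of Q \<and> F' \<subseteq> F}) ` f ` {F. F face_of P}"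
    unfolding face_counts_def image_image by (intro image_cong) auto
  then show ?thesis unfolding fim face_counts_def .
qed

definition code_lists :: "nat \<Rightarrow> nat list list \<Rightarrow> nat list list" where
  "code_lists n ms = filter (\<lambda>A. A = [0..<n] \<or> nonface_free ms A) (subseqs [0..<n])"

text \<open>Codes reverse inclusion, so the faces below the one coded by \<open>A\<close> are those
  whose codes contain \<open>A\<close>.\<close>

definition nerve_counts :: "nat \<Rightarrow> nat list list \<Rightarrow> nat list" where
  "nerve_counts n ms = map (\<lambda>A.
     length (filter (\<lambda>B. list_all (\<lambda>i. i \<in> set B) A) (code_lists n ms))) (code_lists n ms)"

lemma nerve_proper:
  assumes "\<not> nonface_free ms [0..<n]" shows "{..<n} \<notin> nerve n ms"
proof
  assume "{..<n} \<in> nerve n ms"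
  then obtain A where A: "nonface_free ms A" "set A = {..<n}" unfolding nerve_def by auto
  then have "nonface_free ms [0..<n]" unfolding nonface_free_def by (auto simp: list_all_iff)
  then show False using assms by blast
qed

lemma face_counts_polyh:
  assumes aff: "\<forall>c\<in>set cs. affine_fun c" and n: "length cs = n"
    and act: "active cs ` polyh cs = nerve n ms" and ms: "\<not> nonface_free ms [0..<n]"
  shows "face_counts (polyh cs) = set (nerve_counts n ms)"
proof -
  have I: "{..<length cs} \<notin> active cs ` polyh cs" unfolding act n by (rule nerve_proper[OF ms])
  have codes: "face_codes cs = set ` set (code_lists n ms)"
  proof -
    have "set (subseqs [0..<n]) \<inter> {[0..<n]} = {[0..<n]}"
      by (simp add: subseqs_refl)
    then have "set (code_lists n ms) = insert [0..<n] {A \<in> set (subseqs [0..<n]). nonface_free ms A}"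
      unfolding code_lists_def by auto
    then show ?thesis
      unfolding face_codes_def act nerve_def by (simp add: n atLeast0LessThan)
  qed
  have dist: "distinct (map set (code_lists n ms))"
    unfolding code_lists_def by (rule distinct_map_filter[OF distinct_set_subseqs]) simp
  note bij = bij_betw_face_at[OF aff I]
  have faces: "{F. F face_of polyh cs} = face_at cs ` face_codes cs"
    and inj: "inj_on (face_at cs) (face_codes cs)" using bij by (auto simp: bij_betw_def)
  have "card {F'. F' face_of polyh cs \<and> F' \<subseteq> face_at cs (set A)}
      = length (filter (\<lambda>B. list_all (\<lambda>i. i \<in> set B) A) (code_lists n ms))"
    if A: "A \<in> set (code_lists n ms)" for A
  proof -
    have "{F'. F' face_of polyh cs \<and> F' \<subseteq> face_at cs (set A)}
        = {F' \<in> face_at cs ` face_codes cs. F' \<subseteq> face_at cs (set A)}" using faces by blast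
    also have "\<dots> = face_at cs ` {B \<in> face_codes cs. set A \<subseteq> B}"
      using face_at_subset_iff[OF _ _ I] A codes by auto
    also have "card \<dots> = card {B \<in> face_codes cs. set A \<subseteq> B}"
      by (rule card_image) (use inj in \<open>auto intro: inj_on_subset\<close>)
    also have "{B \<in> face_codes cs. set A \<subseteq> B}
        = set (map set (filter (\<lambda>B. list_all (\<lambda>i. i \<in> set B) A) (code_lists n ms)))"
      unfolding codes by (auto simp: list_all_iff)
    also have "card \<dots> = length (filter (\<lambda>B. list_all (\<lambda>i. i \<in> set B) A) (code_lists n ms))"
      by (subst distinct_card) (use dist in \<open>auto intro: distinct_map_filter\<close>)
    finally show ?thesis .
  qed
  then show ?thesis
    unfolding face_counts_def faces codes image_image nerve_counts_def by (auto simp: image_iff)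
qed

lemma mem_polyh: "x \<in> polyh cs \<longleftrightarrow> list_all (\<lambda>c. 0 \<le> c x) cs"
  by (simp add: polyh_def list_all_length)

text \<open>Subtracting \<open>c 0\<close> leaves a linear function, represented by the inner
  product with \<open>adjoint g 1\<close>. Additivity comes from the midpoint of 2x and 2y.\<close>

lemma affine_fun_polyhedron:
  fixes c :: "'a::euclidean_space \<Rightarrow> real"
  assumes "affine_fun c" shows "polyhedron {x. 0 \<le> c x}"
proof -
  define g where "g x = c x - c 0" for x
  have sc: "g (u *\<^sub>R x) = u * g x" for u x
    using affine_funD[OF assms, of u 0 x] by (simp add: g_def algebra_simps)
  have "g (x + y) = g x + g y" for x y
    using affine_funD[OF assms, of "1/2" "2 *\<^sub>R x" "2 *\<^sub>R y"] sc[of 2 x] sc[of 2 y]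
    by (simp add: g_def)
  then have "linear g" by (intro linearI) (simp_all add: sc)
  then have "g x = adjoint g 1 \<bullet> x" for x
    using adjoint_works[of g x 1] by (simp add: inner_commute)
  then have eq: "c x - c 0 = adjoint g 1 \<bullet> x" for x by (simp add: g_def)
  have "{x. 0 \<le> c x} = {x. adjoint g 1 \<bullet> x \<ge> - c 0}"
    unfolding eq[symmetric] by (rule Collect_cong) linarith
  then show ?thesis by (simp only: polyhedron_halfspace_ge)
qed

lemma polytope_polyh:
  fixes cs :: "('a::euclidean_space \<Rightarrow> real) list"
  assumes aff: "\<forall>c\<in>set cs. affine_fun c" and bd: "bounded (polyh cs)"
  shows "polytope (polyh cs)"
proof -
  have "polyh cs = \<Inter>((\<lambda>c. {x. 0 \<le> c x}) ` set cs)"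
    by (auto simp: mem_polyh list_all_iff)
  also have "polyhedron \<dots>"
    by (rule polyhedron_Inter) (use aff affine_fun_polyhedron in auto)
  finally show ?thesis using bd by (simp add: polytope_eq_bounded_polyhedron)
qed

text \<open>The box with side from -2 to 2 holds all four chart polytopes; the bound 2 is attained
  at the vertex (2, 1, 0) of the prism.\<close>

lemma polytope_polyh_cart:
  fixes cs :: "(real ^ 3 \<Rightarrow> real) list"
  assumes "\<forall>c\<in>set cs. affine_fun c"
    and "\<And>p. p \<in> polyh cs \<Longrightarrow> - 2 \<le> p $ 1 \<and> p $ 1 \<le> 2 \<and> - 2 \<le> p $ 2 \<and> p $ 2 \<le> 2 \<and> - 2 \<le> p $ 3 \<and> p $ 3 \<le> 2"
  shows "polytope (polyh cs)"
proof (rule polytope_polyh[OF assms(1)])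
  have "polyh cs \<subseteq> cbox (\<chi> i. - 2) (\<chi> i. 2)"
    using assms(2) by (auto simp: mem_box_cart forall_3)
  then show "bounded (polyh cs)" using bounded_subset bounded_cbox by blast
qed

section \<open>The four combinatorial types\<close>

text \<open>In this list and the following ones the order matters: the same index names
  corresponding facets in a model and in the chart of a chamber, so that both have literally the
  same nonfaces and vertices.\<close>

definition tetrahedron_forms :: "((real \<times> real) \<times> real \<Rightarrow> real) list" where
  "tetrahedron_forms = [\<lambda>((x, y), z). x, \<lambda>((x, y), z). y, \<lambda>((x, y), z). z, \<lambda>((x, y), z). 1 - x - y - z]"

definition prism_forms :: "((real \<times> real) \<times> real \<Rightarrow> real) list" where
  "prism_forms = [\<lambda>((x, y), z). z, \<lambda>((x, y), z). 1 - z,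
     \<lambda>((x, y), z). x, \<lambda>((x, y), z). y, \<lambda>((x, y), z). 1 - x - y]"

definition cube_forms :: "((real \<times> real) \<times> real \<Rightarrow> real) list" where
  "cube_forms = [\<lambda>((x, y), z). x, \<lambda>((x, y), z). y, \<lambda>((x, y), z). z,
     \<lambda>((x, y), z). 1 - y, \<lambda>((x, y), z). 1 - z, \<lambda>((x, y), z). 1 - x]"

text \<open>The crushed side contributes no facet, since 0 \<le> y already follows from 0 \<le> z
  and z \<le> y. Indices 1 and 5 are the two pentagons, meeting along that side.\<close>

definition dumpling_forms :: "((real \<times> real) \<times> real \<Rightarrow> real) list" where
  "dumpling_forms = [\<lambda>((x, y), z). x + y, \<lambda>((x, y), z). z, \<lambda>((x, y), z). 5 - x - 2 * y,
     \<lambda>((x, y), z). 2 - x + y, \<lambda>((x, y), z). 3 + x - 2 * y, \<lambda>((x, y), z). y - z]"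

text \<open>The chart lists are the sign conditions of \<open>closed_cone (rep T)\<close> pulled
  back to the chart. For the tetrahedron two of the six conditions follow from the others, for the
  prism one does, and these are omitted.\<close>

definition tetrahedron_chart_forms :: "(real ^ 3 \<Rightarrow> real) list" where
  "tetrahedron_chart_forms = [\<lambda>p. p $ 1, \<lambda>p. - p $ 2, \<lambda>p. p $ 2 - p $ 1 - p $ 3, \<lambda>p. 1 + p $ 3]"

definition prism_chart_forms :: "(real ^ 3 \<Rightarrow> real) list" where
  "prism_chart_forms = [\<lambda>p. p $ 1, \<lambda>p. 1 - p $ 1 + p $ 2, \<lambda>p. p $ 2, \<lambda>p. - p $ 3, \<lambda>p. 1 - p $ 2 + p $ 3]"

definition cube_chart_forms :: "(real ^ 3 \<Rightarrow> real) list" where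
  "cube_chart_forms = [\<lambda>p. p $ 1, \<lambda>p. p $ 2, \<lambda>p. p $ 3,
     \<lambda>p. 1 - p $ 1 - 2 * p $ 2, \<lambda>p. 1 - p $ 2 - 2 * p $ 3, \<lambda>p. 1 - p $ 3 - 2 * p $ 1]"

definition dumpling_chart_forms :: "(real ^ 3 \<Rightarrow> real) list" where
  "dumpling_chart_forms = [\<lambda>p. p $ 1, \<lambda>p. p $ 2, \<lambda>p. 1 - p $ 1 - p $ 2,
     \<lambda>p. 1 - p $ 1 - p $ 3, \<lambda>p. p $ 3 - p $ 2 + 1, \<lambda>p. p $ 1 - p $ 2 - p $ 3]"

lemmas forms_defs = tetrahedron_forms_def prism_forms_def cube_forms_def dumpling_forms_def
  tetrahedron_chart_forms_def prism_chart_forms_def cube_chart_forms_def dumpling_chart_forms_def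

lemma length_forms:
  "length tetrahedron_forms = 4" "length prism_forms = 5" "length cube_forms = 6" "length dumpling_forms = 6"
  "length tetrahedron_chart_forms = 4" "length prism_chart_forms = 5"
  "length cube_chart_forms = 6" "length dumpling_chart_forms = 6"
  by (simp_all add: forms_defs)

lemma affine_forms:
  "\<forall>c\<in>set tetrahedron_forms. affine_fun c" "\<forall>c\<in>set prism_forms. affine_fun c"
  "\<forall>c\<in>set cube_forms. affine_fun c" "\<forall>c\<in>set dumpling_forms. affine_fun c"
  "\<forall>c\<in>set tetrahedron_chart_forms. affine_fun c" "\<forall>c\<in>set prism_chart_forms. affine_fun c"
  "\<forall>c\<in>set cube_chart_forms. affine_fun c" "\<forall>c\<in>set dumpling_chart_forms. affine_fun c"
  by (auto simp: forms_defs affine_fun_def algebra_simps)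

text \<open>The vertices (as sets of facets) and the minimal nonfaces of the dual simplicial complexes.\<close>

abbreviation "tetrahedron_nonfaces \<equiv> [[0, 1, 2, 3 :: nat]]"
abbreviation "prism_nonfaces \<equiv> [[0, 1], [2, 3, 4 :: nat]]"
abbreviation "cube_nonfaces \<equiv> [[0, 5], [1, 3], [2, 4 :: nat]]"
abbreviation "dumpling_nonfaces \<equiv> [[0, 2], [0, 3], [3, 4], [1, 4, 5], [1, 2, 5 :: nat]]"

abbreviation "tetrahedron_vertices \<equiv> [[0, 1, 2], [0, 1, 3], [0, 2, 3], [1, 2, 3 :: nat]]"
abbreviation "prism_vertices \<equiv>
  [[0, 2, 3], [0, 2, 4], [0, 3, 4], [1, 2, 3], [1, 2, 4], [1, 3, 4 :: nat]]"
abbreviation "cube_vertices \<equiv> [[0, 1, 2], [0, 1, 4], [0, 2, 3], [0, 3, 4],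
  [1, 2, 5], [1, 4, 5], [2, 3, 5], [3, 4, 5 :: nat]]"
abbreviation "dumpling_vertices \<equiv> [[0, 1, 4], [0, 1, 5], [0, 4, 5], [1, 3, 5],
  [1, 2, 4], [1, 2, 3], [2, 4, 5], [2, 3, 5 :: nat]]"

lemma nerve_generated_types:
  "nerve_generated 4 tetrahedron_vertices tetrahedron_nonfaces"
  "nerve_generated 5 prism_vertices prism_nonfaces"
  "nerve_generated 6 cube_vertices cube_nonfaces"
  "nerve_generated 6 dumpling_vertices dumpling_nonfaces"
  by code_simp+

lemma upt_values: "[0..<4] = [0, 1, 2, 3 :: nat]" "[0..<5] = [0, 1, 2, 3, 4 :: nat]"
  "[0..<6] = [0, 1, 2, 3, 4, 5 :: nat]"
  by code_simp+

text \<open>Here and in the seven lemmas that follow, \<open>xs\<close> gives the vertices in the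
  order of the list of facet sets.\<close>

lemma active_tetrahedron_forms:
  "active tetrahedron_forms ` polyh tetrahedron_forms = nerve 4 tetrahedron_nonfaces"
  by (rule active_eq_nerve[OF affine_forms(1) length_forms(1) _ _ _ nerve_generated_types(1),
      where xs = "[((0, 0), 0), ((0, 0), 1), ((0, 1), 0), ((1, 0), 0)]"])
    (auto simp: forms_defs mem_polyh upt_values)

lemma active_prism_forms:
  "active prism_forms ` polyh prism_forms = nerve 5 prism_nonfaces"
  by (rule active_eq_nerve[OF affine_forms(2) length_forms(2) _ _ _ nerve_generated_types(2),
      where xs = "[((0, 0), 0), ((0, 1), 0), ((1, 0), 0), ((0, 0), 1), ((0, 1), 1), ((1, 0), 1)]"])
    (auto simp: forms_defs mem_polyh upt_values)

lemma active_cube_forms: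
  "active cube_forms ` polyh cube_forms = nerve 6 cube_nonfaces"
  by (rule active_eq_nerve[OF affine_forms(3) length_forms(3) _ _ _ nerve_generated_types(3),
      where xs = "[((0, 0), 0), ((0, 0), 1), ((0, 1), 0), ((0, 1), 1), ((1, 0), 0), ((1, 0), 1), ((1, 1), 0), ((1, 1), 1)]"])
    (auto simp: forms_defs mem_polyh upt_values)

lemma active_dumpling_forms:
  "active dumpling_forms ` polyh dumpling_forms = nerve 6 dumpling_nonfaces"
  by (rule active_eq_nerve[OF affine_forms(4) length_forms(4) _ _ _ nerve_generated_types(4),
      where xs = "[((- 1, 1), 0), ((0, 0), 0), ((- 1, 1), 1), ((2, 0), 0), ((1, 2), 0), ((3, 1), 0), ((1, 2), 2), ((3, 1), 1)]"])
    (auto simp: forms_defs mem_polyh upt_values)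

lemma active_tetrahedron_chart_forms:
  "active tetrahedron_chart_forms ` polyh tetrahedron_chart_forms = nerve 4 tetrahedron_nonfaces"
  by (rule active_eq_nerve[OF affine_forms(5) length_forms(5) _ _ _ nerve_generated_types(1),
      where xs = "[vector [0, 0, 0], vector [0, 0, - 1], vector [0, - 1, - 1], vector [1, 0, - 1]]"])
    (auto simp: forms_defs mem_polyh upt_values)

lemma active_prism_chart_forms:
  "active prism_chart_forms ` polyh prism_chart_forms = nerve 5 prism_nonfaces"
  by (rule active_eq_nerve[OF affine_forms(6) length_forms(6) _ _ _ nerve_generated_types(2),
      where xs = "[vector [0, 0, 0], vector [0, 0, - 1], vector [0, 1, 0], vector [1, 0, 0], vector [1, 0, - 1], vector [2, 1, 0]]"])
    (auto simp: forms_defs mem_polyh upt_values)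

lemma active_cube_chart_forms:
  "active cube_chart_forms ` polyh cube_chart_forms = nerve 6 cube_nonfaces"
  by (rule active_eq_nerve[OF affine_forms(7) length_forms(7) _ _ _ nerve_generated_types(3),
      where xs = "[vector [0, 0, 0], vector [0, 0, 1/2], vector [0, 1/2, 0], vector [0, 1/2, 1/4], vector [1/2, 0, 0], vector [1/4, 0, 1/2], vector [1/2, 1/4, 0], vector [1/3, 1/3, 1/3]]"])
    (auto simp: forms_defs mem_polyh upt_values)

lemma active_dumpling_chart_forms:
  "active dumpling_chart_forms ` polyh dumpling_chart_forms = nerve 6 dumpling_nonfaces"
  by (rule active_eq_nerve[OF affine_forms(8) length_forms(8) _ _ _ nerve_generated_types(4),
      where xs = "[vector [0, 0, - 1], vector [0, 0, 0], vector [0, 1/2, - 1/2], vector [1/2, 0, 1/2], vector [1, 0, - 1], vector [1, 0, 0], vector [1/3, 2/3, - 1/3], vector [2/3, 1/3, 1/3]]"])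
    (auto simp: forms_defs mem_polyh upt_values)

lemmas active_nerves = active_tetrahedron_forms active_prism_forms active_cube_forms active_dumpling_forms
  active_tetrahedron_chart_forms active_prism_chart_forms active_cube_chart_forms active_dumpling_chart_forms

lemma tetrahedron_eq: "tetrahedron = polyh tetrahedron_forms"
proof
  show "tetrahedron \<subseteq> polyh tetrahedron_forms"
    unfolding tetrahedron_def
    by (rule hull_minimal[where S = convex, OF _ convex_polyh[OF affine_forms(1)]]) (auto simp: forms_defs mem_polyh)
  show "polyh tetrahedron_forms \<subseteq> tetrahedron"
  proof clarify
    fix x y z :: real assume "((x, y), z) \<in> polyh tetrahedron_forms"
    then have nn: "0 \<le> x" "0 \<le> y" "0 \<le> z" "x + y + z \<le> 1" by (auto simp: forms_defs mem_polyh)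
    let ?w = "\<lambda>i. [1 - x - y - z, x, y, z] ! i"
    let ?v = "\<lambda>i. [((0, 0), 0), ((1, 0), 0), ((0, 1), 0), ((0, 0), 1)] ! i :: (real \<times> real) \<times> real"
    have "(\<Sum>i\<in>{0, 1, 2, 3}. ?w i *\<^sub>R ?v i) \<in> tetrahedron"
      unfolding tetrahedron_def
      by (rule convex_sum) (use nn in \<open>auto intro: hull_inc\<close>)
    then show "((x, y), z) \<in> tetrahedron" by simp
  qed
qed

lemma triangular_prism_eq: "triangular_prism = polyh prism_forms"
proof -
  have "(x, y) \<in> convex hull {(0, 0), (1, 0), (0, 1)} \<longleftrightarrow> 0 \<le> x \<and> 0 \<le> y \<and> 0 \<le> 1 - x - y" for x y :: real
  proof -
    have "0 \<le> x \<and> 0 \<le> y \<and> x + y \<le> 1 \<longleftrightarrow> (\<exists>u. 0 \<le> u \<and> 0 \<le> x \<and> 0 \<le> y \<and> u + x + y = 1)"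
      by (auto intro: exI[of _ "1 - x - y"])
    then show ?thesis unfolding convex_hull_3 by auto
  qed
  then show ?thesis by (auto simp: triangular_prism_def forms_defs mem_polyh)
qed

lemma cube_eq: "cube = polyh cube_forms"
  by (auto simp: cube_def forms_defs mem_polyh)

text \<open>For the inclusion into the hull, the pentagon is cut horizontally at height y. The ends
  of the slice lie on explicit edges, which change at y = 1, the height of the vertices (-1, 1) and
  (3, 1).\<close>

lemma pentagon_iff:
  "(x, y) \<in> pentagon \<longleftrightarrow> 0 \<le> y \<and> 0 \<le> x + y \<and> x + 2 * y \<le> 5 \<and> x - y \<le> 2 \<and> 2 * y - x \<le> 3"
proof
  let ?S = "{(x, y). 0 \<le> y \<and> 0 \<le> x + y \<and> x + 2 * y \<le> 5 \<and> x - y \<le> 2 \<and> 2 * y - x \<le> (3::real)}"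
  have "?S = polyh [\<lambda>(x, y). y, \<lambda>(x, y). x + y, \<lambda>(x, y). 5 - x - 2 * y, \<lambda>(x, y). 2 - x + y, \<lambda>(x, y). 3 - 2 * y + x]"
    by (auto simp: mem_polyh)
  also have "convex \<dots>"
    by (rule convex_polyh) (auto simp: affine_fun_def algebra_simps)
  finally have "pentagon \<subseteq> ?S" unfolding pentagon_def by (intro hull_minimal) auto
  then show "(x, y) \<in> pentagon \<Longrightarrow> 0 \<le> y \<and> 0 \<le> x + y \<and> x + 2 * y \<le> 5 \<and> x - y \<le> 2 \<and> 2 * y - x \<le> 3"
    by auto
next
  assume *: "0 \<le> y \<and> 0 \<le> x + y \<and> x + 2 * y \<le> 5 \<and> x - y \<le> 2 \<and> 2 * y - x \<le> 3"
  have conv: "convex pentagon" by (simp add: pentagon_def)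
  have v: "(0, 0) \<in> pentagon" "(2, 0) \<in> pentagon" "(3, 1) \<in> pentagon" "(1, 2) \<in> pentagon" "(- 1, 1) \<in> pentagon"
    by (auto simp: pentagon_def intro: hull_inc)
  have slice: "(x, y) \<in> pentagon" if "(l, y) \<in> pentagon" "(r, y) \<in> pentagon" "l \<le> x" "x \<le> r" for l r
  proof (cases "l = r")
    case False
    let ?u = "(x - l) / (r - l)"
    have "(1 - ?u) *\<^sub>R (l, y) + ?u *\<^sub>R (r, y) \<in> pentagon"
      using that False by (intro convexD_alt[OF conv]) (auto simp: field_simps)
    moreover have "(1 - ?u) * l + ?u * r = x"
    proof -
      have "(1 - ?u) * l + ?u * r = l + ?u * (r - l)" by (simp only: left_diff_distrib right_diff_distrib)
      then show ?thesis using False by simp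
    qed
    moreover have "(1 - ?u) * y + ?u * y = y" by (simp add: algebra_simps)
    ultimately show ?thesis by simp
  qed (use that in simp)
  show "(x, y) \<in> pentagon"
  proof (cases "y \<le> 1")
    case True
    have "(1 - y) *\<^sub>R (0, 0) + y *\<^sub>R (- 1, 1) \<in> pentagon" "(1 - y) *\<^sub>R (2, 0) + y *\<^sub>R (3, 1) \<in> pentagon"
      using True * v by (intro convexD_alt[OF conv]; simp)+
    then show ?thesis using * by (intro slice[of "- y" "2 + y"]) (simp_all add: algebra_simps)
  next
    case False
    have "(1 - (y - 1)) *\<^sub>R (- 1, 1) + (y - 1) *\<^sub>R (1, 2) \<in> pentagon"
      "(1 - (y - 1)) *\<^sub>R (3, 1) + (y - 1) *\<^sub>R (1, 2) \<in> pentagon"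
      using False * v by (intro convexD_alt[OF conv]; simp)+
    then show ?thesis using * by (intro slice[of "2 * y - 3" "5 - 2 * y"]) (simp_all add: algebra_simps)
  qed
qed

lemma dumpling_eq: "dumpling = polyh dumpling_forms"
proof (intro equalityI subsetI)
  fix q assume "q \<in> dumpling"
  then obtain w where w: "w \<in> pentagon \<times> {0..1}" "q = (\<lambda>(p, u). (p, u * snd p)) w"
    unfolding dumpling_def by blast
  obtain x y u where "w = ((x, y), u)" by (metis prod.exhaust)
  with w have q: "q = ((x, y), u * y)" "(x, y) \<in> pentagon" "0 \<le> u" "u \<le> 1" by auto
  moreover from this have "0 \<le> y" using pentagon_iff by blast
  ultimately have "0 \<le> u * y" "u * y \<le> y" by (simp_all add: mult_left_le_one_le)
  then show "q \<in> polyh dumpling_forms" using q by (auto simp: forms_defs mem_polyh pentagon_iff)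
next
  fix q assume q: "q \<in> polyh dumpling_forms"
  obtain x y h where xyh: "q = ((x, y), h)" by (metis prod.exhaust)
  have *: "0 \<le> x + y" "x + 2 * y \<le> 5" "x - y \<le> 2" "2 * y - x \<le> 3" "0 \<le> h" "h \<le> y"
    using q by (auto simp: forms_defs mem_polyh xyh)
  \<comment> \<open>For y = 0 also h = 0, and the convention h / 0 = 0 still gives an admissible
    height parameter.\<close>
  have "h = (h / y) * y" "0 \<le> h / y" "h / y \<le> 1" using * by (auto simp: divide_simps)
  moreover have "(x, y) \<in> pentagon" using * by (simp add: pentagon_iff)
  ultimately have "((x, y), h) \<in> (\<lambda>(p, u). (p, u * snd p)) ` (pentagon \<times> {0..1})"
    by (intro image_eqI[of _ _ "((x, y), h / y)"]) auto
  then show "q \<in> dumpling" by (simp add: dumpling_def xyh)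
qed

lemma comb_equiv_chart_forms:
  "comb_equiv (polyh tetrahedron_chart_forms) tetrahedron"
  "comb_equiv (polyh prism_chart_forms) triangular_prism"
  "comb_equiv (polyh cube_chart_forms) cube"
  "comb_equiv (polyh dumpling_chart_forms) dumpling"
  unfolding tetrahedron_eq triangular_prism_eq cube_eq dumpling_eq
  by (rule comb_equiv_polyh; (rule affine_forms
      | simp add: length_forms active_nerves nerve_proper nonface_free_def upt_values))+

lemma polytope_chart_forms:
  "polytope (polyh tetrahedron_chart_forms)" "polytope (polyh prism_chart_forms)"
  "polytope (polyh cube_chart_forms)"
  "polytope (polyh dumpling_chart_forms)"
  by (rule polytope_polyh_cart; use affine_forms in \<open>auto simp: forms_defs mem_polyh\<close>)+

text \<open>The entries 1, 2, 4 belong to the empty face, vertices and edges; 8, 10, 12 to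
  triangles, quadrilaterals and pentagons; the largest one counts all faces, including the empty
  face and the polytope itself.\<close>

lemma nerve_counts_types:
  "set (nerve_counts 4 tetrahedron_nonfaces) = {1, 2, 4, 8, 16}"
  "set (nerve_counts 5 prism_nonfaces) = {1, 2, 4, 8, 10, 22}"
  "set (nerve_counts 6 cube_nonfaces) = {1, 2, 4, 10, 28}"
  "set (nerve_counts 6 dumpling_nonfaces) = {1, 2, 4, 8, 10, 12, 28}"
  by code_simp+

lemma face_counts_types:
  "face_counts tetrahedron = {1, 2, 4, 8, 16}"
  "face_counts triangular_prism = {1, 2, 4, 8, 10, 22}"
  "face_counts cube = {1, 2, 4, 10, 28}"
  "face_counts dumpling = {1, 2, 4, 8, 10, 12, 28}"
  unfolding nerve_counts_types[symmetric] tetrahedron_eq triangular_prism_eq cube_eq dumpling_eq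
  by (rule face_counts_polyh[OF _ _ active_tetrahedron_forms] face_counts_polyh[OF _ _ active_prism_forms]
      face_counts_polyh[OF _ _ active_cube_forms] face_counts_polyh[OF _ _ active_dumpling_forms];
      use affine_forms in \<open>simp add: forms_defs nonface_free_def upt_values\<close>)+

section \<open>Sets of points of the projective space given by cones\<close>

definition proj_set :: "(real ^ 4) set \<Rightarrow> (real ^ 4) set set" where
  "proj_set S = proj_pt ` (S - {0})"

definition homog :: "(real ^ 4) set \<Rightarrow> bool" where
  "homog S \<longleftrightarrow> (\<forall>v\<in>S. \<forall>c. c \<noteq> 0 \<longrightarrow> c *\<^sub>R v \<in> S)"

lemma proj_pt_scaleR: "v \<noteq> 0 \<Longrightarrow> c \<noteq> 0 \<Longrightarrow> proj_pt (c *\<^sub>R v) = proj_pt v"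
  by (subst proj_pt_eq_iff) auto

lemma proj_pt_minus: "v \<noteq> 0 \<Longrightarrow> proj_pt (- v) = proj_pt v"
  using proj_pt_scaleR[of v "- 1"] by simp

lemma proj_pt_in_topspace: "v \<noteq> 0 \<Longrightarrow> proj_pt v \<in> topspace proj_space"
  by (auto simp: topspace_proj_space)

lemma proj_pt_in_proj_set:
  assumes "homog S" "v \<noteq> 0" shows "proj_pt v \<in> proj_set S \<longleftrightarrow> v \<in> S"
proof
  assume "proj_pt v \<in> proj_set S"
  then obtain u where "u \<in> S" "u \<noteq> 0" "proj_pt v = proj_pt u" by (auto simp: proj_set_def)
  then show "v \<in> S" using assms proj_pt_eq_iff[of v u] by (auto simp: homog_def)
qed (use assms in \<open>auto simp: proj_set_def\<close>)

lemma proj_set_subset_topspace: "proj_set S \<subseteq> topspace proj_space"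
  by (auto simp: proj_set_def topspace_proj_space)

lemma topspace_eq_proj_set: "topspace proj_space = proj_set UNIV"
  by (simp add: proj_set_def topspace_proj_space Compl_eq_Diff_UNIV)

lemma homog_Compl: assumes "homog S" shows "homog (- S)"
  unfolding homog_def
proof (intro ballI allI impI)
  fix v and c :: real assume v: "v \<in> - S" "c \<noteq> 0"
  have "v \<in> S" if "c *\<^sub>R v \<in> S"
  proof -
    have "(1 / c) *\<^sub>R (c *\<^sub>R v) \<in> S"
      using assms[unfolded homog_def, rule_format, OF that, of "1 / c"] v by simp
    then show ?thesis using v by simp
  qed
  then show "c *\<^sub>R v \<in> - S" using v by blast
qed

lemma homog_Un: "homog S \<Longrightarrow> homog T \<Longrightarrow> homog (S \<union> T)"
  by (auto simp: homog_def)

lemma homog_Int: "homog S \<Longrightarrow> homog T \<Longrightarrow> homog (S \<inter> T)"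
  by (auto simp: homog_def)

lemma proj_set_Un: "proj_set (S \<union> T) = proj_set S \<union> proj_set T"
  by (auto simp: proj_set_def)

lemma proj_set_mono: "S \<subseteq> T \<Longrightarrow> proj_set S \<subseteq> proj_set T"
  by (auto simp: proj_set_def)

lemma proj_set_Diff:
  assumes "homog T" shows "proj_set S - proj_set T = proj_set (S - T)"
proof
  show "proj_set S - proj_set T \<subseteq> proj_set (S - T)" by (auto simp: proj_set_def)
  show "proj_set (S - T) \<subseteq> proj_set S - proj_set T"
    using proj_pt_in_proj_set[OF assms] by (auto simp: proj_set_def)
qed

lemma topspace_Diff_proj_set: "homog S \<Longrightarrow> topspace proj_space - proj_set S = proj_set (- S)"
  by (simp add: topspace_eq_proj_set proj_set_Diff Compl_eq_Diff_UNIV)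

lemma openin_proj_set:
  assumes "homog S" "open S" shows "openin proj_space (proj_set S)"
proof -
  have "{v. v \<noteq> 0 \<and> proj_pt v \<in> proj_set S} = S - {0}"
    using proj_pt_in_proj_set[OF assms(1)] by blast
  then show ?thesis unfolding openin_proj_space
    using assms(2) by (auto simp: proj_set_def open_Diff)
qed

lemma closedin_proj_set:
  assumes "homog S" "closed S" shows "closedin proj_space (proj_set S)"
  unfolding closedin_def
  using openin_proj_set[OF homog_Compl[OF assms(1)]] assms(2)
  by (simp add: topspace_Diff_proj_set[OF assms(1)] proj_set_subset_topspace open_Compl)

lemma continuous_map_proj_pt: "continuous_map (top_of_set (- {0})) proj_space proj_pt"
  using quotient_map_proj_pt quotient_imp_continuous_map by blast

section \<open>The chambers of the arrangement\<close>

definition normals :: "(real ^ 4) set" where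
  "normals = {vector [1, 0, 0, 0], vector [0, 1, 0, 0], vector [0, 0, 1, 0],
      vector [0, 1, -1, -1], vector [-1, 0, 1, -1], vector [1, -1, 0, -1]}"

lemma arrangement_eq: "arrangement = proj_plane ` normals"
  by (simp only: arrangement_def normals_def)

lemma finite_normals: "finite normals" and normals_nonempty: "normals \<noteq> {}"
  by (auto simp: normals_def)

definition generic :: "real ^ 4 \<Rightarrow> bool" where
  "generic w \<longleftrightarrow> (\<forall>a\<in>normals. a \<bullet> w \<noteq> 0)"

text \<open>Equality of signs is expressed by positive products; the cone is empty unless
  \<open>w\<close> is generic.\<close>

definition open_cone :: "real ^ 4 \<Rightarrow> (real ^ 4) set" where
  "open_cone w = {v. \<forall>a\<in>normals. 0 < (a \<bullet> w) * (a \<bullet> v)}"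

definition closed_cone :: "real ^ 4 \<Rightarrow> (real ^ 4) set" where
  "closed_cone w = {v. \<forall>a\<in>normals. 0 \<le> (a \<bullet> w) * (a \<bullet> v)}"

definition cell :: "real ^ 4 \<Rightarrow> (real ^ 4) set set" where
  "cell w = proj_set (open_cone w)"

definition chamber :: "real ^ 4 \<Rightarrow> (real ^ 4) set set" where
  "chamber w = proj_set (closed_cone w)"

lemma open_cone_generic: "v \<in> open_cone w \<Longrightarrow> generic v"
  by (auto simp: open_cone_def generic_def)

lemma generic_nonzero: "generic v \<Longrightarrow> v \<noteq> 0"
  using normals_nonempty by (auto simp: generic_def)

lemma generic_scaleR: "generic v \<Longrightarrow> c \<noteq> 0 \<Longrightarrow> generic (c *\<^sub>R v)"
  by (simp add: generic_def)

lemma open_cone_self: "generic w \<Longrightarrow> w \<in> open_cone w"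
  by (auto simp: open_cone_def generic_def less_le)

lemma open_cone_scaleR: "v \<in> open_cone w \<Longrightarrow> 0 < c \<Longrightarrow> c *\<^sub>R v \<in> open_cone w"
  by (simp add: open_cone_def mult.left_commute[of _ c])

lemma closed_cone_scaleR: "v \<in> closed_cone w \<Longrightarrow> 0 < c \<Longrightarrow> c *\<^sub>R v \<in> closed_cone w"
  by (simp add: closed_cone_def mult.left_commute[of _ c])

text \<open>Cones of sign conditions are stable under positive factors only. Adjoining the opposite
  cone leaves the projective set unchanged and makes the criteria for \<open>homog\<close> sets
  applicable.\<close>

lemma sym_cone:
  assumes "\<And>v c. v \<in> C \<Longrightarrow> 0 < c \<Longrightarrow> c *\<^sub>R v \<in> C"
  shows "homog (C \<union> uminus ` C)" "proj_set (C \<union> uminus ` C) = proj_set C"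
proof -
  show "homog (C \<union> uminus ` C)"
    unfolding homog_def
  proof (intro ballI allI impI)
    fix v and c :: real assume v: "v \<in> C \<union> uminus ` C" and c: "c \<noteq> 0"
    have *: "c *\<^sub>R u \<in> C \<union> uminus ` C" if "u \<in> C" "c \<noteq> 0" for u c
    proof (cases "0 < c")
      case False
      then have "(- c) *\<^sub>R u \<in> C" using assms[of u "- c"] that by simp
      then show ?thesis by (auto intro: image_eqI[of _ _ "(- c) *\<^sub>R u"])
    qed (use assms that in auto)
    show "c *\<^sub>R v \<in> C \<union> uminus ` C"
    proof (cases "v \<in> C")
      case False
      then obtain u where "u \<in> C" "v = - u" using v by blast
      then show ?thesis using *[of u "- c"] c by simp
    qed (use * c in simp)
  qed
  show "proj_set (C \<union> uminus ` C) = proj_set C"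
  proof
    show "proj_set (C \<union> uminus ` C) \<subseteq> proj_set C"
      using proj_pt_minus by (auto simp: proj_set_def)
  qed (rule proj_set_mono, simp)
qed

lemma sym_open_cone:
  "homog (open_cone w \<union> uminus ` open_cone w)"
  "proj_set (open_cone w \<union> uminus ` open_cone w) = proj_set (open_cone w)"
  using sym_cone[of "open_cone w"] open_cone_scaleR[of _ w] by blast+

lemma sym_closed_cone:
  "homog (closed_cone w \<union> uminus ` closed_cone w)"
  "proj_set (closed_cone w \<union> uminus ` closed_cone w) = proj_set (closed_cone w)"
  using sym_cone[of "closed_cone w"] closed_cone_scaleR[of _ w] by blast+

lemma mem_uminus_image: "v \<in> uminus ` C \<longleftrightarrow> - v \<in> C" for v :: "'a::ab_group_add"
  by (metis image_iff minus_minus)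

lemma proj_pt_in_cell:
  "v \<noteq> 0 \<Longrightarrow> proj_pt v \<in> cell w \<longleftrightarrow> v \<in> open_cone w \<or> - v \<in> open_cone w"
  using proj_pt_in_proj_set[OF sym_open_cone(1)[of w], of v]
  by (simp add: cell_def sym_open_cone(2) mem_uminus_image)

lemma proj_pt_in_chamber:
  "v \<noteq> 0 \<Longrightarrow> proj_pt v \<in> chamber w \<longleftrightarrow> v \<in> closed_cone w \<or> - v \<in> closed_cone w"
  using proj_pt_in_proj_set[OF sym_closed_cone(1)[of w], of v]
  by (simp add: chamber_def sym_closed_cone(2) mem_uminus_image)

lemma open_open_cone: "open (open_cone w)"
proof -
  have "open_cone w = (\<Inter>a\<in>normals. {v. 0 < (a \<bullet> w) * (a \<bullet> v)})" by (auto simp: open_cone_def)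
  then show ?thesis
    using finite_normals by (simp add: open_INT open_Collect_less continuous_intros)
qed

lemma closed_closed_cone: "closed (closed_cone w)"
proof -
  have "closed_cone w = (\<Inter>a\<in>normals. {v. 0 \<le> (a \<bullet> w) * (a \<bullet> v)})" by (auto simp: closed_cone_def)
  then show ?thesis by (auto intro!: closed_INT closed_Collect_le continuous_intros)
qed

lemma openin_cell: "openin proj_space (cell w)"
  unfolding cell_def sym_open_cone(2)[symmetric]
  by (rule openin_proj_set[OF sym_open_cone(1) open_Un[OF open_open_cone open_negations[OF open_open_cone]]])

lemma closedin_chamber: "closedin proj_space (chamber w)"
  unfolding chamber_def sym_closed_cone(2)[symmetric]
  by (rule closedin_proj_set[OF sym_closed_cone(1)
        closed_Un[OF closed_closed_cone closed_negations[OF closed_closed_cone]]])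

lemma connectedin_cell:
  shows "connectedin proj_space (cell w)"
proof -
  have "0 \<notin> open_cone w" using normals_nonempty by (auto simp: open_cone_def)
  then have eq: "cell w = proj_pt ` open_cone w" and sub: "open_cone w \<subseteq> - {0}"
    by (auto simp: cell_def proj_set_def)
  have "convex (open_cone w)"
  proof -
    have "open_cone w = (\<Inter>a\<in>normals. {v. 0 < ((a \<bullet> w) *\<^sub>R a) \<bullet> v})" by (auto simp: open_cone_def)
    then show ?thesis by (simp only: convex_INT convex_halfspace_gt)
  qed
  then have "connectedin (top_of_set (- {0})) (open_cone w)"
    using sub by (simp add: connectedin_subtopology convex_connected)
  then show ?thesis unfolding eq by (rule connectedin_continuous_map_image[OF continuous_map_proj_pt])
qed

lemma complement_arrangement:
  "topspace proj_space - \<Union>arrangement = proj_set {v. generic v}"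
proof -
  have "proj_plane a = proj_set {v. a \<bullet> v = 0}" for a
    by (auto simp: proj_plane_def proj_set_def)
  moreover have "homog (\<Union>a\<in>normals. {v. a \<bullet> v = 0})" by (auto simp: homog_def)
  moreover have "(\<Union>a\<in>normals. proj_set {v. a \<bullet> v = 0}) = proj_set (\<Union>a\<in>normals. {v. a \<bullet> v = 0})"
    by (auto simp: proj_set_def)
  moreover have "- (\<Union>a\<in>normals. {v. a \<bullet> v = 0}) = {v. generic v}" by (auto simp: generic_def)
  ultimately show ?thesis by (simp add: arrangement_eq topspace_Diff_proj_set)
qed

text \<open>The cell is connected, being the image of a convex cone, and it is open and closed in
  the complement of the planes, so it is a whole component.\<close>

lemma connected_component_cell:
  assumes w: "generic w"
  shows "connected_component_of_set (subtopology proj_space (proj_set {v. generic v})) (proj_pt w) = cell w"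
    (is "connected_component_of_set ?X _ = _")
proof
  have gen: "homog {v. generic v}" using generic_scaleR by (auto simp: homog_def)
  have sub: "cell w \<subseteq> proj_set {v. generic v}"
    unfolding cell_def using open_cone_generic by (intro proj_set_mono) auto
  have w0: "w \<noteq> 0" using w generic_nonzero by blast
  have mem: "proj_pt w \<in> cell w" using w proj_pt_in_cell[OF w0] open_cone_self by blast
  show "cell w \<subseteq> connected_component_of_set ?X (proj_pt w)"
    using connectedin_cell sub mem
    by (intro connected_component_of_maximal) (auto simp: connectedin_subtopology)
  have "openin ?X (cell w)"
    using sub openin_cell by (simp add: openin_subtopology_Int2 openin_subtopology) blast
  moreover have "closedin ?X (cell w)"
  proof -
    \<comment> \<open>Generic vectors agreeing with \<open>w\<close> in some sign and disagreeing in
      another: exactly those for which neither v nor -v lies in \<open>open_cone w\<close>. This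
      form is visibly open.\<close>
    let ?T = "{v. generic v} \<inter> (\<Union>a\<in>normals. {v. (a \<bullet> w) * (a \<bullet> v) < 0}) \<inter> (\<Union>a\<in>normals. {v. 0 < (a \<bullet> w) * (a \<bullet> v)})"
    have gen_open: "open {v. generic v}"
    proof -
      have "{v. generic v} = (\<Inter>a\<in>normals. - {v. a \<bullet> v = 0})" by (auto simp: generic_def)
      then show ?thesis using finite_normals
        by (auto intro!: open_INT simp: open_Compl closed_hyperplane)
    qed
    have T: "open ?T"
      by (intro open_Int open_UN gen_open ballI open_Collect_less continuous_intros)
    have T_eq: "{v. generic v} - (open_cone w \<union> uminus ` open_cone w) = ?T"
    proof -
      have neg: "v \<in> uminus ` open_cone w \<longleftrightarrow> (\<forall>a\<in>normals. (a \<bullet> w) * (a \<bullet> v) < 0)" for v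
      proof -
        show ?thesis unfolding mem_uminus_image by (simp add: open_cone_def)
      qed
      have ne: "(a \<bullet> w) * (a \<bullet> v) < 0 \<longleftrightarrow> \<not> 0 < (a \<bullet> w) * (a \<bullet> v)" if "a \<in> normals" "generic v" for a v
      proof -
        have "(a \<bullet> w) * (a \<bullet> v) \<noteq> 0" using that w by (auto simp: generic_def)
        then show ?thesis by linarith
      qed
      have "v \<in> {v. generic v} - (open_cone w \<union> uminus ` open_cone w) \<longleftrightarrow> v \<in> ?T" for v
      proof (cases "generic v")
        case True
        show ?thesis
          unfolding Diff_iff Un_iff neg Int_iff UN_iff mem_Collect_eq
          unfolding open_cone_def mem_Collect_eq using True ne[OF _ True] by blast
      qed simp
      then show ?thesis by blast
    qed
    have eq: "proj_set {v. generic v} - cell w = proj_set ?T"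
      unfolding cell_def sym_open_cone(2)[symmetric] T_eq[symmetric]
      by (simp only: proj_set_Diff[OF sym_open_cone(1)])
    have "homog ?T"
      unfolding T_eq[symmetric] by (simp only: Diff_eq homog_Int[OF gen homog_Compl[OF sym_open_cone(1)]])
    then have "openin proj_space (proj_set ?T)" using T by (rule openin_proj_set)
    then have "openin ?X (proj_set {v. generic v} - cell w)"
      unfolding openin_subtopology by (intro exI[of _ "proj_set ?T"] conjI) (auto simp: eq[symmetric])
    then show ?thesis
      using sub by (simp add: closedin_def Int_absorb1 proj_set_subset_topspace)
  qed
  ultimately have "connected_component_of_set ?X (proj_pt w) \<subseteq> cell w
      \<or> disjnt (connected_component_of_set ?X (proj_pt w)) (cell w)"
    by (intro connectedin_clopen_cases[OF connectedin_connected_component_of])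
  moreover have "proj_pt w \<in> connected_component_of_set ?X (proj_pt w)"
    using mem sub connected_component_of_refl[of ?X "proj_pt w"]
    by (auto simp: proj_set_subset_topspace[THEN subsetD])
  ultimately show "connected_component_of_set ?X (proj_pt w) \<subseteq> cell w"
    using mem by (auto simp: disjnt_iff)
qed

text \<open>Adding a small positive multiple of \<open>w\<close> to a vector of the closed cone
  makes all the weak sign conditions strict.\<close>

lemma closure_of_cell:
  assumes w: "generic w" shows "proj_space closure_of (cell w) = chamber w"
proof
  have "open_cone w \<subseteq> closed_cone w" by (auto simp: open_cone_def closed_cone_def less_imp_le)
  then show "proj_space closure_of (cell w) \<subseteq> chamber w"
    by (intro closure_of_minimal closedin_chamber) (simp add: cell_def chamber_def proj_set_mono)
  show "chamber w \<subseteq> proj_space closure_of (cell w)"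
  proof
    fix p assume "p \<in> chamber w"
    then obtain v where v: "p = proj_pt v" "v \<noteq> 0" "v \<in> closed_cone w"
      by (auto simp: chamber_def proj_set_def)
    have "\<exists>y. y \<in> cell w \<and> y \<in> U" if U: "p \<in> U" "openin proj_space U" for U
    proof -
      have "open {v. v \<noteq> 0 \<and> proj_pt v \<in> U}" using U openin_proj_space by blast
      moreover have "((\<lambda>e. v + e *\<^sub>R w) \<longlongrightarrow> v + 0 *\<^sub>R w) (at_right 0)" by (intro tendsto_intros)
      ultimately have "\<forall>\<^sub>F e in at_right 0. v + e *\<^sub>R w \<in> {v. v \<noteq> 0 \<and> proj_pt v \<in> U}"
        using U v by (intro topological_tendstoD) auto
      moreover have "\<forall>\<^sub>F e in at_right (0::real). 0 < e" by (rule eventually_at_right_less)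
      ultimately obtain e where e: "0 < e" "v + e *\<^sub>R w \<noteq> 0" "proj_pt (v + e *\<^sub>R w) \<in> U"
        using eventually_happens'[OF trivial_limit_at_right_real eventually_conj] by blast
      have "v + e *\<^sub>R w \<in> open_cone w"
        unfolding open_cone_def
      proof (intro CollectI ballI)
        fix a assume a: "a \<in> normals"
        have "0 < (a \<bullet> w) * (a \<bullet> w)" using w a by (auto simp: generic_def less_le)
        then have "0 < e * ((a \<bullet> w) * (a \<bullet> w))" using e(1) by simp
        moreover have "0 \<le> (a \<bullet> w) * (a \<bullet> v)" using v(3) a by (auto simp: closed_cone_def)
        ultimately show "0 < (a \<bullet> w) * (a \<bullet> (v + e *\<^sub>R w))" by (simp add: inner_add_right algebra_simps)
      qed
      then show ?thesis using e proj_pt_in_cell by blast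
    qed
    then show "p \<in> proj_space closure_of (cell w)"
      using v proj_pt_in_topspace by (auto simp: in_closure_of)
  qed
qed

lemma chambers_eq: "chambers = chamber ` {w. generic w}"
proof -
  let ?X = "subtopology proj_space (proj_set {v. generic v})"
  have "topspace ?X = proj_pt ` {w. generic w}"
    using generic_nonzero proj_set_subset_topspace[of "{v. generic v}"]
    by (auto simp: proj_set_def)
  then have "connected_components_of ?X = cell ` {w. generic w}"
    unfolding connected_components_of_def image_image
    by (simp only: image_image) (intro image_cong refl connected_component_cell, simp)
  then show ?thesis
    unfolding chambers_def complement_arrangement by (simp add: image_image closure_of_cell)
qed

lemma open_cone_cong: "w' \<in> open_cone w \<Longrightarrow> closed_cone w' = closed_cone w"
proof -
  have *: "0 \<le> r * t \<longleftrightarrow> 0 \<le> s * t" if "0 < r * s" for r s t :: real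
    using that by (auto simp: zero_le_mult_iff zero_less_mult_iff)
  assume "w' \<in> open_cone w"
  then show "closed_cone w' = closed_cone w" unfolding closed_cone_def open_cone_def
    using * by (intro Collect_cong ball_cong refl) blast
qed

lemma closed_cone_minus: "closed_cone (- w) = uminus ` closed_cone w"
proof -
  have "v \<in> closed_cone (- w) \<longleftrightarrow> v \<in> uminus ` closed_cone w" for v
    unfolding mem_uminus_image by (simp add: closed_cone_def)
  then show ?thesis by blast
qed

lemma chamber_minus: "chamber (- w) = chamber w"
proof -
  have "uminus ` C - {0} = uminus ` (C - {0})" for C :: "(real ^ 4) set" by auto
  then have "chamber (- w) = (\<lambda>v. proj_pt (- v)) ` (closed_cone w - {0})"
    by (simp add: chamber_def proj_set_def closed_cone_minus image_image)
  also have "\<dots> = chamber w"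
    unfolding chamber_def proj_set_def by (intro image_cong) (auto simp: proj_pt_minus)
  finally show ?thesis .
qed

lemma closed_cone_generic_iff:
  "generic w \<Longrightarrow> generic w' \<Longrightarrow> w' \<in> closed_cone w \<longleftrightarrow> w' \<in> open_cone w"
  by (auto simp: generic_def open_cone_def closed_cone_def less_le)

text \<open>A generic vector of a closed cone satisfies the sign conditions strictly, so a chamber
  determines its open cone up to the sign of the representing vector.\<close>

lemma chamber_eq_iff:
  assumes "generic w" "generic w'"
  shows "chamber w = chamber w' \<longleftrightarrow> w' \<in> open_cone w \<or> - w' \<in> open_cone w"
proof
  assume "chamber w = chamber w'"
  moreover have "w' \<in> closed_cone w'" by (auto simp: closed_cone_def)
  ultimately have "proj_pt w' \<in> chamber w" using proj_pt_in_chamber generic_nonzero assms by blast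
  then have "w' \<in> closed_cone w \<or> - w' \<in> closed_cone w"
    using proj_pt_in_chamber generic_nonzero assms by blast
  then show "w' \<in> open_cone w \<or> - w' \<in> open_cone w"
    using closed_cone_generic_iff assms generic_scaleR[of w' "- 1"] by simp
next
  assume "w' \<in> open_cone w \<or> - w' \<in> open_cone w"
  then show "chamber w = chamber w'"
    using open_cone_cong[of w' w] open_cone_cong[of "- w'" w] chamber_minus[of w']
    by (auto simp: chamber_def)
qed

text \<open>For small e the nonzero signs of \<open>v\<close> persist, and where \<open>v\<close>
  vanishes the sign of \<open>w0\<close> takes over. This yields both that closed chambers cover
  everything and that generic points are dense.\<close>

lemma generic_perturbation:
  assumes "generic w0" "0 < d"
  obtains e where "0 < e" "e < d" "generic (v + e *\<^sub>R w0)" "v \<in> closed_cone (v + e *\<^sub>R w0)"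
proof -
  have "\<forall>\<^sub>F e in at_right 0. \<forall>a\<in>normals. a \<bullet> v \<noteq> 0 \<longrightarrow> 0 < (a \<bullet> v) * (a \<bullet> (v + e *\<^sub>R w0))"
  proof (subst eventually_ball_finite_distrib[OF finite_normals], intro ballI)
    fix a show "\<forall>\<^sub>F e in at_right 0. a \<bullet> v \<noteq> 0 \<longrightarrow> 0 < (a \<bullet> v) * (a \<bullet> (v + e *\<^sub>R w0))"
    proof (cases "a \<bullet> v = 0")
      case False
      have "((\<lambda>e. (a \<bullet> v) * (a \<bullet> (v + e *\<^sub>R w0))) \<longlongrightarrow> (a \<bullet> v) * (a \<bullet> (v + 0 *\<^sub>R w0))) (at_right 0)"
        by (intro tendsto_intros)
      moreover have "0 < (a \<bullet> v) * (a \<bullet> (v + 0 *\<^sub>R w0))" using False by (auto simp: less_le)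
      ultimately show ?thesis using order_tendstoD(1) by (blast intro: eventually_mono)
    qed simp
  qed
  moreover have "\<forall>\<^sub>F e in at_right 0. 0 < e \<and> e < d"
    using assms(2) by (auto simp: eventually_at_right)
  ultimately obtain e where e: "0 < e" "e < d"
    "\<And>a. a \<in> normals \<Longrightarrow> a \<bullet> v \<noteq> 0 \<Longrightarrow> 0 < (a \<bullet> v) * (a \<bullet> (v + e *\<^sub>R w0))"
    using eventually_happens'[OF trivial_limit_at_right_real eventually_conj] by blast
  show thesis
  proof (rule that[OF e(1,2)])
    have "a \<bullet> (v + e *\<^sub>R w0) \<noteq> 0" if "a \<in> normals" for a
      using e(3)[OF that] assms(1) e(1) that by (cases "a \<bullet> v = 0") (auto simp: generic_def inner_add_right)
    then show "generic (v + e *\<^sub>R w0)" by (simp add: generic_def)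
    have "0 \<le> (a \<bullet> (v + e *\<^sub>R w0)) * (a \<bullet> v)" if "a \<in> normals" for a
      using e(3)[of a] that by (cases "a \<bullet> v = 0") (simp_all add: mult.commute)
    then show "v \<in> closed_cone (v + e *\<^sub>R w0)" by (simp add: closed_cone_def)
  qed
qed

lemma inner_4: "(vector [a, b, c, d] :: real ^ 4) \<bullet> v = a * v $ 1 + b * v $ 2 + c * v $ 3 + d * v $ 4"
  by (simp add: inner_vec_def sum_4)

lemma rho_vec: "rho *v v = vector [v $ 2, v $ 3, v $ 1, v $ 4]"
  and sigma_vec: "sigma *v v = vector [- v $ 2, - v $ 1, - v $ 3, v $ 4]"
  and tau_vec: "tau *v v = vector [v $ 2 - v $ 3 - v $ 4, v $ 3 - v $ 1 - v $ 4,
      v $ 1 - v $ 2 - v $ 4, v $ 1 + v $ 2 + v $ 3]"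
  by (simp_all add: rho_def sigma_def tau_def matrix_vector_mult_def vec_eq_iff forall_4 sum_4)

lemma det_4:
  "det (A::'a::comm_ring_1^4^4) =
     A$1$1 * (A$2$2 * (A$3$3 * A$4$4 - A$3$4 * A$4$3) - A$2$3 * (A$3$2 * A$4$4 - A$3$4 * A$4$2)
       + A$2$4 * (A$3$2 * A$4$3 - A$3$3 * A$4$2))
   - A$1$2 * (A$2$1 * (A$3$3 * A$4$4 - A$3$4 * A$4$3) - A$2$3 * (A$3$1 * A$4$4 - A$3$4 * A$4$1)
       + A$2$4 * (A$3$1 * A$4$3 - A$3$3 * A$4$1))
   + A$1$3 * (A$2$1 * (A$3$2 * A$4$4 - A$3$4 * A$4$2) - A$2$2 * (A$3$1 * A$4$4 - A$3$4 * A$4$1)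
       + A$2$4 * (A$3$1 * A$4$2 - A$3$2 * A$4$1))
   - A$1$4 * (A$2$1 * (A$3$2 * A$4$3 - A$3$3 * A$4$2) - A$2$2 * (A$3$1 * A$4$3 - A$3$3 * A$4$1)
       + A$2$3 * (A$3$1 * A$4$2 - A$3$2 * A$4$1))"
proof -
  have f1234: "finite {2::4, 3, 4}" "1 \<notin> {2::4, 3, 4}" by auto
  have f234: "finite {3::4, 4}" "2 \<notin> {3::4, 4}" by auto
  have f34: "finite {4::4}" "3 \<notin> {4::4}" by auto
  show ?thesis
    unfolding det_def UNIV_4
    unfolding sum_over_permutations_insert[OF f1234]
    unfolding sum_over_permutations_insert[OF f234]
    unfolding sum_over_permutations_insert[OF f34]
    unfolding permutes_sing
    by (simp add: sign_swap_id permutation_swap_id sign_compose sign_id swap_id_eq permutation_compose)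
      (simp add: algebra_simps)
qed

lemma det_generators: "0 < det rho" "0 < det sigma" "0 < det tau"
  by (simp_all add: det_4 rho_def sigma_def tau_def)

section \<open>The group\<close>

text \<open>Inverses are left out because, projectively, the inverse of each generator is a product
  of generators: rho has order 3, sigma and tau have order 2.\<close>

inductive_set gen_mats :: "(real ^ 4 ^ 4) set" where
  one: "mat 1 \<in> gen_mats"
| rho: "M \<in> gen_mats \<Longrightarrow> rho ** M \<in> gen_mats"
| sigma: "M \<in> gen_mats \<Longrightarrow> sigma ** M \<in> gen_mats"
| tau: "M \<in> gen_mats \<Longrightarrow> tau ** M \<in> gen_mats"

lemma det_gen_mats: "M \<in> gen_mats \<Longrightarrow> 0 < det M"
  by (induction rule: gen_mats.induct) (simp_all add: det_mul det_generators)

lemma invertible_gen_mats: "M \<in> gen_mats \<Longrightarrow> invertible M"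
  using det_gen_mats by (fastforce simp: invertible_det_nz)

lemma generators_in_gen_mats: "rho \<in> gen_mats" "sigma \<in> gen_mats" "tau \<in> gen_mats"
  using gen_mats.intros(2-4)[OF gen_mats.one] by simp_all

lemma gen_mats_mult: "M \<in> gen_mats \<Longrightarrow> N \<in> gen_mats \<Longrightarrow> M ** N \<in> gen_mats"
  by (induction rule: gen_mats.induct)
    (auto simp: matrix_mul_assoc[symmetric] intro: gen_mats.intros)

abbreviation "PGL \<equiv> BijGroup (topspace proj_space)"

lemma proj_map_carrier: "invertible A \<Longrightarrow> proj_map A \<in> carrier PGL"
  by (rule proj_map_Bij)

lemma proj_map_eqI:
  assumes "\<And>v. v \<noteq> 0 \<Longrightarrow> proj_pt (A *v v) = proj_pt (B *v v)"
  shows "proj_map A = proj_map B"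
proof
  fix p show "proj_map A p = proj_map B p"
  proof (cases "p \<in> topspace proj_space")
    case True
    then obtain v where "v \<noteq> 0" "p = proj_pt v" by (auto simp: topspace_proj_space)
    then show ?thesis using assms by (simp add: proj_map_pt)
  qed (simp add: proj_map_def)
qed

lemma proj_map_mult:
  assumes "invertible A" "invertible B"
  shows "proj_map A \<otimes>\<^bsub>PGL\<^esub> proj_map B = proj_map (A ** B)"
proof -
  have mem: "proj_map A \<in> Bij (topspace proj_space)" "proj_map B \<in> Bij (topspace proj_space)"
    using assms proj_map_carrier by (simp_all add: BijGroup_def)
  have "compose (topspace proj_space) (proj_map A) (proj_map B) p = proj_map (A ** B) p" for p
  proof (cases "p \<in> topspace proj_space")
    case True
    then obtain v where v: "v \<noteq> 0" "p = proj_pt v" by (auto simp: topspace_proj_space)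
    then show ?thesis using True invertible_mult_nonzero[OF assms(2)]
      by (simp add: compose_def proj_map_pt matrix_vector_mul_assoc)
  qed (simp add: proj_map_def compose_def)
  then show ?thesis using mem by (auto simp: BijGroup_def)
qed

lemma proj_map_one: "\<one>\<^bsub>PGL\<^esub> = proj_map (mat 1)"
proof -
  have "(\<lambda>x\<in>topspace proj_space. x) p = proj_map (mat 1) p" for p
  proof (cases "p \<in> topspace proj_space")
    case True
    then obtain v where v: "v \<noteq> 0" "p = proj_pt v" by (auto simp: topspace_proj_space)
    then show ?thesis using True by (simp add: proj_map_pt)
  qed (simp add: proj_map_def)
  then show ?thesis by (auto simp: BijGroup_def)
qed

lemma carrier_G: "carrier G = proj_map ` gen_mats"
proof -
  interpret group PGL by (rule group_BijGroup)
  have S: "carrier PGL \<inter> {proj_map rho, proj_map sigma, proj_map tau}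
      = {proj_map rho, proj_map sigma, proj_map tau}"
    using generators_in_gen_mats invertible_gen_mats proj_map_carrier by blast
  have inverse: "inv\<^bsub>PGL\<^esub> (proj_map A) = proj_map B"
    if "A \<in> gen_mats" "B \<in> gen_mats" "c \<noteq> 0" "\<And>v. B *v (A *v v) = c *\<^sub>R v" for A B c
  proof (rule inv_equality)
    have "proj_map (B ** A) = proj_map (mat 1)"
    proof (rule proj_map_eqI)
      fix v :: "real ^ 4" assume "v \<noteq> 0"
      then show "proj_pt ((B ** A) *v v) = proj_pt (mat 1 *v v)"
        using that(3,4) by (subst proj_pt_eq_iff) (auto simp: matrix_vector_mul_assoc[symmetric])
    qed
    then show "proj_map B \<otimes>\<^bsub>PGL\<^esub> proj_map A = \<one>\<^bsub>PGL\<^esub>"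
      using that invertible_gen_mats by (simp add: proj_map_mult proj_map_one)
  qed (use that invertible_gen_mats proj_map_carrier in auto)
  have inv_rho: "inv\<^bsub>PGL\<^esub> (proj_map rho) = proj_map (rho ** rho)"
    by (rule inverse[of _ _ 1]) (use generators_in_gen_mats gen_mats_mult in
      \<open>auto simp: matrix_vector_mul_assoc[symmetric] rho_vec vec_eq_iff forall_4\<close>)
  have inv_sigma: "inv\<^bsub>PGL\<^esub> (proj_map sigma) = proj_map sigma"
    by (rule inverse[of _ _ 1]) (use generators_in_gen_mats in \<open>auto simp: sigma_vec vec_eq_iff forall_4\<close>)
  \<comment> \<open>The square of \<open>tau\<close> is -3 times the identity, hence trivial as a
    projective map.\<close>
  have inv_tau: "inv\<^bsub>PGL\<^esub> (proj_map tau) = proj_map tau"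
    by (rule inverse[of _ _ "- 3"]) (use generators_in_gen_mats in \<open>auto simp: tau_vec vec_eq_iff forall_4\<close>)
  have "generate PGL {proj_map rho, proj_map sigma, proj_map tau} = proj_map ` gen_mats"
  proof
    show "generate PGL {proj_map rho, proj_map sigma, proj_map tau} \<subseteq> proj_map ` gen_mats"
    proof
      fix g assume "g \<in> generate PGL {proj_map rho, proj_map sigma, proj_map tau}"
      then show "g \<in> proj_map ` gen_mats"
      proof (induction rule: generate.induct)
        case one then show ?case using proj_map_one gen_mats.one by blast
      next
        case (incl h) then show ?case using generators_in_gen_mats by blast
      next
        case (inv h)
        then show ?case
          using generators_in_gen_mats gen_mats_mult inv_rho inv_sigma inv_tau by auto
      next
        case (eng g h)
        then obtain M N where MN: "M \<in> gen_mats" "N \<in> gen_mats" "g = proj_map M" "h = proj_map N" by blast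
        then have "g \<otimes>\<^bsub>PGL\<^esub> h = proj_map (M ** N)"
          using proj_map_mult invertible_gen_mats by simp
        then show ?case using gen_mats_mult MN by blast
      qed
    qed
    have "proj_map M \<in> generate PGL {proj_map rho, proj_map sigma, proj_map tau}" if "M \<in> gen_mats" for M
      using that
    proof (induction rule: gen_mats.induct)
      case one
      then show ?case using generate.one[of PGL] by (simp add: proj_map_one)
    next
      case (rho M)
      then show ?case
        using generate.eng[OF generate.incl rho.IH, of "proj_map rho"]
        by (simp add: proj_map_mult invertible_gen_mats generators_in_gen_mats)
    next
      case (sigma M)
      then show ?case
        using generate.eng[OF generate.incl sigma.IH, of "proj_map sigma"]
        by (simp add: proj_map_mult invertible_gen_mats generators_in_gen_mats)
    next
      case (tau M)
      then show ?case
        using generate.eng[OF generate.incl tau.IH, of "proj_map tau"]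
        by (simp add: proj_map_mult invertible_gen_mats generators_in_gen_mats)
    qed
    then show "proj_map ` gen_mats \<subseteq> generate PGL {proj_map rho, proj_map sigma, proj_map tau}" by blast
  qed
  then show ?thesis by (simp add: G_def carrier_subgroup_generated S)
qed

lemma mult_G: "mult G = mult PGL" and one_G: "one G = one PGL"
  by (simp_all add: G_def)

lemma group_G: "group G"
  unfolding G_def by (rule group.group_subgroup_generated[OF group_BijGroup])

lemma orientation_preserving_G: "g \<in> carrier G \<Longrightarrow> orientation_preserving_proj g"
  unfolding carrier_G orientation_preserving_proj_def using det_gen_mats by blast

section \<open>The isomorphism type of the group\<close>

abbreviation (input) "swap \<equiv> Transposition.transpose"

lemma permutes_3_cases:
  assumes "p permutes {1..3::nat}"
  shows "p \<in> {id, swap 1 2, swap 2 3, swap 1 3,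
    swap 1 2 \<circ> swap 2 3, swap 2 3 \<circ> swap 1 2}"
proof -
  have iff: "k \<in> {1..3} \<longleftrightarrow> k = 1 \<or> k = 2 \<or> k = 3" for k :: nat by auto
  have "p k = 1 \<or> p k = 2 \<or> p k = 3" if "k \<in> {1..3}" for k
    using permutes_in_image[OF assms, of k] that iff[of "p k"] by blast
  then have val: "p 1 = 1 \<or> p 1 = 2 \<or> p 1 = 3" "p 2 = 1 \<or> p 2 = 2 \<or> p 2 = 3"
    "p 3 = 1 \<or> p 3 = 2 \<or> p 3 = 3" by simp_all
  have ne: "p 1 \<noteq> p 2" "p 1 \<noteq> p 3" "p 2 \<noteq> p 3"
    by (simp_all add: inj_eq[OF permutes_inj[OF assms]])
  have ext: "p = q" if "p 1 = q 1" "p 2 = q 2" "p 3 = q 3" "\<And>k. k \<notin> {1..3} \<Longrightarrow> q k = k" for q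
  proof
    fix k show "p k = q k"
      using that permutes_not_in[OF assms, of k] iff[of k] by (cases "k \<in> {1..3}") auto
  qed
  consider "p 1 = 1" "p 2 = 2" "p 3 = 3" | "p 1 = 1" "p 2 = 3" "p 3 = 2"
    | "p 1 = 2" "p 2 = 1" "p 3 = 3" | "p 1 = 2" "p 2 = 3" "p 3 = 1"
    | "p 1 = 3" "p 2 = 1" "p 3 = 2" | "p 1 = 3" "p 2 = 2" "p 3 = 1"
    using val ne by (elim disjE) (simp_all only: simp_thms)
  then show ?thesis
  proof cases
    case 1 then have "p = id" by (intro ext) auto then show ?thesis by blast
  next
    case 2 then have "p = swap 2 3" by (intro ext) (auto simp: Transposition.transpose_def) then show ?thesis by blast
  next
    case 3 then have "p = swap 1 2" by (intro ext) (auto simp: Transposition.transpose_def) then show ?thesis by blast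
  next
    case 4 then have "p = swap 1 2 \<circ> swap 2 3" by (intro ext) (auto simp: Transposition.transpose_def) then show ?thesis by blast
  next
    case 5 then have "p = swap 2 3 \<circ> swap 1 2" by (intro ext) (auto simp: Transposition.transpose_def) then show ?thesis by blast
  next
    case 6 then have "p = swap 1 3" by (intro ext) (auto simp: Transposition.transpose_def) then show ?thesis by blast
  qed
qed

text \<open>A permutation acts contravariantly on the first three coordinates, twisted by its sign.\<close>

definition perm_vec :: "(nat \<Rightarrow> nat) \<Rightarrow> real ^ 4 \<Rightarrow> real ^ 4" where
  "perm_vec p v = vector [of_int (sign p) * v $ of_nat (p 1), of_int (sign p) * v $ of_nat (p 2),
     of_int (sign p) * v $ of_nat (p 3), v $ 4]"

lemma perm_vec_nth:
  "k \<in> {1..3} \<Longrightarrow> perm_vec p v $ of_nat k = of_int (sign p) * v $ of_nat (p k)"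
proof -
  assume "k \<in> {1..3}"
  then have "k = 1 \<or> k = 2 \<or> k = 3" by auto
  then show ?thesis by (auto simp: perm_vec_def)
qed

lemma perm_vec_comp:
  assumes "p permutes {1..3}" "q permutes {1..3}"
  shows "perm_vec p (perm_vec q v) = perm_vec (q \<circ> p) v"
proof -
  have "p 1 \<in> {1..3}" "p 2 \<in> {1..3}" "p 3 \<in> {1..3}"
    using permutes_in_image[OF assms(1)] by auto
  moreover have "sign (q \<circ> p) = sign q * sign p"
    using assms by (intro sign_compose) (auto simp: permutation_permutes)
  ultimately show ?thesis
    unfolding perm_vec_def[of p] perm_vec_def[of "q \<circ> p"]
    by (simp add: perm_vec_nth) (simp add: perm_vec_def ac_simps)
qed

lemma perm_vec_values:
  "perm_vec id v = v"
  "perm_vec (swap 1 2) v = vector [- v $ 2, - v $ 1, - v $ 3, v $ 4]"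
  "perm_vec (swap 2 3) v = vector [- v $ 1, - v $ 3, - v $ 2, v $ 4]"
  "perm_vec (swap 1 3) v = vector [- v $ 3, - v $ 2, - v $ 1, v $ 4]"
  "perm_vec (swap 1 2 \<circ> swap 2 3) v = vector [v $ 2, v $ 3, v $ 1, v $ 4]"
  "perm_vec (swap 2 3 \<circ> swap 1 2) v = vector [v $ 3, v $ 1, v $ 2, v $ 4]"
  by (simp_all add: perm_vec_def sign_swap_id sign_compose permutation_swap_id Transposition.transpose_def vec_eq_iff forall_4)

text \<open>An odd permutation, with its sign twist, permutes the three cyclic differences without a
  sign and negates x + y + z. The discrepancy is a global factor, so \<open>tau\<close> commutes
  with all permutations projectively and the product of groups is direct.\<close>

lemma tau_perm_vec:
  assumes "p permutes {1..3}"
  shows "tau *v perm_vec p v = of_int (sign p) *\<^sub>R perm_vec p (tau *v v)"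
  using permutes_3_cases[OF assms]
  by (elim insertE emptyE; simp only: perm_vec_values tau_vec)
    (simp_all add: sign_swap_id sign_compose permutation_swap_id vec_eq_iff forall_4)

lemma linear_perm_vec: "linear (perm_vec p)"
  by (rule linearI) (simp_all add: perm_vec_def vec_eq_iff forall_4 algebra_simps)

definition perm_mat :: "(nat \<Rightarrow> nat) \<Rightarrow> real ^ 4 ^ 4" where
  "perm_mat p = matrix (perm_vec p)"

lemma perm_mat_vec: "perm_mat p *v v = perm_vec p v"
  unfolding perm_mat_def by (rule matrix_works) (simp add: linear_perm_vec linear_matrix_vector_mul_eq)

lemma perm_mat_values:
  "perm_mat id = mat 1" "perm_mat (swap 1 2) = sigma" "perm_mat (swap 2 3) = rho ** sigma"
  "perm_mat (swap 1 3) = sigma ** rho" "perm_mat (swap 1 2 \<circ> swap 2 3) = rho"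
  "perm_mat (swap 2 3 \<circ> swap 1 2) = rho ** rho"
  unfolding matrix_eq perm_mat_vec perm_vec_values
  by (simp_all add: matrix_vector_mul_assoc[symmetric] rho_vec sigma_vec)

lemma perm_mat_in_gen_mats:
  assumes "p permutes {1..3}" shows "perm_mat p \<in> gen_mats"
  using permutes_3_cases[OF assms]
  by (elim insertE emptyE; simp only: perm_mat_values)
    (auto intro: gen_mats.one gen_mats_mult generators_in_gen_mats)

definition tau_pow :: "int \<Rightarrow> real ^ 4 ^ 4" where
  "tau_pow k = (if k = 0 then mat 1 else tau)"

lemma tau_pow_in_gen_mats: "tau_pow k \<in> gen_mats"
  by (simp add: tau_pow_def gen_mats.one generators_in_gen_mats)

text \<open>Inverting the permutation turns the contravariant action into a homomorphism.\<close>

definition G_param :: "(nat \<Rightarrow> nat) \<times> int \<Rightarrow> (real ^ 4) set \<Rightarrow> (real ^ 4) set" where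
  "G_param x = proj_map (perm_mat (Hilbert_Choice.inv (fst x)) ** tau_pow (snd x))"

lemma G_param_carrier:
  assumes "p permutes {1..3}" shows "G_param (p, k) \<in> carrier G"
proof -
  have "perm_mat (Hilbert_Choice.inv p) ** tau_pow k \<in> gen_mats"
    by (intro gen_mats_mult perm_mat_in_gen_mats permutes_inv assms tau_pow_in_gen_mats)
  then show ?thesis by (simp add: carrier_G G_param_def)
qed

lemma G_param_mult:
  assumes p: "p permutes {1..3}" and q: "q permutes {1..3}" and k: "k \<in> {0, 1}" "l \<in> {0, 1}"
  shows "G_param (p \<circ> q, (k + l) mod 2) = G_param (p, k) \<otimes>\<^bsub>G\<^esub> G_param (q, l)"
proof -
  let ?p = "Hilbert_Choice.inv p" and ?q = "Hilbert_Choice.inv q"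
  have pq: "?p permutes {1..3}" "?q permutes {1..3}" using p q permutes_inv by auto
  have inv: "Hilbert_Choice.inv (p \<circ> q) = ?q \<circ> ?p"
    using p q by (intro o_inv_distrib) (auto intro: permutes_bij)
  have mats: "perm_mat ?p ** tau_pow k \<in> gen_mats" "perm_mat ?q ** tau_pow l \<in> gen_mats"
    by (intro gen_mats_mult perm_mat_in_gen_mats pq tau_pow_in_gen_mats)+
  have "proj_map (perm_mat (?q \<circ> ?p) ** tau_pow ((k + l) mod 2))
      = proj_map ((perm_mat ?p ** tau_pow k) ** (perm_mat ?q ** tau_pow l))"
  proof (rule proj_map_eqI)
    fix v :: "real ^ 4" assume v: "v \<noteq> 0"
    \<comment> \<open>Moving \<open>tau\<close> past a permutation costs a factor 1 or -1, harmless
      for projective points.\<close>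
    have comm: "\<exists>c. c \<noteq> 0 \<and> tau_pow k *v perm_vec ?q u = c *\<^sub>R perm_vec ?q (tau_pow k *v u)" for u
      using tau_perm_vec[OF pq(2), of u] by (cases "k = 0")
        (auto simp: tau_pow_def sign_def intro: exI[of _ 1] exI[of _ "- 1"])
    then obtain c where c: "c \<noteq> 0"
      "tau_pow k *v perm_vec ?q (tau_pow l *v v) = c *\<^sub>R perm_vec ?q (tau_pow k *v (tau_pow l *v v))" by blast
    \<comment> \<open>Reducing the exponent modulo 2 costs the factor -3 when both exponents are
      1.\<close>
    have "tau *v (tau *v v) = (- 3) *\<^sub>R v" by (simp add: tau_vec vec_eq_iff forall_4)
    then have "\<exists>d. d \<noteq> 0 \<and> tau_pow k *v (tau_pow l *v v) = d *\<^sub>R (tau_pow ((k + l) mod 2) *v v)"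
      using k by (auto simp: tau_pow_def intro: exI[of _ 1] exI[of _ "- 3"])
    then obtain d where d: "d \<noteq> 0"
      "tau_pow k *v (tau_pow l *v v) = d *\<^sub>R (tau_pow ((k + l) mod 2) *v v)" by blast
    have sc: "perm_vec p (c *\<^sub>R u) = c *\<^sub>R perm_vec p u" for p c u
      using linear_perm_vec by (rule linear_scale)
    have "((perm_mat ?p ** tau_pow k) ** (perm_mat ?q ** tau_pow l)) *v v
        = perm_vec ?p (tau_pow k *v perm_vec ?q (tau_pow l *v v))"
      by (simp add: matrix_vector_mul_assoc[symmetric] perm_mat_vec)
    also have "\<dots> = (c * d) *\<^sub>R perm_vec ?p (perm_vec ?q (tau_pow ((k + l) mod 2) *v v))"
      by (simp add: c(2) d(2) sc)
    also have "\<dots> = (c * d) *\<^sub>R ((perm_mat (?q \<circ> ?p) ** tau_pow ((k + l) mod 2)) *v v)"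
      by (simp add: perm_vec_comp[OF pq] matrix_vector_mul_assoc[symmetric] perm_mat_vec)
    finally have eq: "((perm_mat ?p ** tau_pow k) ** (perm_mat ?q ** tau_pow l)) *v v
        = (c * d) *\<^sub>R ((perm_mat (?q \<circ> ?p) ** tau_pow ((k + l) mod 2)) *v v)" .
    have "(perm_mat (?q \<circ> ?p) ** tau_pow ((k + l) mod 2)) *v v \<noteq> 0"
      by (intro invertible_mult_nonzero invertible_gen_mats gen_mats_mult perm_mat_in_gen_mats
          permutes_compose pq tau_pow_in_gen_mats v)
    then show "proj_pt ((perm_mat (?q \<circ> ?p) ** tau_pow ((k + l) mod 2)) *v v)
        = proj_pt (((perm_mat ?p ** tau_pow k) ** (perm_mat ?q ** tau_pow l)) *v v)"
      unfolding eq using c(1) d(1) by (simp add: proj_pt_scaleR)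
  qed
  then show ?thesis
    unfolding G_param_def mult_G using mats by (simp add: inv proj_map_mult invertible_gen_mats)
qed

text \<open>\<open>tau\<close> sends the first basis vector to one with nonzero last entry, which
  permutations do not change, so that line cannot be fixed if k is nonzero. A permutation fixing the
  first two coordinate lines is the identity.\<close>

lemma G_param_eq_one:
  assumes p: "p permutes {1..3}" and one: "G_param (p, k) = \<one>\<^bsub>G\<^esub>"
  shows "p = id \<and> k = 0"
proof -
  let ?q = "Hilbert_Choice.inv p"
  have q: "?q permutes {1..3}" using p by (rule permutes_inv)
  have fix_pt: "\<exists>c. perm_vec ?q (tau_pow k *v v) = c *\<^sub>R v" if v: "v \<noteq> 0" for v
  proof -
    have "proj_map (perm_mat ?q ** tau_pow k) = proj_map (mat 1)"
      using one by (simp add: G_param_def one_G proj_map_one)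
    then have "proj_map (perm_mat ?q ** tau_pow k) (proj_pt v) = proj_map (mat 1) (proj_pt v)" by simp
    then have "proj_pt ((perm_mat ?q ** tau_pow k) *v v) = proj_pt (mat 1 *v v)"
      by (simp only: proj_map_pt[OF v])
    moreover have "(perm_mat ?q ** tau_pow k) *v v \<noteq> 0"
      by (intro invertible_mult_nonzero invertible_gen_mats gen_mats_mult perm_mat_in_gen_mats
          q tau_pow_in_gen_mats v)
    ultimately show ?thesis using v
      by (auto simp: proj_pt_eq_iff matrix_vector_mul_assoc[symmetric] perm_mat_vec)
  qed
  have nz: "vector [1, 0, 0, 0] \<noteq> (0 :: real ^ 4)" "vector [0, 1, 0, 0] \<noteq> (0 :: real ^ 4)"
    by (auto simp: vec_eq_iff forall_4)
  have k: "k = 0"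
  proof (rule ccontr)
    assume "k \<noteq> 0"
    then show False using fix_pt[OF nz(1)]
      by (auto simp: tau_pow_def tau_vec perm_vec_def vec_eq_iff forall_4)
  qed
  obtain c d where cd: "perm_vec ?q (vector [1, 0, 0, 0]) = c *\<^sub>R vector [1, 0, 0, 0]"
    "perm_vec ?q (vector [0, 1, 0, 0]) = d *\<^sub>R vector [0, 1, 0, 0]"
    using fix_pt[OF nz(1)] fix_pt[OF nz(2)] k by (auto simp: tau_pow_def)
  have "?q = id"
    using permutes_3_cases[OF q] cd
    by (elim insertE emptyE; simp only: perm_vec_values) (auto simp: vec_eq_iff forall_4)
  then have "p = id" using p by (metis permutes_inv_inv inv_id)
  then show ?thesis using k by blast
qed

lemma G_iso: "G \<cong> sym_group 3 \<times>\<times> integer_mod_group 2"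
proof -
  let ?S = "sym_group 3 \<times>\<times> integer_mod_group 2"
  have S: "group ?S"
    by (intro DirProd_group sym_group_is_group group_integer_mod_group)
  have carr: "carrier ?S = {p. p permutes {1..3}} \<times> {0, 1}"
    by (auto simp: sym_group_def carrier_integer_mod_group)
  have mult: "x \<otimes>\<^bsub>?S\<^esub> y = (fst x \<circ> fst y, (snd x + snd y) mod 2)" for x y
    by (cases x; cases y) (simp add: sym_group_def)
  have hom: "G_param \<in> hom ?S G"
    unfolding hom_def carr mult
  proof (intro CollectI conjI ballI)
    show "G_param \<in> {p. p permutes {1..3}} \<times> {0, 1} \<rightarrow> carrier G"
      using G_param_carrier by (intro funcsetI) (clarsimp simp del: One_nat_def)
    fix x y :: "(nat \<Rightarrow> nat) \<times> int"
    assume "x \<in> {p. p permutes {1..3}} \<times> {0, 1}" "y \<in> {p. p permutes {1..3}} \<times> {0, 1}"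
    then show "G_param (fst x \<circ> fst y, (snd x + snd y) mod 2) = G_param x \<otimes>\<^bsub>G\<^esub> G_param y"
      using G_param_mult[of "fst x" "fst y" "snd x" "snd y"] by (simp add: mem_Times_iff)
  qed
  interpret group_hom ?S G G_param
    using S group_G hom by (simp add: group_hom_def group_hom_axioms_def)
  have inj: "inj_on G_param (carrier ?S)"
    unfolding inj_on_one_iff
  proof (intro allI impI)
    fix x assume "x \<in> carrier ?S" "G_param x = \<one>\<^bsub>G\<^esub>"
    then show "x = \<one>\<^bsub>?S\<^esub>" using G_param_eq_one[of "fst x" "snd x"]
      by (auto simp: carr sym_group_def)
  qed
  have img: "G_param ` carrier ?S = carrier G"
  proof
    show "G_param ` carrier ?S \<subseteq> carrier G" using G_param_carrier by (auto simp: carr)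
    have gens: "proj_map rho \<in> G_param ` carrier ?S" "proj_map sigma \<in> G_param ` carrier ?S"
      "proj_map tau \<in> G_param ` carrier ?S"
    proof -
      have mem: "proj_map (perm_mat q ** tau_pow k) \<in> G_param ` carrier ?S"
        if "q permutes {1..3}" "k \<in> {0, 1}" for q k
        using that by (intro image_eqI[of _ _ "(Hilbert_Choice.inv q, k)"])
          (auto simp: G_param_def sym_group_def carrier_integer_mod_group permutes_inv permutes_inv_inv)
      have sw: "swap 1 2 permutes {1..3::nat}" "swap 2 3 permutes {1..3::nat}"
        by (auto intro: permutes_swap_id)
      show "proj_map rho \<in> G_param ` carrier ?S"
        using mem[OF permutes_compose[OF sw(2,1)], of 0] unfolding perm_mat_values by (simp add: tau_pow_def)
      show "proj_map sigma \<in> G_param ` carrier ?S"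
        using mem[OF sw(1), of 0] unfolding perm_mat_values by (simp add: tau_pow_def)
      show "proj_map tau \<in> G_param ` carrier ?S"
        using mem[OF permutes_id, of 1] unfolding perm_mat_values by (simp add: tau_pow_def)
    qed
    have step: "proj_map (A ** M) \<in> G_param ` carrier ?S"
      if "proj_map A \<in> G_param ` carrier ?S" "A \<in> gen_mats" "M \<in> gen_mats" "proj_map M \<in> G_param ` carrier ?S" for A M
    proof -
      from that(1) obtain x where x: "proj_map A = G_param x" "x \<in> carrier ?S" by (rule imageE)
      from that(4) obtain y where y: "proj_map M = G_param y" "y \<in> carrier ?S" by (rule imageE)
      have "proj_map (A ** M) = G_param x \<otimes>\<^bsub>G\<^esub> G_param y"
        unfolding x(1)[symmetric] y(1)[symmetric] mult_G using that by (simp add: proj_map_mult invertible_gen_mats)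
      also have "\<dots> = G_param (x \<otimes>\<^bsub>?S\<^esub> y)" by (rule hom_mult[OF x(2) y(2), symmetric])
      finally show ?thesis by (rule image_eqI) (rule G.m_closed[OF x(2) y(2)])
    qed
    have "proj_map M \<in> G_param ` carrier ?S" if "M \<in> gen_mats" for M
      using that
    proof (induction rule: gen_mats.induct)
      case one
      have "proj_map (mat 1) = G_param \<one>\<^bsub>?S\<^esub>" using hom_one by (simp add: one_G proj_map_one)
      then show ?case by (rule image_eqI) (rule G.one_closed)
    next
      case (rho M) then show ?case by (intro step gens generators_in_gen_mats)
    next
      case (sigma M) then show ?case by (intro step gens generators_in_gen_mats)
    next
      case (tau M) then show ?case by (intro step gens generators_in_gen_mats)
    qed
    then show "carrier G \<subseteq> G_param ` carrier ?S" unfolding carrier_G by blast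
  qed
  have "G_param \<in> iso ?S G"
    using hom inj img by (simp add: iso_def bij_betw_def)
  then have "?S \<cong> G" by (rule is_isoI)
  then show ?thesis by (rule group.iso_sym[OF S])
qed

section \<open>Symmetries of the arrangement\<close>

text \<open>The map permutes the six linear forms up to nonzero factors. Quantifying from both sides
  lets sign conditions be transferred in either direction without a counting argument.\<close>

definition arrangement_sym :: "real ^ 4 ^ 4 \<Rightarrow> bool" where
  "arrangement_sym M \<longleftrightarrow> invertible M \<and>
     (\<forall>a\<in>normals. \<exists>b\<in>normals. \<exists>c. c \<noteq> 0 \<and> (\<forall>v. a \<bullet> (M *v v) = c * (b \<bullet> v))) \<and>
     (\<forall>b\<in>normals. \<exists>a\<in>normals. \<exists>c. c \<noteq> 0 \<and> (\<forall>v. a \<bullet> (M *v v) = c * (b \<bullet> v)))"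

lemma arrangement_symI:
  assumes "invertible M" "fst ` set ts = normals" "(snd \<circ> snd) ` set ts = normals"
    "\<And>a c b v. (a, c, b) \<in> set ts \<Longrightarrow> c \<noteq> 0 \<and> a \<bullet> (M *v v) = c * (b \<bullet> v)"
  shows "arrangement_sym M"
  unfolding arrangement_sym_def
proof (intro conjI ballI assms(1))
  fix a assume "a \<in> normals"
  then obtain c b where "(a, c, b) \<in> set ts" unfolding assms(2)[symmetric] by auto
  moreover from this have "b \<in> normals" unfolding assms(3)[symmetric] by force
  ultimately show "\<exists>b\<in>normals. \<exists>c. c \<noteq> 0 \<and> (\<forall>v. a \<bullet> (M *v v) = c * (b \<bullet> v))" using assms(4) by blast
next
  fix b assume "b \<in> normals"
  then obtain a c where "(a, c, b) \<in> set ts" unfolding assms(3)[symmetric] by auto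
  moreover from this have "a \<in> normals" unfolding assms(2)[symmetric] by force
  ultimately show "\<exists>a\<in>normals. \<exists>c. c \<noteq> 0 \<and> (\<forall>v. a \<bullet> (M *v v) = c * (b \<bullet> v))" using assms(4) by blast
qed

lemma arrangement_sym_mult:
  assumes "arrangement_sym M" "arrangement_sym N" shows "arrangement_sym (M ** N)"
  unfolding arrangement_sym_def
proof (intro conjI ballI)
  show "invertible (M ** N)" using assms invertible_mult by (auto simp: arrangement_sym_def)
next
  fix a assume "a \<in> normals"
  then obtain b c where b: "b \<in> normals" "c \<noteq> 0" "\<forall>v. a \<bullet> (M *v v) = c * (b \<bullet> v)"
    using assms(1) unfolding arrangement_sym_def by blast
  then obtain b' c' where "b' \<in> normals" "c' \<noteq> 0" "\<forall>v. b \<bullet> (N *v v) = c' * (b' \<bullet> v)"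
    using assms(2) unfolding arrangement_sym_def by blast
  with b show "\<exists>b\<in>normals. \<exists>c. c \<noteq> 0 \<and> (\<forall>v. a \<bullet> ((M ** N) *v v) = c * (b \<bullet> v))"
    by (intro bexI[of _ b'] exI[of _ "c * c'"]) (simp_all add: matrix_vector_mul_assoc[symmetric])
next
  fix b assume "b \<in> normals"
  then obtain a c where a: "a \<in> normals" "c \<noteq> 0" "\<forall>v. a \<bullet> (N *v v) = c * (b \<bullet> v)"
    using assms(2) unfolding arrangement_sym_def by blast
  then obtain a' c' where "a' \<in> normals" "c' \<noteq> 0" "\<forall>v. a' \<bullet> (M *v v) = c' * (a \<bullet> v)"
    using assms(1) unfolding arrangement_sym_def by blast
  with a show "\<exists>a\<in>normals. \<exists>c. c \<noteq> 0 \<and> (\<forall>v. a \<bullet> ((M ** N) *v v) = c * (b \<bullet> v))"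
    by (intro bexI[of _ a'] exI[of _ "c' * c"]) (simp_all add: matrix_vector_mul_assoc[symmetric])
qed

lemma arrangement_sym_generators:
  "arrangement_sym rho" "arrangement_sym sigma" "arrangement_sym tau"
proof -
  let ?x = "vector [1, 0, 0, 0] :: real ^ 4" and ?y = "vector [0, 1, 0, 0] :: real ^ 4"
    and ?z = "vector [0, 0, 1, 0] :: real ^ 4" and ?a = "vector [0, 1, -1, -1] :: real ^ 4"
    and ?b = "vector [-1, 0, 1, -1] :: real ^ 4" and ?c = "vector [1, -1, 0, -1] :: real ^ 4"
  show "arrangement_sym rho"
    by (rule arrangement_symI[where ts = "[(?x, 1, ?y), (?y, 1, ?z), (?z, 1, ?x), (?a, 1, ?b), (?b, 1, ?c), (?c, 1, ?a)]"])
      (auto simp: normals_def inner_4 rho_vec invertible_gen_mats generators_in_gen_mats)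
  show "arrangement_sym sigma"
    by (rule arrangement_symI[where ts = "[(?x, - 1, ?y), (?y, - 1, ?x), (?z, - 1, ?z), (?a, 1, ?b), (?b, 1, ?a), (?c, 1, ?c)]"])
      (auto simp: normals_def inner_4 sigma_vec invertible_gen_mats generators_in_gen_mats)
  \<comment> \<open>\<open>tau\<close> turns the first triple of forms into the second; applying it
    again returns the first triple times -3.\<close>
  show "arrangement_sym tau"
    by (rule arrangement_symI[where ts = "[(?x, 1, ?a), (?y, 1, ?b), (?z, 1, ?c), (?a, - 3, ?x), (?b, - 3, ?y), (?c, - 3, ?z)]"])
      (auto simp: normals_def inner_4 tau_vec invertible_gen_mats generators_in_gen_mats)
qed

lemma arrangement_sym_one: "arrangement_sym (mat 1)"
proof -
  have "\<exists>b\<in>normals. \<exists>c. c \<noteq> 0 \<and> (\<forall>v. a \<bullet> (mat 1 *v v) = c * (b \<bullet> v))"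
    "\<exists>b\<in>normals. \<exists>c. c \<noteq> 0 \<and> (\<forall>v. b \<bullet> (mat 1 *v v) = c * (a \<bullet> v))" if "a \<in> normals" for a
    using that by (intro bexI[of _ a] exI[of _ 1]; simp)+
  then show ?thesis
    unfolding arrangement_sym_def using invertible_gen_mats[OF gen_mats.one] by blast
qed

lemma arrangement_sym_gen_mats: "M \<in> gen_mats \<Longrightarrow> arrangement_sym M"
  by (induction rule: gen_mats.induct)
    (simp_all add: arrangement_sym_one arrangement_sym_mult arrangement_sym_generators)

lemma arrangement_sym_generic:
  assumes "arrangement_sym M" shows "generic (M *v w) \<longleftrightarrow> generic w"
proof
  show "generic w" if "generic (M *v w)"
    unfolding generic_def
  proof
    fix b assume "b \<in> normals"
    then obtain a c where "a \<in> normals" "\<forall>v. a \<bullet> (M *v v) = c * (b \<bullet> v)"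
      using assms unfolding arrangement_sym_def by blast
    then show "b \<bullet> w \<noteq> 0" using that by (auto simp: generic_def)
  qed
  show "generic (M *v w)" if "generic w"
    unfolding generic_def
  proof
    fix a assume "a \<in> normals"
    then obtain b c where "b \<in> normals" "c \<noteq> 0" "\<forall>v. a \<bullet> (M *v v) = c * (b \<bullet> v)"
      using assms unfolding arrangement_sym_def by blast
    then show "a \<bullet> (M *v w) \<noteq> 0" using that by (auto simp: generic_def)
  qed
qed

lemma arrangement_sym_surj:
  assumes "arrangement_sym M" obtains v where "u = M *v v"
proof -
  obtain N where "M ** N = mat 1" using assms unfolding arrangement_sym_def invertible_def by blast
  then have "u = M *v (N *v u)" by (simp add: matrix_vector_mul_assoc)
  then show thesis using that by blast
qed

text \<open>The factor attached to a form occurs once for \<open>w\<close> and once for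
  \<open>v\<close>, so it enters squared and its sign does not matter.\<close>

lemma arrangement_sym_closed_cone:
  assumes M: "arrangement_sym M"
  shows "M *v v \<in> closed_cone (M *v w) \<longleftrightarrow> v \<in> closed_cone w"
proof -
  have *: "0 \<le> (c * r) * (c * s) \<longleftrightarrow> 0 \<le> r * s" if "c \<noteq> 0" for c r s :: real
  proof -
    have "(c * r) * (c * s) = (c * c) * (r * s)" by simp
    moreover have "0 < c * c" using that by (auto simp: less_le)
    ultimately show ?thesis by (simp only: zero_le_mult_iff) linarith
  qed
  show ?thesis
  proof
    assume v: "M *v v \<in> closed_cone (M *v w)"
    show "v \<in> closed_cone w" unfolding closed_cone_def
    proof (intro CollectI ballI)
      fix b assume "b \<in> normals"
      then obtain a c where "a \<in> normals" "c \<noteq> 0" "\<forall>v. a \<bullet> (M *v v) = c * (b \<bullet> v)"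
        using M unfolding arrangement_sym_def by blast
      then show "0 \<le> (b \<bullet> w) * (b \<bullet> v)" using v * by (auto simp: closed_cone_def)
    qed
  next
    assume v: "v \<in> closed_cone w"
    show "M *v v \<in> closed_cone (M *v w)" unfolding closed_cone_def
    proof (intro CollectI ballI)
      fix a assume "a \<in> normals"
      then obtain b c where b: "b \<in> normals" "c \<noteq> 0" "\<forall>v. a \<bullet> (M *v v) = c * (b \<bullet> v)"
        using M unfolding arrangement_sym_def by blast
      then have "0 \<le> (b \<bullet> w) * (b \<bullet> v)" using v by (auto simp: closed_cone_def)
      then show "0 \<le> (a \<bullet> (M *v w)) * (a \<bullet> (M *v v))" using b *[of c] by simp
    qed
  qed
qed

lemma arrangement_sym_nonzero: "arrangement_sym M \<Longrightarrow> v \<noteq> 0 \<Longrightarrow> M *v v \<noteq> 0"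
  using invertible_mult_nonzero by (auto simp: arrangement_sym_def)

lemma proj_map_chamber:
  assumes M: "arrangement_sym M" shows "proj_map M ` chamber w = chamber (M *v w)"
proof
  show "proj_map M ` chamber w \<subseteq> chamber (M *v w)"
    using arrangement_sym_closed_cone[OF M] arrangement_sym_nonzero[OF M]
    by (auto simp: chamber_def proj_set_def proj_map_pt)
  show "chamber (M *v w) \<subseteq> proj_map M ` chamber w"
  proof
    fix p assume "p \<in> chamber (M *v w)"
    then obtain u where u: "p = proj_pt u" "u \<noteq> 0" "u \<in> closed_cone (M *v w)"
      by (auto simp: chamber_def proj_set_def)
    obtain v where v: "u = M *v v" using arrangement_sym_surj[OF M] by blast
    then have "v \<noteq> 0" using u by (auto simp: matrix_vector_mult_0_right)
    moreover have "v \<in> closed_cone w" using u v arrangement_sym_closed_cone[OF M] by blast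
    ultimately have "proj_pt v \<in> chamber w" by (auto simp: chamber_def proj_set_def)
    then show "p \<in> proj_map M ` chamber w"
      using u v \<open>v \<noteq> 0\<close> by (intro image_eqI[of _ _ "proj_pt v"]) (simp_all add: proj_map_pt)
  qed
qed

lemma proj_map_proj_plane:
  assumes M: "arrangement_sym M" and c: "c \<noteq> 0" "\<And>v. a \<bullet> (M *v v) = c * (b \<bullet> v)"
  shows "proj_map M ` proj_plane b = proj_plane a"
proof
  show "proj_map M ` proj_plane b \<subseteq> proj_plane a"
    using c arrangement_sym_nonzero[OF M] by (force simp: proj_plane_def proj_map_pt)
  show "proj_plane a \<subseteq> proj_map M ` proj_plane b"
  proof
    fix p assume "p \<in> proj_plane a"
    then obtain u where u: "p = proj_pt u" "u \<noteq> 0" "a \<bullet> u = 0" by (auto simp: proj_plane_def)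
    obtain v where v: "u = M *v v" using arrangement_sym_surj[OF M] by blast
    then have "v \<noteq> 0" "b \<bullet> v = 0" using u c by (auto simp: matrix_vector_mult_0_right)
    then show "p \<in> proj_map M ` proj_plane b"
      using u v by (intro image_eqI[of _ _ "proj_pt v"]) (auto simp: proj_map_pt proj_plane_def)
  qed
qed

lemma arrangement_invariant:
  assumes "g \<in> carrier G" shows "(`) g ` arrangement = arrangement"
proof -
  obtain M where M: "M \<in> gen_mats" "g = proj_map M" using assms carrier_G by auto
  note sym = arrangement_sym_gen_mats[OF M(1)]
  show ?thesis
    unfolding arrangement_eq M(2)
  proof
    show "(`) (proj_map M) ` proj_plane ` normals \<subseteq> proj_plane ` normals"
    proof clarify
      fix b assume "b \<in> normals"
      then obtain a c where "a \<in> normals" "c \<noteq> 0" "\<forall>v. a \<bullet> (M *v v) = c * (b \<bullet> v)"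
        using sym unfolding arrangement_sym_def by blast
      then show "proj_map M ` proj_plane b \<in> proj_plane ` normals"
        using proj_map_proj_plane[OF sym, of c a b] by blast
    qed
    show "proj_plane ` normals \<subseteq> (`) (proj_map M) ` proj_plane ` normals"
    proof clarify
      fix a assume "a \<in> normals"
      then obtain b c where "b \<in> normals" "c \<noteq> 0" "\<forall>v. a \<bullet> (M *v v) = c * (b \<bullet> v)"
        using sym unfolding arrangement_sym_def by blast
      then show "proj_plane a \<in> (`) (proj_map M) ` proj_plane ` normals"
        using proj_map_proj_plane[OF sym, of c a b] by blast
    qed
  qed
qed

lemma chamber_action_apply:
  assumes "M \<in> gen_mats" "generic w"
  shows "chamber_action (proj_map M) (chamber w) = chamber (M *v w)"
  using assms by (simp add: chamber_action_def chambers_eq proj_map_chamber arrangement_sym_gen_mats)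

lemma group_action_chambers: "group_action G chambers chamber_action"
proof -
  have maps: "chamber_action g K \<in> chambers" if "g \<in> carrier G" "K \<in> chambers" for g K
    using that chamber_action_apply arrangement_sym_gen_mats arrangement_sym_generic
    by (auto simp: carrier_G chambers_eq)
  have comp: "chamber_action (g \<otimes>\<^bsub>G\<^esub> h) K = chamber_action g (chamber_action h K)"
    if ghK: "g \<in> carrier G" "h \<in> carrier G" "K \<in> chambers" for g h K
  proof -
    obtain M where M: "M \<in> gen_mats" "g = proj_map M" using ghK(1) by (auto simp: carrier_G)
    obtain N where N: "N \<in> gen_mats" "h = proj_map N" using ghK(2) by (auto simp: carrier_G)
    obtain w where w: "generic w" "K = chamber w" using ghK(3) by (auto simp: chambers_eq)
    note MN = M(1) N(1) M(2) N(2)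
    have "g \<otimes>\<^bsub>G\<^esub> h = proj_map (M ** N)"
      using MN by (simp add: mult_G proj_map_mult invertible_gen_mats)
    then show ?thesis
      using MN w by (simp add: chamber_action_apply gen_mats_mult matrix_vector_mul_assoc
          arrangement_sym_generic arrangement_sym_gen_mats)
  qed
  have one: "chamber_action \<one>\<^bsub>G\<^esub> K = K" if "K \<in> chambers" for K
    using that chamber_action_apply[OF gen_mats.one] by (auto simp: one_G proj_map_one chambers_eq)
  interpret group G by (rule group_G)
  have "bij_betw (chamber_action g) chambers chambers" if g: "g \<in> carrier G" for g
  proof (rule bij_betw_byWitness[where f' = "chamber_action (inv\<^bsub>G\<^esub> g)"])
    show "\<forall>K\<in>chambers. chamber_action (inv\<^bsub>G\<^esub> g) (chamber_action g K) = K"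
      using comp[of "inv\<^bsub>G\<^esub> g" g] g one by (simp add: l_inv)
    show "\<forall>K\<in>chambers. chamber_action g (chamber_action (inv\<^bsub>G\<^esub> g) K) = K"
      using comp[of g "inv\<^bsub>G\<^esub> g"] g one by (simp add: r_inv)
  qed (use maps g in auto)
  then have bij: "chamber_action g \<in> Bij chambers" if "g \<in> carrier G" for g
    using that by (simp add: Bij_def chamber_action_def)
  have "chamber_action (g \<otimes>\<^bsub>G\<^esub> h) = compose chambers (chamber_action g) (chamber_action h)"
    if "g \<in> carrier G" "h \<in> carrier G" for g h
  proof
    fix K show "chamber_action (g \<otimes>\<^bsub>G\<^esub> h) K = compose chambers (chamber_action g) (chamber_action h) K"
      using comp[OF that, of K] by (cases "K \<in> chambers") (simp_all add: compose_def chamber_action_def)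
  qed
  then have "chamber_action \<in> hom G (BijGroup chambers)"
    using bij by (auto simp: hom_def BijGroup_def)
  then show ?thesis
    using group_G group_BijGroup
    by (simp add: group_action_def group_hom_def group_hom_axioms_def)
qed

lemma orbit_chamber:
  "generic w \<Longrightarrow> orbit G chamber_action (chamber w) = (\<lambda>M. chamber (M *v w)) ` gen_mats"
  unfolding orbit_def carrier_G Setcompr_eq_image image_image
  by (intro image_cong refl chamber_action_apply)

section \<open>Sign patterns\<close>

definition pattern :: "real ^ 4 \<Rightarrow> bool list" where
  "pattern w = [0 < w $ 1, 0 < w $ 2, 0 < w $ 3, 0 < w $ 2 - w $ 3 - w $ 4,
     0 < w $ 3 - w $ 1 - w $ 4, 0 < w $ 1 - w $ 2 - w $ 4]"

lemma generic_iff: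
  "generic w \<longleftrightarrow> w $ 1 \<noteq> 0 \<and> w $ 2 \<noteq> 0 \<and> w $ 3 \<noteq> 0 \<and> w $ 2 - w $ 3 - w $ 4 \<noteq> 0 \<and>
     w $ 3 - w $ 1 - w $ 4 \<noteq> 0 \<and> w $ 1 - w $ 2 - w $ 4 \<noteq> 0"
  unfolding generic_def normals_def ball_simps inner_4 by (auto simp: algebra_simps)

lemma open_cone_iff:
  "v \<in> open_cone w \<longleftrightarrow> 0 < w $ 1 * v $ 1 \<and> 0 < w $ 2 * v $ 2 \<and> 0 < w $ 3 * v $ 3 \<and>
     0 < (w $ 2 - w $ 3 - w $ 4) * (v $ 2 - v $ 3 - v $ 4) \<and>
     0 < (w $ 3 - w $ 1 - w $ 4) * (v $ 3 - v $ 1 - v $ 4) \<and>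
     0 < (w $ 1 - w $ 2 - w $ 4) * (v $ 1 - v $ 2 - v $ 4)"
  unfolding open_cone_def normals_def mem_Collect_eq ball_simps inner_4
  by (simp add: algebra_simps)

lemma closed_cone_iff:
  "v \<in> closed_cone w \<longleftrightarrow> 0 \<le> w $ 1 * v $ 1 \<and> 0 \<le> w $ 2 * v $ 2 \<and> 0 \<le> w $ 3 * v $ 3 \<and>
     0 \<le> (w $ 2 - w $ 3 - w $ 4) * (v $ 2 - v $ 3 - v $ 4) \<and>
     0 \<le> (w $ 3 - w $ 1 - w $ 4) * (v $ 3 - v $ 1 - v $ 4) \<and>
     0 \<le> (w $ 1 - w $ 2 - w $ 4) * (v $ 1 - v $ 2 - v $ 4)"
  unfolding closed_cone_def normals_def mem_Collect_eq ball_simps inner_4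
  by (simp add: algebra_simps)

lemma pattern_eq_iff:
  assumes "generic w" "generic v" shows "pattern v = pattern w \<longleftrightarrow> v \<in> open_cone w"
proof -
  have *: "0 < r * s \<longleftrightarrow> (0 < s \<longleftrightarrow> 0 < r)" if "r \<noteq> 0" "s \<noteq> 0" for r s :: real
    using that by (auto simp: zero_less_mult_iff)
  show ?thesis
    using assms unfolding open_cone_iff pattern_def generic_iff list.inject
    by (simp only: * simp_thms)
qed

lemma pattern_minus: "generic w \<Longrightarrow> pattern (- w) = map Not (pattern w)"
  unfolding pattern_def generic_iff by auto

lemma chamber_eq_pattern:
  assumes "generic w" "generic v"
  shows "chamber w = chamber v \<longleftrightarrow> pattern v = pattern w \<or> pattern v = map Not (pattern w)"
proof -
  have "generic (- v)" using generic_scaleR[OF assms(2), of "- 1"] by simp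
  then have "- v \<in> open_cone w \<longleftrightarrow> map Not (pattern v) = pattern w"
    using pattern_eq_iff[OF assms(1), of "- v"] pattern_minus[OF assms(2)] by simp
  moreover have "map Not (pattern v) = pattern w \<longleftrightarrow> pattern v = map Not (pattern w)"
    by (simp add: pattern_def) blast
  ultimately show ?thesis
    using chamber_eq_iff[OF assms] pattern_eq_iff[OF assms] by blast
qed

text \<open>The actions of the generators on sign vectors, in a form that can be evaluated; they
  mirror the triples in \<open>arrangement_sym_generators\<close>.\<close>

fun rho_pattern :: "bool list \<Rightarrow> bool list" where
  "rho_pattern [x, y, z, a, b, c] = [y, z, x, b, c, a]" | "rho_pattern l = l"
fun sigma_pattern :: "bool list \<Rightarrow> bool list" where
  "sigma_pattern [x, y, z, a, b, c] = [\<not> y, \<not> x, \<not> z, b, a, c]" | "sigma_pattern l = l"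
fun tau_pattern :: "bool list \<Rightarrow> bool list" where
  "tau_pattern [x, y, z, a, b, c] = [a, b, c, \<not> x, \<not> y, \<not> z]" | "tau_pattern l = l"

lemma pattern_generators:
  assumes "generic w"
  shows "pattern (rho *v w) = rho_pattern (pattern w)"
    and "pattern (sigma *v w) = sigma_pattern (pattern w)"
    and "pattern (tau *v w) = tau_pattern (pattern w)"
  using assms by (auto simp: pattern_def generic_iff rho_vec sigma_vec tau_vec)

datatype chamber_type = Cube | Prism | Dumpling | Tetrahedron

text \<open>If \<open>z\<close> is the coordinate of odd sign, then \<open>y - z - t\<close> has the sign of \<open>x\<close> and
  \<open>z - x - t\<close> that of \<open>z\<close> for a dumpling; both signs reversed cannot occur.\<close>

fun pattern_type :: "bool list \<Rightarrow> chamber_type" where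
  "pattern_type [x, y, z, a, b, c] =
     (if x = y \<and> y = z then (if a = b \<and> b = c then Cube else Prism)
      else if a = b \<and> b = c then Prism
      else if x = y then (if a = x \<and> b = z then Dumpling else Tetrahedron)
      else if y = z then (if b = y \<and> c = x then Dumpling else Tetrahedron)
      else (if c = z \<and> a = y then Dumpling else Tetrahedron))"
| "pattern_type l = Cube"

text \<open>If x, y > 0 > z, the excluded signs would demand both t > y - z > 0 and t < z - x < 0.
  The three clauses and their negatives remove 12 of the 64 patterns; all the others occur.\<close>

fun valid_pattern :: "bool list \<Rightarrow> bool" where
  "valid_pattern [x, y, z, a, b, c] = (\<not> (x = y \<and> z \<noteq> x \<and> a = z \<and> b = x)
     \<and> \<not> (y = z \<and> x \<noteq> y \<and> b = x \<and> c = y) \<and> \<not> (z = x \<and> y \<noteq> z \<and> c = y \<and> a = z))"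
| "valid_pattern l = False"

definition patterns :: "bool list list" where
  "patterns = filter valid_pattern (List.n_lists 6 [True, False])"

lemma pattern_in_patterns:
  assumes "generic w" shows "pattern w \<in> set patterns"
proof -
  have "valid_pattern (pattern w)"
    using assms unfolding pattern_def generic_iff by (simp add: not_less) linarith
  then show ?thesis by (simp add: patterns_def set_n_lists) (simp add: pattern_def)
qed

datatype generator = Rho | Sigma | Tau

fun generator_mat :: "generator \<Rightarrow> real ^ 4 ^ 4" where
  "generator_mat Rho = rho" | "generator_mat Sigma = sigma" | "generator_mat Tau = tau"

fun generator_pattern :: "generator \<Rightarrow> bool list \<Rightarrow> bool list" where
  "generator_pattern Rho = rho_pattern" | "generator_pattern Sigma = sigma_pattern"
| "generator_pattern Tau = tau_pattern"

fun word_mat :: "generator list \<Rightarrow> real ^ 4 ^ 4" where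
  "word_mat [] = mat 1" | "word_mat (g # gs) = generator_mat g ** word_mat gs"

text \<open>The twelve normal forms rho^i sigma^j tau^k, one for each element of the group.\<close>

definition words :: "generator list list" where
  "words = [l @ m @ n. l \<leftarrow> [[], [Rho], [Rho, Rho]], m \<leftarrow> [[], [Sigma]], n \<leftarrow> [[], [Tau]]]"

lemma word_mat_in_gen_mats: "word_mat l \<in> gen_mats"
proof (induction l)
  case (Cons g l)
  then show ?case by (cases g) (auto intro: gen_mats.intros)
qed (simp add: gen_mats.one)

lemma pattern_word:
  assumes "generic w"
  shows "pattern (word_mat l *v w) = foldr generator_pattern l (pattern w)"
proof (induction l)
  case (Cons g l)
  have "generic (word_mat l *v w)"
    using assms arrangement_sym_generic arrangement_sym_gen_mats word_mat_in_gen_mats by blast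
  then show ?case
    using Cons by (cases g) (simp_all add: matrix_vector_mul_assoc[symmetric] pattern_generators)
qed simp

fun rep :: "chamber_type \<Rightarrow> real ^ 4" where
  "rep Cube = vector [1, 1, 1, 1]" | "rep Prism = vector [1, 1, - 1, 5]"
| "rep Tetrahedron = vector [1, 5, - 1, - 3]" | "rep Dumpling = vector [2, 1, - 1, 0]"

fun rep_pattern :: "chamber_type \<Rightarrow> bool list" where
  "rep_pattern Cube = [True, True, True, False, False, False]"
| "rep_pattern Prism = [True, True, False, False, False, False]"
| "rep_pattern Tetrahedron = [True, True, False, True, True, False]"
| "rep_pattern Dumpling = [True, True, False, True, False, True]"

lemma generic_rep: "generic (rep T)" and pattern_rep: "pattern (rep T) = rep_pattern T"
  by (cases T; simp add: generic_iff pattern_def)+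

text \<open>An exhaustive check over the valid patterns. Patterns are compared up to negation, as
  opposite vectors give the same chamber.\<close>

lemma rep_pattern_transitive:
  "list_all (\<lambda>p. list_ex (\<lambda>l. foldr generator_pattern l (rep_pattern (pattern_type p)) = p
      \<or> foldr generator_pattern l (rep_pattern (pattern_type p)) = map Not p) words) patterns"
  by code_simp

lemma pattern_type_invariant:
  "list_all (\<lambda>p. pattern_type (rho_pattern p) = pattern_type p \<and>
     pattern_type (sigma_pattern p) = pattern_type p \<and> pattern_type (tau_pattern p) = pattern_type p \<and>
     pattern_type (map Not p) = pattern_type p) patterns"
  by code_simp

lemma pattern_type_rep: "pattern_type (rep_pattern T) = T"
  by (cases T) simp_all

definition type_of :: "real ^ 4 \<Rightarrow> chamber_type" where
  "type_of w = pattern_type (pattern w)"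

lemma type_of_rep: "type_of (rep T) = T"
  by (simp add: type_of_def pattern_rep pattern_type_rep)

lemma generic_gen_mats: "M \<in> gen_mats \<Longrightarrow> generic (M *v w) \<longleftrightarrow> generic w"
  by (simp add: arrangement_sym_generic arrangement_sym_gen_mats)

lemma type_of_gen_mats:
  assumes "M \<in> gen_mats" "generic w" shows "type_of (M *v w) = type_of w"
  using assms(1)
proof (induction rule: gen_mats.induct)
  case (rho M)
  then have "generic (M *v w)" using assms(2) generic_gen_mats by blast
  then show ?case
    using rho.IH pattern_in_patterns pattern_type_invariant
    by (simp add: type_of_def matrix_vector_mul_assoc[symmetric] pattern_generators list_all_iff)
next
  case (sigma M)
  then have "generic (M *v w)" using assms(2) generic_gen_mats by blast
  then show ?case
    using sigma.IH pattern_in_patterns pattern_type_invariant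
    by (simp add: type_of_def matrix_vector_mul_assoc[symmetric] pattern_generators list_all_iff)
next
  case (tau M)
  then have "generic (M *v w)" using assms(2) generic_gen_mats by blast
  then show ?case
    using tau.IH pattern_in_patterns pattern_type_invariant
    by (simp add: type_of_def matrix_vector_mul_assoc[symmetric] pattern_generators list_all_iff)
qed simp

lemma type_of_chamber:
  assumes "generic w" "generic v" "chamber w = chamber v" shows "type_of w = type_of v"
  using assms pattern_in_patterns[OF assms(1)] pattern_type_invariant
  by (auto simp: chamber_eq_pattern type_of_def list_all_iff)

lemma pattern_transitive:
  assumes "p \<in> set patterns"
  obtains M where "M \<in> gen_mats" "pattern (M *v rep (pattern_type p)) = p
    \<or> pattern (M *v rep (pattern_type p)) = map Not p"
proof -
  obtain l where "foldr generator_pattern l (rep_pattern (pattern_type p)) = p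
      \<or> foldr generator_pattern l (rep_pattern (pattern_type p)) = map Not p"
    using rep_pattern_transitive assms unfolding list_all_iff list_ex_iff by blast
  then show thesis
    using that[of "word_mat l"] word_mat_in_gen_mats
    by (simp add: pattern_word generic_rep pattern_rep)
qed

lemma chamber_transitive:
  assumes "generic w"
  obtains M where "M \<in> gen_mats" "chamber w = chamber (M *v rep (type_of w))"
proof -
  obtain M where M: "M \<in> gen_mats" "pattern (M *v rep (type_of w)) = pattern w
      \<or> pattern (M *v rep (type_of w)) = map Not (pattern w)"
    using pattern_transitive[OF pattern_in_patterns[OF assms]] unfolding type_of_def by blast
  moreover have "generic (M *v rep (type_of w))" using M generic_gen_mats generic_rep by blast
  ultimately show thesis using that assms by (simp add: chamber_eq_pattern)
qed

text \<open>Every valid pattern is realised by moving one of the four representatives by the group,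
  if necessary followed by a change of sign.\<close>

lemma pattern_surj:
  assumes "p \<in> set patterns" obtains w where "generic w" "pattern w = p"
proof -
  obtain M where M: "M \<in> gen_mats" "pattern (M *v rep (pattern_type p)) = p
    \<or> pattern (M *v rep (pattern_type p)) = map Not p"
    using pattern_transitive[OF assms] by blast
  have g: "generic (M *v rep (pattern_type p))" using M generic_gen_mats generic_rep by blast
  then have "generic (- (M *v rep (pattern_type p)))"
    using generic_scaleR[of _ "- 1"] by fastforce
  moreover have "map Not (map Not p) = p" by (simp add: comp_def)
  ultimately show thesis using that g M(2) pattern_minus[OF g] by metis
qed

definition chambers_typed :: "chamber_type \<Rightarrow> (real ^ 4) set set set" where
  "chambers_typed T = chamber ` {w. generic w \<and> type_of w = T}"

lemma orbit_eq_chambers_typed: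
  assumes "generic w" shows "orbit G chamber_action (chamber w) = chambers_typed (type_of w)"
proof -
  let ?r = "rep (type_of w)"
  obtain M where M: "M \<in> gen_mats" "chamber w = chamber (M *v ?r)"
    using chamber_transitive[OF assms] by blast
  interpret group_action G chambers chamber_action by (rule group_action_chambers)
  have "chamber w \<in> orbit G chamber_action (chamber ?r)"
    using M by (simp add: orbit_chamber[OF generic_rep])
  moreover have mem: "chamber ?r \<in> chambers" "chamber w \<in> chambers"
    using generic_rep assms by (auto simp: chambers_eq)
  ultimately have "orbit G chamber_action (chamber w) = orbit G chamber_action (chamber ?r)"
    using orbit_sym orbit_trans by (smt (verit) Collect_cong orbit_def mem_Collect_eq
      element_image equalityI subsetI)
  also have "\<dots> = chambers_typed (type_of w)"
  proof
    show "orbit G chamber_action (chamber ?r) \<subseteq> chambers_typed (type_of w)"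
      unfolding orbit_chamber[OF generic_rep] chambers_typed_def
      by (auto simp: generic_gen_mats generic_rep type_of_gen_mats type_of_rep)
    show "chambers_typed (type_of w) \<subseteq> orbit G chamber_action (chamber ?r)"
    proof
      fix K assume "K \<in> chambers_typed (type_of w)"
      then obtain v where v: "generic v" "type_of v = type_of w" "K = chamber v"
        by (auto simp: chambers_typed_def)
      then show "K \<in> orbit G chamber_action (chamber ?r)"
        unfolding orbit_chamber[OF generic_rep] using chamber_transitive[OF v(1)] v(2,3) by auto
    qed
  qed
  finally show ?thesis .
qed

lemma orbits_eq: "orbits G chambers chamber_action = range chambers_typed"
proof
  show "orbits G chambers chamber_action \<subseteq> range chambers_typed"
    by (auto simp: orbits_def chambers_eq orbit_eq_chambers_typed)
  show "range chambers_typed \<subseteq> orbits G chambers chamber_action"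
  proof
    fix O' assume "O' \<in> range chambers_typed"
    then obtain T where "O' = chambers_typed T" by blast
    then have "O' = orbit G chamber_action (chamber (rep T))"
      using orbit_eq_chambers_typed[OF generic_rep, of T] by (simp add: type_of_rep)
    moreover have "chamber (rep T) \<in> chambers" using generic_rep by (auto simp: chambers_eq)
    ultimately show "O' \<in> orbits G chambers chamber_action" unfolding orbits_def by blast
  qed
qed

section \<open>Counting chambers\<close>

text \<open>Chambers correspond to pairs of opposite valid patterns, and each pair has exactly one
  member with first entry True.\<close>

lemma card_chambers_pattern:
  "card (chamber ` {w. generic w \<and> P (pattern w)}) = length (filter (\<lambda>p. hd p \<and> P p) patterns)"
  if P: "\<And>p. p \<in> set patterns \<Longrightarrow> P (map Not p) = P p"
proof -
  define f where "f p = (SOME w. generic w \<and> pattern w = p)" for p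
  have f: "generic (f p)" "pattern (f p) = p" if "p \<in> set patterns" for p
    using pattern_surj[OF that] unfolding f_def by (metis (mono_tags, lifting) someI)+
  have hd_Not: "hd (map Not p) = (\<not> hd p)" if "p \<in> set patterns" for p
    using that pattern_surj[OF that] by (metis list.simps(3) list.map_sel(1) pattern_def)
  have eq: "chamber ` {w. generic w \<and> P (pattern w)} = (chamber \<circ> f) ` set (filter (\<lambda>p. hd p \<and> P p) patterns)"
  proof
    show "chamber ` {w. generic w \<and> P (pattern w)} \<subseteq> (chamber \<circ> f) ` set (filter (\<lambda>p. hd p \<and> P p) patterns)"
    proof clarify
      fix w assume w: "generic w" "P (pattern w)"
      define p where "p = (if hd (pattern w) then pattern w else map Not (pattern w))"
      have w': "generic (- w)" using generic_scaleR[OF w(1), of "- 1"] by simp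
      have "map Not (pattern w) \<in> set patterns"
        using pattern_in_patterns[OF w'] pattern_minus[OF w(1)] by simp
      then have p: "p \<in> set patterns" "hd p" "P p"
        using w pattern_in_patterns[OF w(1)] P hd_Not unfolding p_def by (auto simp del: hd_map)
      have "map Not (map Not (pattern w)) = pattern w" by (simp add: comp_def)
      then have "chamber w = chamber (f p)"
        using f[OF p(1)] w(1) by (simp add: chamber_eq_pattern p_def del: map_map)
      then show "chamber w \<in> (chamber \<circ> f) ` set (filter (\<lambda>p. hd p \<and> P p) patterns)" using p by auto
    qed
    show "(chamber \<circ> f) ` set (filter (\<lambda>p. hd p \<and> P p) patterns) \<subseteq> chamber ` {w. generic w \<and> P (pattern w)}"
      using f by auto
  qed
  have inj: "inj_on (chamber \<circ> f) (set (filter (\<lambda>p. hd p \<and> P p) patterns))"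
  proof (rule inj_onI)
    fix p q assume pq: "p \<in> set (filter (\<lambda>p. hd p \<and> P p) patterns)" "q \<in> set (filter (\<lambda>p. hd p \<and> P p) patterns)"
      and "(chamber \<circ> f) p = (chamber \<circ> f) q"
    then have "q = p \<or> q = map Not p" using f by (simp add: chamber_eq_pattern)
    then show "p = q" using pq hd_Not[of p] by auto
  qed
  have "distinct patterns" by (simp add: patterns_def distinct_n_lists)
  then show ?thesis unfolding eq card_image[OF inj] by (intro distinct_card distinct_filter)
qed

lemma card_patterns:
  "length (filter (\<lambda>p. hd p \<and> True) patterns) = 26"
  "length (filter (\<lambda>p. hd p \<and> pattern_type p = Prism) patterns) = 12"
  "length (filter (\<lambda>p. hd p \<and> pattern_type p = Tetrahedron) patterns) = 6"
  "length (filter (\<lambda>p. hd p \<and> pattern_type p = Dumpling) patterns) = 6"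
  "length (filter (\<lambda>p. hd p \<and> pattern_type p = Cube) patterns) = 2"
  by code_simp+

lemma card_chambers: "card chambers = 26"
  using card_chambers_pattern[of "\<lambda>p. True"] unfolding chambers_eq card_patterns by simp

lemma card_chambers_typed:
  "card (chambers_typed Prism) = 12" "card (chambers_typed Tetrahedron) = 6"
  "card (chambers_typed Dumpling) = 6" "card (chambers_typed Cube) = 2"
proof -
  have "card (chambers_typed T) = length (filter (\<lambda>p. hd p \<and> pattern_type p = T) patterns)" for T
    unfolding chambers_typed_def type_of_def
    using pattern_type_invariant by (intro card_chambers_pattern) (simp add: list_all_iff)
  note this[of Prism] this[of Tetrahedron] this[of Dumpling] this[of Cube]
  then show "card (chambers_typed Prism) = 12" "card (chambers_typed Tetrahedron) = 6"
    "card (chambers_typed Dumpling) = 6" "card (chambers_typed Cube) = 2"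
    by (simp_all only: card_patterns)
qed

lemma chambers_typed_disjoint:
  assumes "T \<noteq> T'" shows "chambers_typed T \<inter> chambers_typed T' = {}"
proof -
  have False if "K \<in> chambers_typed T" "K \<in> chambers_typed T'" for K
  proof -
    obtain w where w: "generic w" "type_of w = T" "K = chamber w"
      using \<open>K \<in> chambers_typed T\<close> unfolding chambers_typed_def by blast
    obtain v where v: "generic v" "type_of v = T'" "K = chamber v"
      using \<open>K \<in> chambers_typed T'\<close> unfolding chambers_typed_def by blast
    show False using type_of_chamber[OF w(1) v(1)] w v assms by simp
  qed
  then show ?thesis by blast
qed

lemma chambers_typed_nonempty: "chambers_typed T \<noteq> {}"
  using generic_rep type_of_rep by (auto simp: chambers_typed_def)

lemma inj_chambers_typed: "inj chambers_typed"
proof (rule injI, rule ccontr)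
  fix T T' assume "chambers_typed T = chambers_typed T'" "T \<noteq> T'"
  then show False using chambers_typed_disjoint[of T T'] chambers_typed_nonempty[of T] by simp
qed

lemma range_chamber_type: "range f = {f Prism, f Tetrahedron, f Dumpling, f Cube}"
proof -
  have "UNIV = {Prism, Tetrahedron, Dumpling, Cube}" using chamber_type.exhaust by blast
  then have "range f = f ` {Prism, Tetrahedron, Dumpling, Cube}" by (simp only:)
  then show ?thesis by simp
qed

lemma card_orbits: "card (orbits G chambers chamber_action) = 4"
proof -
  have "orbits G chambers chamber_action = chambers_typed ` {Prism, Tetrahedron, Dumpling, Cube}"
    by (simp add: orbits_eq range_chamber_type)
  also have "card \<dots> = card {Prism, Tetrahedron, Dumpling, Cube}"
    by (intro card_image inj_on_subset[OF inj_chambers_typed]) simp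
  also have "\<dots> = 4" by simp
  finally show ?thesis .
qed

section \<open>The combinatorial types of the chambers\<close>

text \<open>The form \<open>b\<close> is positive on the closed cone away from 0, so the plane b = 0
  misses the chamber. Each of its points then has a representative normalised by b = 1, which the
  chart parametrises.\<close>

lemma chamber_affine_chart:
  assumes M: "invertible M"
    and sub: "\<And>q. q \<in> polyh cs \<Longrightarrow> M *v hom_coords q \<in> closed_cone w"
    and pos: "\<And>v. v \<in> closed_cone w \<Longrightarrow> v \<noteq> 0 \<Longrightarrow> 0 < b \<bullet> v"
    and ex: "\<And>v. v \<in> closed_cone w \<Longrightarrow> b \<bullet> v = 1 \<Longrightarrow> \<exists>q\<in>polyh cs. M *v hom_coords q = v"
  shows "chamber w = affine_chart M ` polyh cs"
proof
  show "affine_chart M ` polyh cs \<subseteq> chamber w"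
    using sub invertible_mult_nonzero[OF M hom_coords_nonzero]
    by (auto simp: affine_chart_eq chamber_def proj_set_def)
  show "chamber w \<subseteq> affine_chart M ` polyh cs"
  proof
    fix p assume "p \<in> chamber w"
    then obtain v where v: "p = proj_pt v" "v \<noteq> 0" "v \<in> closed_cone w"
      by (auto simp: chamber_def proj_set_def)
    then have p: "0 < b \<bullet> v" using pos by blast
    then obtain q where "q \<in> polyh cs" "M *v hom_coords q = (1 / (b \<bullet> v)) *\<^sub>R v"
      using ex[OF closed_cone_scaleR[OF v(3), of "1 / (b \<bullet> v)"]] by auto
    then show "p \<in> affine_chart M ` polyh cs"
      using v p by (intro image_eqI[of _ _ q]) (simp_all add: affine_chart_eq proj_pt_scaleR)
  qed
qed

text \<open>This chart and the next two parametrise the affine hyperplanes x + y + z + t = 1, y - x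
  = 1 and x + y - z = 1, chosen so that these forms are positive on the nonzero vectors of the
  respective closed cones. For the prism t = 1 works, with the identity matrix.\<close>

definition cube_chart :: "real ^ 4 ^ 4" where
  "cube_chart = vector [vector [1, 0, 0, 0], vector [0, 1, 0, 0], vector [0, 0, 1, 0], vector [- 1, - 1, - 1, 1]]"

definition tetrahedron_chart :: "real ^ 4 ^ 4" where
  "tetrahedron_chart = vector [vector [1, 0, 0, 0], vector [1, 0, 0, 1], vector [0, 1, 0, 0], vector [0, 0, 1, 0]]"

definition dumpling_chart :: "real ^ 4 ^ 4" where
  "dumpling_chart = vector [vector [1, 0, 0, 0], vector [0, 1, 0, 0], vector [1, 1, 0, - 1], vector [0, 0, 1, 0]]"

lemma invertible_charts: "invertible cube_chart" "invertible tetrahedron_chart" "invertible dumpling_chart"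
  by (simp_all add: invertible_det_nz det_4 cube_chart_def tetrahedron_chart_def dumpling_chart_def)

lemma chart_hom_coords:
  "cube_chart *v hom_coords p = vector [p $ 1, p $ 2, p $ 3, 1 - p $ 1 - p $ 2 - p $ 3]"
  "tetrahedron_chart *v hom_coords p = vector [p $ 1, 1 + p $ 1, p $ 2, p $ 3]"
  "dumpling_chart *v hom_coords p = vector [p $ 1, p $ 2, p $ 1 + p $ 2 - 1, p $ 3]"
  by (simp_all add: cube_chart_def tetrahedron_chart_def dumpling_chart_def hom_coords_def
      matrix_vector_mult_def vec_eq_iff forall_4 sum_4)

lemma chamber_rep_chart:
  "chamber (rep Cube) = affine_chart cube_chart ` polyh cube_chart_forms"
  "chamber (rep Prism) = affine_chart (mat 1) ` polyh prism_chart_forms"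
  "chamber (rep Tetrahedron) = affine_chart tetrahedron_chart ` polyh tetrahedron_chart_forms"
  "chamber (rep Dumpling) = affine_chart dumpling_chart ` polyh dumpling_chart_forms"
proof -
  have nz: "v $ 1 \<noteq> 0 \<or> v $ 2 \<noteq> 0 \<or> v $ 3 \<noteq> 0 \<or> v $ 4 \<noteq> 0" if "v \<noteq> 0" for v :: "real ^ 4"
    using that by (auto simp: vec_eq_iff forall_4)
  show "chamber (rep Cube) = affine_chart cube_chart ` polyh cube_chart_forms"
  proof (rule chamber_affine_chart[where b = "vector [1, 1, 1, 1]"])
    fix v assume v: "v \<in> closed_cone (rep Cube)"
    show "0 < vector [1, 1, 1, 1] \<bullet> v" if "v \<noteq> 0"
      using v nz[OF that] by (simp add: closed_cone_iff inner_4) linarith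
    show "\<exists>q\<in>polyh cube_chart_forms. cube_chart *v hom_coords q = v" if "vector [1, 1, 1, 1] \<bullet> v = 1"
      using v that by (intro bexI[of _ "vector [v $ 1, v $ 2, v $ 3]"])
        (simp_all add: closed_cone_iff inner_4 chart_hom_coords forms_defs mem_polyh vec_eq_iff forall_4)
  qed (simp_all add: invertible_charts closed_cone_iff chart_hom_coords forms_defs mem_polyh)
  show "chamber (rep Prism) = affine_chart (mat 1) ` polyh prism_chart_forms"
  proof (rule chamber_affine_chart[where b = "vector [0, 0, 0, 1]"])
    fix v assume v: "v \<in> closed_cone (rep Prism)"
    show "0 < vector [0, 0, 0, 1] \<bullet> v" if "v \<noteq> 0"
      using v nz[OF that] by (simp add: closed_cone_iff inner_4) linarith
    show "\<exists>q\<in>polyh prism_chart_forms. mat 1 *v hom_coords q = v" if "vector [0, 0, 0, 1] \<bullet> v = 1"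
      using v that by (intro bexI[of _ "vector [v $ 1, v $ 2, v $ 3]"])
        (simp_all add: closed_cone_iff inner_4 hom_coords_def forms_defs mem_polyh vec_eq_iff forall_4)
  qed (simp_all add: invertible_gen_mats[OF gen_mats.one] closed_cone_iff hom_coords_def forms_defs mem_polyh)
  show "chamber (rep Tetrahedron) = affine_chart tetrahedron_chart ` polyh tetrahedron_chart_forms"
  proof (rule chamber_affine_chart[where b = "vector [- 1, 1, 0, 0]"])
    fix v assume v: "v \<in> closed_cone (rep Tetrahedron)"
    show "0 < vector [- 1, 1, 0, 0] \<bullet> v" if "v \<noteq> 0"
      using v nz[OF that] by (simp add: closed_cone_iff inner_4) linarith
    show "\<exists>q\<in>polyh tetrahedron_chart_forms. tetrahedron_chart *v hom_coords q = v"
      if "vector [- 1, 1, 0, 0] \<bullet> v = 1"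
      using v that by (intro bexI[of _ "vector [v $ 1, v $ 3, v $ 4]"])
        (simp_all add: closed_cone_iff inner_4 chart_hom_coords forms_defs mem_polyh vec_eq_iff forall_4)
  qed (simp_all add: invertible_charts closed_cone_iff chart_hom_coords forms_defs mem_polyh)
  show "chamber (rep Dumpling) = affine_chart dumpling_chart ` polyh dumpling_chart_forms"
  proof (rule chamber_affine_chart[where b = "vector [1, 1, - 1, 0]"])
    fix v assume v: "v \<in> closed_cone (rep Dumpling)"
    show "0 < vector [1, 1, - 1, 0] \<bullet> v" if "v \<noteq> 0"
      using v nz[OF that] by (simp add: closed_cone_iff inner_4) linarith
    show "\<exists>q\<in>polyh dumpling_chart_forms. dumpling_chart *v hom_coords q = v"
      if "vector [1, 1, - 1, 0] \<bullet> v = 1"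
      using v that by (intro bexI[of _ "vector [v $ 1, v $ 2, v $ 4]"])
        (simp_all add: closed_cone_iff inner_4 chart_hom_coords forms_defs mem_polyh vec_eq_iff forall_4)
  qed (simp_all add: invertible_charts closed_cone_iff chart_hom_coords forms_defs mem_polyh)
qed

fun type_polytope :: "chamber_type \<Rightarrow> ((real \<times> real) \<times> real) set" where
  "type_polytope Cube = cube" | "type_polytope Prism = triangular_prism"
| "type_polytope Tetrahedron = tetrahedron" | "type_polytope Dumpling = dumpling"

lemma has_comb_type_rep: "has_comb_type (chamber (rep T)) (type_polytope T)"
proof -
  have *: "has_comb_type (affine_chart M ` P) Q" if "invertible M" "polytope P" "comb_equiv P Q"
    for M P and Q :: "((real \<times> real) \<times> real) set"
    using that unfolding has_comb_type_def by blast
  show ?thesis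
    by (cases T; simp only: chamber_rep_chart type_polytope.simps;
        intro * invertible_charts polytope_chart_forms comb_equiv_chart_forms invertible_gen_mats gen_mats.one)
qed

lemma has_comb_type_chamber:
  assumes "generic w" shows "has_comb_type (chamber w) (type_polytope (type_of w))"
proof -
  obtain M where M: "M \<in> gen_mats" "chamber w = chamber (M *v rep (type_of w))"
    using chamber_transitive[OF assms] by blast
  then have "chamber w = proj_map M ` chamber (rep (type_of w))"
    by (simp add: proj_map_chamber arrangement_sym_gen_mats)
  then show ?thesis using has_comb_type_proj_map[OF has_comb_type_rep invertible_gen_mats[OF M(1)]] by simp
qed

lemma type_polytope_inj:
  assumes "comb_equiv (type_polytope T) (type_polytope T')" shows "T = T'"
proof -
  have "face_counts (type_polytope T) = face_counts (type_polytope T')"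
    using assms by (rule comb_equiv_face_counts)
  then show ?thesis
    by (cases T; cases T'; simp add: face_counts_types; simp add: set_eq_iff; presburger)
qed

lemma chambers_of_type_eq: "chambers_of_type (type_polytope T) = chambers_typed T"
proof
  show "chambers_of_type (type_polytope T) \<subseteq> chambers_typed T"
    unfolding chambers_of_type_def chambers_eq chambers_typed_def
    using has_comb_type_unique[OF has_comb_type_chamber] type_polytope_inj by blast
  show "chambers_typed T \<subseteq> chambers_of_type (type_polytope T)"
    unfolding chambers_of_type_def chambers_eq chambers_typed_def
    using has_comb_type_chamber by auto
qed

lemmas chambers_of_types = chambers_of_type_eq[of Cube] chambers_of_type_eq[of Prism]
  chambers_of_type_eq[of Tetrahedron] chambers_of_type_eq[of Dumpling]

section \<open>A criterion for solid tori\<close>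

lemma linear_inv_bij:
  assumes j: "linear j" "bij j" shows "linear (Hilbert_Choice.inv j)"
proof (rule linearI)
  have ij: "Hilbert_Choice.inv j (j x) = x" and ji: "j (Hilbert_Choice.inv j v) = v" for x v
    using j(2) by (simp_all add: bij_is_inj bij_is_surj surj_f_inv_f)
  fix u v and c :: real
  have "j (Hilbert_Choice.inv j u + Hilbert_Choice.inv j v) = u + v"
    using j(1) by (simp add: linear_add ji)
  then show "Hilbert_Choice.inv j (u + v) = Hilbert_Choice.inv j u + Hilbert_Choice.inv j v" by (metis ij)
  have "j (c *\<^sub>R Hilbert_Choice.inv j u) = c *\<^sub>R u" using j(1) by (simp add: linear_scale ji)
  then show "Hilbert_Choice.inv j (c *\<^sub>R u) = c *\<^sub>R Hilbert_Choice.inv j u" by (metis ij)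
qed

text \<open>The join structure: each point off the two cores \<open>{w = 0}\<close> and \<open>{z = 0}\<close> lies on a unique ray
  from the first to the second, on which \<open>A\<close> is an initial and \<open>B\<close> a final segment, meeting in one point.\<close>

locale join_splitting =
  fixes A B :: "(complex \<times> complex) set"
  assumes closed_A: "closed A" and closed_B: "closed B" and cover: "A \<union> B = UNIV"
    and homog_A: "x \<in> A \<Longrightarrow> c *\<^sub>R x \<in> A" and homog_B: "x \<in> B \<Longrightarrow> c *\<^sub>R x \<in> B"
    and core_A: "z \<noteq> 0 \<Longrightarrow> (z, 0) \<notin> B" and core_B: "w \<noteq> 0 \<Longrightarrow> (0, w) \<notin> A"
    and ray: "(z, w) \<in> B \<Longrightarrow> z \<noteq> 0 \<Longrightarrow> w \<noteq> 0 \<Longrightarrow> 1 < \<mu> \<Longrightarrow> (z, \<mu> *\<^sub>R w) \<notin> A"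
begin

lemma zero_mem: "0 \<in> A" "0 \<in> B"
proof -
  have "(1, 0) \<in> A" using core_A[of 1] cover by auto
  from homog_A[OF this, of 0] show "0 \<in> A" by (simp add: zero_prod_def)
  have "(0, 1) \<in> B" using core_B[of 1] cover by auto
  from homog_B[OF this, of 0] show "0 \<in> B" by (simp add: zero_prod_def)
qed

text \<open>The compact circle |z| = 1, w = 0 is disjoint from the closed set B, hence at some
  distance d > 0 from it. Scaling (k e, w) to (e, w / k) turns this into a bound with K = 1 /
  d.\<close>

lemma gauge_bound:
  obtains K where "0 < K" "\<And>e w k. norm e = 1 \<Longrightarrow> 0 \<le> k \<Longrightarrow> (k *\<^sub>R e, w) \<in> B \<Longrightarrow> k \<le> K * norm w"
proof -
  have "sphere 0 1 \<times> {0} \<inter> B = {}"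
  proof (rule equals0I)
    fix x assume "x \<in> sphere 0 1 \<times> {0} \<inter> B"
    then obtain e where "norm e = 1" "(e, 0) \<in> B" by auto
    then show False using core_A[of e] by (cases "e = 0") simp_all
  qed
  moreover have "compact (sphere (0::complex) 1 \<times> {0::complex})" by (intro compact_Times) auto
  ultimately have "\<exists>d>0. \<forall>x\<in>sphere 0 1 \<times> {0}. \<forall>y\<in>B. d \<le> dist x y"
    using closed_B by (intro separate_compact_closed)
  then obtain d where d: "0 < d" "\<forall>x\<in>sphere 0 1 \<times> {0}. \<forall>y\<in>B. d \<le> dist x y"
    by (elim exE conjE)
  have "k \<le> (1 / d) * norm w" if "norm e = 1" "0 \<le> k" "(k *\<^sub>R e, w) \<in> B" for e w k
  proof (cases "k = 0")
    case False
    then have "(e, (1 / k) *\<^sub>R w) \<in> B" using homog_B[OF that(3), of "1 / k"] by simp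
    then have "d \<le> dist (e, 0) (e, (1 / k) *\<^sub>R w)"
      using d(2)[rule_format, of "(e, 0)"] that(1) by simp
    also have "\<dots> = norm w / k" using that(2) by (simp add: dist_Pair_Pair dist_norm)
    finally show ?thesis using d(1) that(2) False by (simp add: field_simps)
  qed (use d in simp)
  then show thesis using that[of "1 / d"] d(1) by simp
qed

text \<open>The same distance argument for the other core, the circle z = 0, |w| = 1, and the closed
  set A.\<close>

lemma A_bound:
  obtains R where "0 < R" "\<And>e w. norm e = 1 \<Longrightarrow> (e, w) \<in> A \<Longrightarrow> norm w \<le> R"
proof -
  have "{0} \<times> sphere 0 1 \<inter> A = {}"
  proof (rule equals0I)
    fix x assume "x \<in> {0} \<times> sphere 0 1 \<inter> A"
    then obtain e where "norm e = 1" "(0, e) \<in> A" by auto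
    then show False using core_B[of e] by (cases "e = 0") simp_all
  qed
  moreover have "compact ({0::complex} \<times> sphere (0::complex) 1)" by (intro compact_Times) auto
  ultimately have "\<exists>d>0. \<forall>x\<in>{0} \<times> sphere 0 1. \<forall>y\<in>A. d \<le> dist x y"
    using closed_A by (intro separate_compact_closed)
  then obtain d where d: "0 < d" "\<forall>x\<in>{0} \<times> sphere 0 1. \<forall>y\<in>A. d \<le> dist x y"
    by (elim exE conjE)
  have "norm w \<le> 1 / d" if "norm e = 1" "(e, w) \<in> A" for e w
  proof (cases "w = 0")
    case False
    then have n: "0 < norm w" by simp
    have "((1 / norm w) *\<^sub>R e, (1 / norm w) *\<^sub>R w) \<in> A" using homog_A[OF that(2), of "1 / norm w"] by simp
    then have "d \<le> dist (0, (1 / norm w) *\<^sub>R w) ((1 / norm w) *\<^sub>R e, (1 / norm w) *\<^sub>R w)"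
      using d(2)[rule_format, of "(0, (1 / norm w) *\<^sub>R w)"] n by simp
    also have "\<dots> = 1 / norm w" using that(1) by (simp add: dist_Pair_Pair dist_norm)
    finally show ?thesis using d(1) n by (simp add: field_simps)
  qed (use d in simp)
  then show thesis using that[of "1 / d"] d(1) by simp
qed

text \<open>If k < l both worked, scaling the point for k by l / k would place (l e, (l / k) w) in
  A, beyond the point (l e, w) of B on the same ray.\<close>

lemma gauge_unique:
  assumes e: "norm e = 1" and k: "0 \<le> k" "(k *\<^sub>R e, w) \<in> A \<inter> B" "0 \<le> l" "(l *\<^sub>R e, w) \<in> A \<inter> B"
  shows "k = l"
proof -
  have e0: "e \<noteq> 0" using e by auto
  have *: "\<not> k < l" if "0 \<le> k" "(k *\<^sub>R e, w) \<in> A \<inter> B" "0 \<le> l" "(l *\<^sub>R e, w) \<in> A \<inter> B" for k l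
  proof
    assume lt: "k < l"
    have w: "w \<noteq> 0"
    proof
      assume "w = 0"
      then show False using core_A[of "l *\<^sub>R e"] that lt e0 by auto
    qed
    then have "0 < k" using core_B[OF w] that by (cases "k = 0") auto
    then have "(l *\<^sub>R e, (l / k) *\<^sub>R w) \<notin> A" using that lt e0 w by (intro ray) auto
    moreover have "(l / k) *\<^sub>R (k *\<^sub>R e, w) \<in> A" using that homog_A by blast
    ultimately show False using \<open>0 < k\<close> by simp
  qed
  show ?thesis using *[OF k] *[OF k(3,4,1,2)] by linarith
qed

text \<open>A Minkowski-type functional in w for the fibre of A over the unit number e. Scaling e
  instead of w to reach the common boundary makes it defined, with value 0, also at w = 0.\<close>

definition gauge :: "complex \<times> complex \<Rightarrow> real" where
  "gauge x = (THE k. 0 \<le> k \<and> (k *\<^sub>R fst x, snd x) \<in> A \<inter> B)"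

text \<open>As k grows from 0, the point (k e, w) starts in B, because it lies on the second core,
  and ends in A, past the bound of \<open>gauge_bound\<close>. By connectedness it meets both closed
  sets at once.\<close>

lemma gauge_exists:
  assumes e: "norm e = 1" shows "\<exists>k\<ge>0. (k *\<^sub>R e, w) \<in> A \<inter> B"
proof (cases "w = 0")
  case True
  then show ?thesis using zero_mem by (intro exI[of _ 0]) (simp add: zero_prod_def)
next
  case False
  obtain K where K: "0 < K" "\<And>e w k. norm e = 1 \<Longrightarrow> 0 \<le> k \<Longrightarrow> (k *\<^sub>R e, w) \<in> B \<Longrightarrow> k \<le> K * norm w"
    using that by (rule gauge_bound)
  let ?M = "K * norm w + 1"
  have M: "0 \<le> ?M" using K(1) by simp
  have cont: "continuous_on UNIV (\<lambda>k. (k *\<^sub>R e, w))" by (intro continuous_intros)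
  have "closed ((\<lambda>k. (k *\<^sub>R e, w)) -` A)" "closed ((\<lambda>k. (k *\<^sub>R e, w)) -` B)"
    using closed_vimage[OF closed_A cont] closed_vimage[OF closed_B cont] by auto
  moreover have "0 \<in> (\<lambda>k. (k *\<^sub>R e, w)) -` B \<inter> {0..?M}" using core_B[OF False] cover M by auto
  moreover have "?M \<in> (\<lambda>k. (k *\<^sub>R e, w)) -` A \<inter> {0..?M}"
  proof -
    have "(?M *\<^sub>R e, w) \<notin> B" using K(2)[OF e M, of w] by auto
    then show ?thesis using cover M by auto
  qed
  moreover have "connected {0..?M}" by simp
  moreover have "{0..?M} \<subseteq> (\<lambda>k. (k *\<^sub>R e, w)) -` A \<union> (\<lambda>k. (k *\<^sub>R e, w)) -` B" using cover by auto
  ultimately have "(\<lambda>k. (k *\<^sub>R e, w)) -` A \<inter> (\<lambda>k. (k *\<^sub>R e, w)) -` B \<inter> {0..?M} \<noteq> {}"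
    using connected_closedD[of "{0..?M}" "(\<lambda>k. (k *\<^sub>R e, w)) -` A" "(\<lambda>k. (k *\<^sub>R e, w)) -` B"] by blast
  then show ?thesis by auto
qed

lemma gauge:
  assumes e: "norm e = 1"
  shows "0 \<le> gauge (e, w)" "(gauge (e, w) *\<^sub>R e, w) \<in> A" "(gauge (e, w) *\<^sub>R e, w) \<in> B"
proof -
  have "\<exists>!k. 0 \<le> k \<and> (k *\<^sub>R fst (e, w), snd (e, w)) \<in> A \<inter> B"
    using gauge_exists[OF e] gauge_unique[OF e] by (auto simp del: Int_iff)
  from theI'[OF this] show "0 \<le> gauge (e, w)" "(gauge (e, w) *\<^sub>R e, w) \<in> A" "(gauge (e, w) *\<^sub>R e, w) \<in> B"
    unfolding gauge_def by simp_all
qed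

lemma gauge_eqI: "norm e = 1 \<Longrightarrow> 0 \<le> k \<Longrightarrow> (k *\<^sub>R e, w) \<in> A \<Longrightarrow> (k *\<^sub>R e, w) \<in> B \<Longrightarrow> gauge (e, w) = k"
  using gauge_unique[of e "gauge (e, w)" w k] gauge[of e w] by simp

lemma gauge_eq_0_iff: assumes "norm e = 1" shows "gauge (e, w) = 0 \<longleftrightarrow> w = 0"
proof
  assume "gauge (e, w) = 0"
  then show "w = 0" using gauge(2)[OF assms, of w] core_B[of w] by auto
next
  assume "w = 0"
  then show "gauge (e, w) = 0"
    using assms zero_mem by (intro gauge_eqI) (simp_all add: zero_prod_def)
qed

lemma gauge_scale: assumes "norm e = 1" "0 \<le> c" shows "gauge (e, c *\<^sub>R w) = c * gauge (e, w)"
  using homog_A[OF gauge(2)[OF assms(1), of w], of c] homog_B[OF gauge(3)[OF assms(1), of w], of c]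
    gauge(1)[OF assms(1), of w] assms
  by (intro gauge_eqI) simp_all

lemma gauge_minus: assumes "norm e = 1" shows "gauge (- e, - w) = gauge (e, w)"
  using homog_A[OF gauge(2)[OF assms, of w], of "- 1"] homog_B[OF gauge(3)[OF assms, of w], of "- 1"]
    gauge(1)[OF assms, of w] assms
  by (intro gauge_eqI) simp_all

text \<open>Dividing the boundary point (k e, w) by k gives the point (e, w / k), where the ray
  through (e, w) crosses from A to B. The condition k \<le> 1 says that (e, w) is not beyond
  it.\<close>

lemma mem_A_iff: assumes e: "norm e = 1" shows "(e, w) \<in> A \<longleftrightarrow> gauge (e, w) \<le> 1"
proof -
  define k where "k = gauge (e, w)"
  note k = gauge[OF e, of w, folded k_def]
  have e0: "e \<noteq> 0" using e by auto
  show ?thesis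
  proof (cases "w = 0")
    case True
    then have "(e, w) \<in> A" using core_A[OF e0] cover by auto
    then show ?thesis using True gauge_eq_0_iff[OF e, of w] by simp
  next
    case False
    then have pos: "0 < k" using gauge_eq_0_iff[OF e, of w] k(1) by (simp add: k_def)
    show ?thesis
    proof
      assume mem: "(e, w) \<in> A"
      show "gauge (e, w) \<le> 1"
      proof (rule ccontr)
        assume "\<not> gauge (e, w) \<le> 1"
        then have "(k *\<^sub>R e, k *\<^sub>R w) \<notin> A" using k pos e0 False by (intro ray) (auto simp: k_def)
        then show False using homog_A[OF mem, of k] by simp
      qed
    next
      assume le: "gauge (e, w) \<le> 1"
      show "(e, w) \<in> A"
      proof (rule ccontr)
        assume nA: "(e, w) \<notin> A"
        then have "k \<noteq> 1" using k(2) by auto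
        then have "1 < 1 / k" using le pos by (simp add: k_def)
        moreover have "(e, w) \<in> B" using nA cover by auto
        ultimately have "(e, (1 / k) *\<^sub>R w) \<notin> A" using e0 False by (intro ray) auto
        then show False using homog_A[OF k(2), of "1 / k"] pos by simp
      qed
    qed
  qed
qed

text \<open>A function with values in a compact interval is continuous once its graph is
  closed.\<close>

lemma continuous_on_gauge: "continuous_on (sphere 0 1 \<times> cball 0 R) gauge"
proof -
  obtain K where K: "0 < K" "\<And>e w k. norm e = 1 \<Longrightarrow> 0 \<le> k \<Longrightarrow> (k *\<^sub>R e, w) \<in> B \<Longrightarrow> k \<le> K * norm w"
    using that by (rule gauge_bound)
  let ?S = "sphere (0::complex) 1 \<times> cball (0::complex) R"
  have le: "gauge (e, w) \<le> K * R" if "norm e = 1" "norm w \<le> R" for e w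
  proof -
    have "gauge (e, w) \<le> K * norm w" using K(2) gauge that by blast
    also have "\<dots> \<le> K * R" using that K(1) by simp
    finally show ?thesis .
  qed
  \<comment> \<open>By uniqueness of the gauge its graph is cut out by membership in the closed set
    A \<inter> B.\<close>
  have eq: "(\<lambda>x. (x, gauge x)) ` ?S
      = (?S \<times> {0..K * R}) \<inter> (\<lambda>p. (snd p *\<^sub>R fst (fst p), snd (fst p))) -` (A \<inter> B)" (is "?L = ?R")
  proof
    show "?L \<subseteq> ?R" using gauge le by auto
    show "?R \<subseteq> ?L"
    proof
      fix p assume p: "p \<in> ?R"
      obtain e w k where ewk: "p = ((e, w), k)" by (metis prod.exhaust)
      then have "gauge (e, w) = k" using p by (intro gauge_eqI) auto
      then show "p \<in> ?L" using p ewk by auto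
    qed
  qed
  show ?thesis
  proof (rule continuous_from_closed_graph[of "{0..K * R}"])
    show "gauge \<in> ?S \<rightarrow> {0..K * R}" using gauge le by auto
    have "closed ((\<lambda>p. (snd p *\<^sub>R fst (fst p), snd (fst p))) -` (A \<inter> B) :: ((complex \<times> complex) \<times> real) set)"
      by (intro closed_vimage closed_Int closed_A closed_B continuous_intros)
    then show "closed ((\<lambda>x. (x, gauge x)) ` ?S)" unfolding eq
      by (intro closed_Int closed_Times) auto
  qed simp
qed

text \<open>Keeps the direction of w but takes the gauge as new length, so the fibre of A becomes
  the unit disc. At w = 0 the value is 0.\<close>

definition disc_part :: "complex \<times> complex \<Rightarrow> complex" where
  "disc_part x = (gauge x / norm (snd x)) *\<^sub>R snd x"

lemma norm_disc_part: "norm e = 1 \<Longrightarrow> norm (disc_part (e, w)) = gauge (e, w)"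
  using gauge_eq_0_iff[of e w] gauge(1)[of e w] by (cases "w = 0") (simp_all add: disc_part_def)

text \<open>Where w = 0 the direction has no limit, but the length is the gauge, which tends to 0
  there.\<close>

lemma continuous_on_disc_part: "continuous_on (sphere 0 1 \<times> cball 0 R) disc_part"
  unfolding continuous_on_def
proof
  let ?S = "sphere (0::complex) 1 \<times> cball (0::complex) R"
  fix x assume x: "x \<in> ?S"
  have g: "(gauge \<longlongrightarrow> gauge x) (at x within ?S)"
    using continuous_on_gauge x unfolding continuous_on_def by blast
  obtain e w where ew: "x = (e, w)" "norm e = 1" using x by auto
  show "(disc_part \<longlongrightarrow> disc_part x) (at x within ?S)"
  proof (cases "w = 0")
    case True
    have "\<forall>\<^sub>F y in at x within ?S. norm (disc_part y) = gauge y"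
      unfolding eventually_at_filter by (rule always_eventually) (auto simp: norm_disc_part)
    moreover have "gauge x = 0" using True ew gauge_eq_0_iff by simp
    ultimately have "((\<lambda>y. norm (disc_part y)) \<longlongrightarrow> 0) (at x within ?S)"
      using g by (subst tendsto_cong) simp_all
    then have "(disc_part \<longlongrightarrow> 0) (at x within ?S)" by (rule tendsto_norm_zero_cancel)
    then show ?thesis using True ew by (simp add: disc_part_def)
  next
    case False
    then show ?thesis unfolding disc_part_def
      using g ew by (intro tendsto_intros) auto
  qed
qed

text \<open>Both components are invariant under (e, w) to (-e, -w), the only ambiguity in a
  normalised representative. The factor e in the second one untwists the disc bundle over the circle
  of squares.\<close>

definition torus_map :: "complex \<times> complex \<Rightarrow> complex \<times> complex" where
  "torus_map x = (fst x ^ 2, fst x * disc_part x)"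

definition unit_A :: "(complex \<times> complex) set" where
  "unit_A = {x \<in> A. norm (fst x) = 1}"

lemma unit_A_bounded: obtains R where "unit_A \<subseteq> sphere 0 1 \<times> cball 0 R"
proof -
  obtain R where "0 < R" "\<And>e w. norm e = 1 \<Longrightarrow> (e, w) \<in> A \<Longrightarrow> norm w \<le> R"
    using that by (rule A_bound)
  then have "unit_A \<subseteq> sphere 0 1 \<times> cball 0 R" by (auto simp: unit_A_def)
  then show thesis using that by blast
qed

lemma compact_unit_A: "compact unit_A"
proof -
  obtain R where R: "unit_A \<subseteq> sphere 0 1 \<times> cball 0 R" by (rule unit_A_bounded)
  have "bounded (sphere (0::complex) 1 \<times> cball (0::complex) R)" by (intro bounded_Times) auto
  then have "bounded unit_A" using R bounded_subset by blast
  moreover have "unit_A = A \<inter> (\<lambda>x. norm (fst x)) -` {1}" by (auto simp: unit_A_def)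
  then have "closed unit_A" by (auto intro!: closed_Int closed_A closed_vimage continuous_intros)
  ultimately show ?thesis by (simp add: compact_eq_bounded_closed)
qed

lemma continuous_on_torus_map: "continuous_on unit_A torus_map"
proof -
  obtain R where R: "unit_A \<subseteq> sphere 0 1 \<times> cball 0 R" by (rule unit_A_bounded)
  show ?thesis unfolding torus_map_def
    by (intro continuous_intros continuous_on_subset[OF continuous_on_disc_part R])
qed

lemma torus_map_minus: "norm e = 1 \<Longrightarrow> torus_map (- e, - w) = torus_map (e, w)"
  by (simp add: torus_map_def disc_part_def gauge_minus)

lemma torus_map_image: "torus_map ` unit_A = sphere 0 1 \<times> cball 0 1"
proof
  show "torus_map ` unit_A \<subseteq> sphere 0 1 \<times> cball 0 1"
    by (auto simp: unit_A_def torus_map_def norm_power norm_mult norm_disc_part mem_A_iff)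
  show "sphere 0 1 \<times> cball 0 1 \<subseteq> torus_map ` unit_A"
  proof
    fix x assume x: "x \<in> sphere (0::complex) 1 \<times> cball (0::complex) 1"
    obtain \<zeta> \<eta> where \<zeta>\<eta>: "x = (\<zeta>, \<eta>)" by (metis prod.exhaust)
    define e where "e = csqrt \<zeta>"
    have e: "e ^ 2 = \<zeta>" by (simp add: e_def)
    have "norm e ^ 2 = 1" using x \<zeta>\<eta> by (simp add: e norm_power[symmetric])
    then have "norm e = 1 \<or> norm e = - 1" by (simp only: power2_eq_1_iff)
    then have ne: "norm e = 1" using norm_ge_zero[of e] by linarith
    then have e0: "e \<noteq> 0" by auto
    define u where "u = \<eta> / e"
    have u1: "norm u \<le> 1" using x \<zeta>\<eta> ne by (simp add: u_def norm_divide)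
    obtain w where w: "disc_part (e, w) = u"
    proof (cases "u = 0")
      case True
      then show ?thesis using that[of 0] by (simp add: disc_part_def)
    next
      case False
      define k where "k = gauge (e, u)"
      have k: "0 < k" using gauge(1)[OF ne, of u] gauge_eq_0_iff[OF ne, of u] False by (simp add: k_def)
      \<comment> \<open>By homogeneity of the gauge this multiple of u has gauge equal to the length
        of u.\<close>
      have "disc_part (e, (norm u / k) *\<^sub>R u) = u"
        using False k gauge_scale[OF ne, of "norm u / k" u]
        by (simp add: disc_part_def flip: k_def)
      then show ?thesis by (rule that)
    qed
    have "(e, w) \<in> unit_A"
      using norm_disc_part[OF ne, of w] w u1 mem_A_iff[OF ne, of w] ne by (simp add: unit_A_def)
    moreover have "torus_map (e, w) = x" using w e e0 \<zeta>\<eta> by (simp add: torus_map_def u_def)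
    ultimately show "x \<in> torus_map ` unit_A" by (metis imageI)
  qed
qed

text \<open>Equal images have equal gauge and direction, and the gauge is homogeneous with positive
  value along that direction, so the lengths agree too.\<close>

lemma disc_part_inj:
  assumes e: "norm e = 1" and eq: "disc_part (e, w) = disc_part (e, w')" shows "w = w'"
proof -
  define k where "k = gauge (e, w)"
  have k': "gauge (e, w') = k" using norm_disc_part[OF e, of w] norm_disc_part[OF e, of w'] eq k_def by simp
  show ?thesis
  proof (cases "w = 0")
    case True
    then show ?thesis using k' gauge_eq_0_iff[OF e] k_def by metis
  next
    case False
    then have k0: "k \<noteq> 0" and w': "w' \<noteq> 0" using k' gauge_eq_0_iff[OF e] k_def by metis+
    have "(k / norm w) *\<^sub>R w = (k / norm w') *\<^sub>R w'" using eq k' by (simp add: disc_part_def k_def)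
    then have "(norm w / k) *\<^sub>R ((k / norm w) *\<^sub>R w) = (norm w / k) *\<^sub>R ((k / norm w') *\<^sub>R w')" by simp
    then have w: "w = (norm w / norm w') *\<^sub>R w'" using k0 False by simp
    have "gauge (e, w) = (norm w / norm w') * gauge (e, w')"
      by (subst w) (rule gauge_scale[OF e], simp)
    then have "k = (norm w / norm w') * k" unfolding k' k_def[symmetric] .
    then have "norm w / norm w' = 1" using k0 unfolding mult_cancel_right1 by blast
    from w[unfolded this] show ?thesis by simp
  qed
qed

lemma torus_map_eq:
  assumes e: "norm e = 1" "norm e' = 1" and eq: "torus_map (e, w) = torus_map (e', w')"
  shows "(e', w') = (e, w) \<or> (e', w') = (- e, - w)"
proof -
  have e0: "e \<noteq> 0" using e by auto
  have "e' = e \<or> e' = - e" using eq by (auto simp: torus_map_def power2_eq_iff)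
  then show ?thesis
  proof
    assume "e' = e"
    then show ?thesis using eq e0 disc_part_inj[OF e(1)] by (simp add: torus_map_def)
  next
    assume e': "e' = - e"
    then have "torus_map (e, w) = torus_map (e, - w')" using eq torus_map_minus[OF e(1), of "- w'"] by simp
    then have "w = - w'" using e0 disc_part_inj[OF e(1)] by (simp add: torus_map_def)
    then show ?thesis using e' by simp
  qed
qed

definition unit_part :: "complex \<times> complex \<Rightarrow> complex \<times> complex" where
  "unit_part x = (1 / norm (fst x)) *\<^sub>R x"

lemma A_fst_nonzero: "x \<in> A \<Longrightarrow> x \<noteq> 0 \<Longrightarrow> fst x \<noteq> 0"
  using core_B[of "snd x"] by (cases x) (auto simp: zero_prod_def)

lemma unit_part_mem: "x \<in> A \<Longrightarrow> x \<noteq> 0 \<Longrightarrow> unit_part x \<in> unit_A"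
  using homog_A A_fst_nonzero[of x] by (auto simp: unit_part_def unit_A_def)

lemma torus_map_unit_part_scale:
  assumes x: "x \<in> A" "x \<noteq> 0" and c: "c \<noteq> 0"
  shows "torus_map (unit_part (c *\<^sub>R x)) = torus_map (unit_part x)"
proof -
  have "unit_part (c *\<^sub>R x) = unit_part x \<or> unit_part (c *\<^sub>R x) = - unit_part x"
    using c by (cases "0 < c") (auto simp: unit_part_def)
  moreover have "norm (fst (unit_part x)) = 1" using unit_part_mem[OF x] by (simp add: unit_A_def)
  then have "torus_map (- unit_part x) = torus_map (unit_part x)"
    using torus_map_minus[of "fst (unit_part x)" "snd (unit_part x)"] by (simp add: uminus_prod_def)
  ultimately show ?thesis by auto
qed

text \<open>\<open>torus_map\<close> of the normalised vector is constant on the fibres of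
  \<open>proj_pt\<close> and descends to a continuous bijection from a compact space to a Hausdorff
  one. Leaving the isomorphism \<open>j\<close> arbitrary allows the same theorem to be applied with
  the two cores exchanged.\<close>

theorem solid_torus:
  fixes j :: "complex \<times> complex \<Rightarrow> real ^ 4"
  assumes j: "linear j" "bij j"
  shows "solid_torus_in proj_space (proj_set (j ` A))"
proof -
  define i where "i = Hilbert_Choice.inv j"
  have ij: "i (j x) = x" and ji: "j (i v) = v" for x v
    using j(2) by (simp_all add: i_def bij_is_inj bij_is_surj surj_f_inv_f)
  have lin_i: "linear i" unfolding i_def by (rule linear_inv_bij[OF j])
  have i0: "i v = 0 \<longleftrightarrow> v = 0" for v using linear_0[OF lin_i] linear_0[OF j(1)] by (metis ji)
  have hom: "homog (j ` A)"
    unfolding homog_def using homog_A linear_scale[OF j(1), symmetric] by (auto intro: imageI)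
  have jA: "v \<in> j ` A \<longleftrightarrow> i v \<in> A" for v using ij ji by (metis imageE imageI)
  let ?V = "proj_set (j ` A)" and ?U = "j ` A - {0}"
  let ?\<Phi> = "\<lambda>v. torus_map (unit_part (i v))"
  let ?X = "subtopology proj_space ?V" and ?Y = "top_of_set (sphere (0::complex) 1 \<times> cball (0::complex) 1)"
  have cont_j: "continuous_on S j" for S by (rule linear_continuous_on) (use j(1) in \<open>simp add: linear_conv_bounded_linear\<close>)
  have cont_i: "continuous_on S i" for S by (rule linear_continuous_on) (use lin_i in \<open>simp add: linear_conv_bounded_linear\<close>)
  have clos: "closed (j ` A)"
  proof -
    have "j ` A = i -` A" using jA by auto
    then show ?thesis using closed_vimage[OF closed_A cont_i] by simp
  qed
  have "quotient_map (subtopology (top_of_set (- {0})) ?U) ?X proj_pt"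
  proof (rule quotient_map_restriction[OF quotient_map_proj_pt])
    show "{x \<in> topspace (top_of_set (- {0})). proj_pt x \<in> ?V} = ?U"
      using proj_pt_in_proj_set[OF hom] by auto
    show "openin proj_space ?V \<or> closedin proj_space ?V" using closedin_proj_set[OF hom clos] by blast
  qed
  moreover have "subtopology (top_of_set (- {0})) ?U = top_of_set ?U"
  proof -
    have "- {0} \<inter> ?U = ?U" by auto
    then show ?thesis by (simp only: subtopology_subtopology)
  qed
  ultimately have quo: "quotient_map (top_of_set ?U) ?X proj_pt" by simp
  have U: "i v \<in> A" "i v \<noteq> 0" "fst (i v) \<noteq> 0" if "v \<in> ?U" for v
    using that jA i0 A_fst_nonzero by auto
  have "continuous_on ?U (\<lambda>v. unit_part (i v))"
    unfolding unit_part_def using U by (intro continuous_intros cont_i) auto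
  then have "continuous_on ?U ?\<Phi>"
  proof (rule continuous_on_compose2[OF continuous_on_torus_map])
    show "(\<lambda>v. unit_part (i v)) ` ?U \<subseteq> unit_A"
      by (intro image_subsetI unit_part_mem U)
  qed
  moreover have "?\<Phi> ` ?U \<subseteq> sphere 0 1 \<times> cball 0 1"
    using U unit_part_mem torus_map_image by blast
  ultimately have cont: "continuous_map (top_of_set ?U) ?Y ?\<Phi>"
    by (simp add: continuous_map_in_subtopology image_subset_iff_funcset)
  have fib: "?\<Phi> u = ?\<Phi> v" if uv: "u \<in> ?U" "v \<in> ?U" "proj_pt u = proj_pt v" for u v
  proof -
    obtain c where c: "c \<noteq> 0" "u = c *\<^sub>R v" using uv proj_pt_eq_iff by auto
    then have "i u = c *\<^sub>R i v" using linear_scale[OF lin_i] by simp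
    then show ?thesis using torus_map_unit_part_scale U[OF uv(2)] c(1) by simp
  qed
  obtain g where g: "continuous_map ?X ?Y g" "g ` topspace ?X = ?\<Phi> ` topspace (top_of_set ?U)"
    "\<And>v. v \<in> topspace (top_of_set ?U) \<Longrightarrow> g (proj_pt v) = ?\<Phi> v"
    by (rule quotient_map_lift_exists[OF quo cont]) (simp_all only: topspace_euclidean_subtopology, rule fib)
  note g = g(1) g(2,3)[unfolded topspace_euclidean_subtopology]
  have topX: "topspace ?X = ?V" using proj_set_subset_topspace by auto
  have unit_id: "unit_part x = x" if "x \<in> unit_A" for x using that by (simp add: unit_part_def unit_A_def)
  have unit_ne: "x \<noteq> 0" if "x \<in> unit_A" for x using that by (auto simp: unit_A_def)
  have V: "?V = proj_pt ` j ` unit_A"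
  proof
    show "proj_pt ` j ` unit_A \<subseteq> ?V"
    proof clarify
      fix e w assume ew: "(e, w) \<in> unit_A"
      then have "j (e, w) \<noteq> 0" using unit_ne i0[of "j (e, w)"] ij by metis
      then show "proj_pt (j (e, w)) \<in> ?V" using ew by (auto simp: proj_set_def unit_A_def)
    qed
    show "?V \<subseteq> proj_pt ` j ` unit_A"
    proof
      fix p assume "p \<in> ?V"
      then obtain v where v: "v \<in> ?U" "p = proj_pt v" by (auto simp: proj_set_def)
      have "j (unit_part (i v)) = (1 / norm (fst (i v))) *\<^sub>R v"
        using linear_scale[OF j(1)] by (simp add: unit_part_def ji)
      then have "proj_pt (j (unit_part (i v))) = p" using v U(3)[OF v(1)] by (simp add: proj_pt_scaleR)
      then show "p \<in> proj_pt ` j ` unit_A" using unit_part_mem U[OF v(1)] by blast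
    qed
  qed
  have compact: "compact_space ?X"
  proof -
    have "compactin (top_of_set (- {0})) (j ` unit_A)"
      using compact_continuous_image[OF cont_j compact_unit_A] unit_ne i0 ij
      by (auto simp: compactin_subtopology) metis
    then have "compactin proj_space ?V"
      unfolding V by (rule image_compactin[OF _ continuous_map_proj_pt])
    then show ?thesis by (simp add: compactin_subspace)
  qed
  have inj: "inj_on g (topspace ?X)"
  proof (rule inj_onI)
    fix p q assume pq: "p \<in> topspace ?X" "q \<in> topspace ?X" "g p = g q"
    then have "p \<in> proj_pt ` j ` unit_A" "q \<in> proj_pt ` j ` unit_A"
      using proj_set_subset_topspace by (simp_all add: V[symmetric])
    then obtain x y where xy: "x \<in> unit_A" "y \<in> unit_A" "p = proj_pt (j x)" "q = proj_pt (j y)"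
      unfolding image_image by (elim imageE)
    have mem: "j z \<in> ?U" if "z \<in> unit_A" for z
      using that unit_ne[OF that] i0[of "j z"] ij by (auto simp: unit_A_def)
    then have "torus_map x = torus_map y" using pq(3) xy g(3) unit_id ij by simp
    then have "y = x \<or> y = - x"
      using torus_map_eq[of "fst x" "fst y" "snd x" "snd y"] xy(1,2) by (simp add: unit_A_def uminus_prod_def)
    then show "p = q"
    proof
      assume "y = - x"
      then have "j y = - j x" using linear_neg[OF j(1)] by simp
      then show "p = q" using xy mem[OF xy(1)] proj_pt_minus by simp
    qed (use xy in simp)
  qed
  have "?\<Phi> ` ?U = sphere 0 1 \<times> cball 0 1"
  proof
    show "sphere 0 1 \<times> cball 0 1 \<subseteq> ?\<Phi> ` ?U"
    proof
      fix y assume "y \<in> sphere (0::complex) 1 \<times> cball (0::complex) 1"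
      then obtain x where x: "x \<in> unit_A" "y = torus_map x" unfolding torus_map_image[symmetric] by blast
      then have "j x \<in> ?U" using unit_ne[OF x(1)] i0[of "j x"] ij by (auto simp: unit_A_def)
      moreover have "y = ?\<Phi> (j x)" using x unit_id ij by simp
      ultimately show "y \<in> ?\<Phi> ` ?U" by blast
    qed
  qed fact
  then have "g ` topspace ?X = topspace ?Y" using g(2) by simp
  then have "homeomorphic_map ?X ?Y g"
    using g(1) compact inj by (intro continuous_imp_homeomorphic_map) (auto simp: Hausdorff_space_subtopology Hausdorff_space_euclidean)
  then have "?X homeomorphic_space ?Y" by (rule homeomorphic_map_imp_homeomorphic_space)
  then show ?thesis
    unfolding solid_torus_in_def using proj_set_subset_topspace by simp
qed

text \<open>Up to a common factor, stretching one component is shrinking the other, so the ray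
  condition also reads from the second core to the first. Hence B is a solid torus as well.\<close>

lemma swap: "join_splitting (prod.swap ` B) (prod.swap ` A)"
proof -
  have mem: "x \<in> prod.swap ` S \<longleftrightarrow> prod.swap x \<in> S" for x and S :: "(complex \<times> complex) set"
    by (metis image_iff swap_swap)
  have cl: "closed (prod.swap ` S)" if "closed S" for S :: "(complex \<times> complex) set"
  proof -
    have "prod.swap ` S = prod.swap -` S" using mem by auto
    moreover have "continuous_on UNIV (prod.swap :: complex \<times> complex \<Rightarrow> _)"
      by (rule continuous_on_swap)
    ultimately show ?thesis using closed_vimage[OF that] by metis
  qed
  show ?thesis
  proof
    fix z w \<mu> assume *: "(z, w) \<in> prod.swap ` A" "z \<noteq> 0" "w \<noteq> 0" "1 < (\<mu>::real)"
    show "(z, \<mu> *\<^sub>R w) \<notin> prod.swap ` B"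
    proof
      assume "(z, \<mu> *\<^sub>R w) \<in> prod.swap ` B"
      then have "(\<mu> *\<^sub>R w, z) \<in> B" by (simp add: mem)
      then have "(\<mu> *\<^sub>R w, \<mu> *\<^sub>R z) \<notin> A" using * by (intro ray) auto
      moreover have "(w, z) \<in> A" using * by (simp add: mem)
      ultimately show False using homog_A[of "(w, z)" \<mu>] by simp
    qed
  qed (use closed_A closed_B cover homog_A homog_B core_A core_B cl in \<open>auto simp: mem\<close>)
qed

end

section \<open>Noncontractibility of the cores\<close>

text \<open>Projecting from the line \<open>{z = 0}\<close> maps the complement of that line to the circle of squares
  \<open>z\<^sup>2\<close> (up to positive factors); the line \<open>{w = 0}\<close> is mapped to a loop of winding number \<open>1\<close>.\<close>

lemma not_contractible_within_core:
  fixes j :: "complex \<times> complex \<Rightarrow> real ^ 4"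
  assumes j: "linear j" "bij j"
    and S: "S \<subseteq> topspace proj_space" "\<And>z. z \<noteq> 0 \<Longrightarrow> proj_pt (j (z, 0)) \<in> S"
    and T: "\<And>w. w \<noteq> 0 \<Longrightarrow> proj_pt (j (0, w)) \<in> T"
  shows "\<not> contractible_within proj_space S (topspace proj_space - T)"
proof
  assume "contractible_within proj_space S (topspace proj_space - T)"
  then obtain c h where h: "continuous_map (prod_topology (top_of_set {0..1}) (subtopology proj_space S))
      (subtopology proj_space (topspace proj_space - T)) h"
    "\<And>x. h (0::real, x) = x" "\<And>x. h (1, x) = c"
    unfolding contractible_within_def homotopic_with_def by blast
  define i where "i = Hilbert_Choice.inv j"
  have ij: "i (j x) = x" and ji: "j (i v) = v" for x v
    using j(2) by (simp_all add: i_def bij_is_inj bij_is_surj surj_f_inv_f)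
  have lin_i: "linear i" unfolding i_def by (rule linear_inv_bij[OF j])
  have i0: "i v = 0 \<longleftrightarrow> v = 0" for v using linear_0[OF lin_i] linear_0[OF j(1)] by (metis ji)
  have j0: "j x = 0 \<longleftrightarrow> x = 0" for x using i0[of "j x"] ij[of x] by simp
  have cont_j: "continuous_on A j" for A by (rule linear_continuous_on) (use j(1) in \<open>simp add: linear_conv_bounded_linear\<close>)
  have cont_i: "continuous_on A i" for A by (rule linear_continuous_on) (use lin_i in \<open>simp add: linear_conv_bounded_linear\<close>)
  \<comment> \<open>A quotient of functions of degree 2, so it descends to projective points; it
    vanishes exactly on the second core.\<close>
  define f where "f v = (fst (i v)) ^ 2 / of_real (norm (i v) ^ 2)" for v
  have "continuous_on (- {0}) f"
    unfolding f_def using i0 by (intro continuous_intros cont_i) auto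
  then have cf: "continuous_map (top_of_set (- {0})) euclidean f" by simp
  have ff: "f u = f v" if uv: "u \<noteq> 0" "v \<noteq> 0" "proj_pt u = proj_pt v" for u v
  proof -
    obtain c where c: "c \<noteq> 0" "u = c *\<^sub>R v" using uv proj_pt_eq_iff by blast
    then have "i u = c *\<^sub>R i v" using linear_scale[OF lin_i] by simp
    then have "f u = (of_real c * fst (i v)) ^ 2 / of_real ((\<bar>c\<bar> * norm (i v)) ^ 2)"
      by (simp add: f_def scaleR_conv_of_real)
    also have "\<dots> = (of_real (c ^ 2) * fst (i v) ^ 2) / (of_real (c ^ 2) * of_real (norm (i v) ^ 2))"
      by (simp add: power_mult_distrib)
    also have "\<dots> = f v" using c(1) by (simp add: f_def)
    finally show ?thesis .
  qed
  obtain Q where Q': "continuous_map proj_space euclidean Q"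
    "Q ` topspace proj_space = f ` topspace (top_of_set (- {0}))"
    "\<And>v. v \<in> topspace (top_of_set (- {0})) \<Longrightarrow> Q (proj_pt v) = f v"
    by (rule quotient_map_lift_exists[OF quotient_map_proj_pt cf])
      (simp_all only: topspace_euclidean_subtopology, rule ff, auto)
  then have Q: "continuous_map proj_space euclidean Q" "\<And>v. v \<noteq> 0 \<Longrightarrow> Q (proj_pt v) = f v"
    by simp_all
  have Q0: "Q p \<noteq> 0" if p: "p \<in> topspace proj_space - T" for p
  proof -
    obtain v where v: "v \<noteq> 0" "p = proj_pt v" using p by (auto simp: topspace_proj_space)
    have "fst (i v) \<noteq> 0"
    proof
      assume *: "fst (i v) = 0"
      then have eq: "i v = (0, snd (i v))" by (simp add: prod_eq_iff)
      have "snd (i v) \<noteq> 0"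
      proof
        assume "snd (i v) = 0"
        then have "i v = 0" using * by (simp add: prod_eq_iff)
        then show False using v(1) i0 by blast
      qed
      then have "proj_pt (j (i v)) \<in> T" by (subst eq) (rule T)
      then show False using p v ji by simp
    qed
    then show ?thesis using v i0[of v] by (simp add: Q(2) f_def)
  qed
  \<comment> \<open>A half turn already closes up projectively, since z and -z give the same point;
    squaring makes it one full turn.\<close>
  define \<gamma> where "\<gamma> x = proj_pt (j (cis (pi * x), 0))" for x :: real
  have nz: "j (cis x, 0) \<noteq> 0" for x by (simp add: j0 zero_prod_def)
  have "continuous_on {0..1} (\<lambda>x. j (cis (pi * x), 0))"
    by (intro continuous_on_compose2[OF cont_j[of UNIV]] continuous_intros) auto
  then have "continuous_map (top_of_set {0..1}) (top_of_set (- {0})) (\<lambda>x. j (cis (pi * x), 0))"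
    using nz nz[symmetric] by (auto simp: continuous_map_in_subtopology)
  then have "continuous_map (top_of_set {0..1}) proj_space (proj_pt \<circ> (\<lambda>x. j (cis (pi * x), 0)))"
    by (rule continuous_map_compose[OF _ continuous_map_proj_pt])
  then have "continuous_map (top_of_set {0..1}) proj_space \<gamma>" by (simp add: \<gamma>_def[abs_def] comp_def)
  then have \<gamma>: "continuous_map (top_of_set {0..1}) (subtopology proj_space S) \<gamma>"
    using S(2) by (simp add: continuous_map_in_subtopology \<gamma>_def)
  define H where "H = Q \<circ> h \<circ> (\<lambda>(t, x). (t, \<gamma> x))"
  have k: "continuous_map (prod_topology (top_of_set {0..1}) (top_of_set {0..1}))
      (prod_topology (top_of_set {0..1}) (subtopology proj_space S)) (\<lambda>(t, x). (t, \<gamma> x))"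
    using \<gamma> by (simp add: continuous_map_prod_top del: prod_topology_subtopology_eu)
  have QT: "continuous_map (subtopology proj_space (topspace proj_space - T)) (top_of_set (- {0})) Q"
  proof -
    have "continuous_map (subtopology proj_space (topspace proj_space - T)) euclidean Q"
      by (rule continuous_map_from_subtopology[OF Q(1)])
    moreover have "Q \<in> topspace (subtopology proj_space (topspace proj_space - T)) \<rightarrow> - {0}"
      by (intro funcsetI) (use Q0 in simp)
    ultimately show ?thesis
      unfolding continuous_map_in_subtopology by blast
  qed
  have "continuous_map (prod_topology (top_of_set {0..1}) (top_of_set {0..1})) (top_of_set (- {0})) H"
    unfolding H_def by (intro continuous_map_compose[OF k] continuous_map_compose[OF h(1) QT])
  then have H: "continuous_on ({0..1} \<times> {0..1}) H" "H ` ({0..1} \<times> {0..1}) \<subseteq> - {0}"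
    by (auto simp: continuous_map_in_subtopology)
  have H0: "H (0, x) = cis (2 * pi * x)" for x
  proof -
    have "cis (pi * x) ^ 2 = cis (2 * pi * x)" using Complex.DeMoivre[of "pi * x" 2] by (simp add: mult.assoc)
    then show ?thesis by (simp add: H_def h(2) \<gamma>_def Q(2) nz f_def ij norm_Pair)
  qed
  have H1: "H (1, x) = Q c" for x by (simp add: H_def h(3))
  have \<gamma>01: "\<gamma> 1 = \<gamma> 0"
  proof -
    have "j (cis (pi * 1), 0) = - j (1, 0)" using linear_neg[OF j(1), of "(1, 0)"] by (simp add: cis_pi)
    then show ?thesis using proj_pt_minus[OF nz[of 0]] by (simp add: \<gamma>_def)
  qed
  have "homotopic_loops (- {0}) (circlepath 0 1) (\<lambda>x. Q c)"
    unfolding homotopic_loops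
  proof (intro exI[of _ H] conjI ballI)
    fix x :: real
    show "H (0, x) = circlepath 0 1 x"
      by (simp add: H0 circlepath cis_conv_exp algebra_simps)
  next
    fix t :: real
    show "pathfinish (H \<circ> Pair t) = pathstart (H \<circ> Pair t)"
      by (simp add: pathfinish_def pathstart_def H_def \<gamma>01)
  qed (use H H1 in auto)
  then have "winding_number (circlepath 0 1) 0 = winding_number (\<lambda>x. Q c) 0"
    by (rule winding_number_homotopic_loops)
  moreover have "H (1, 0) \<in> - {0}" using H(2) by (rule subsetD) simp
  then have "Q c \<noteq> 0" by (simp add: H1)
  then have "winding_number (\<lambda>x. Q c) 0 = 0"
    using winding_number_trivial[of 0 "Q c"] by (simp add: linepath_refl)
  ultimately show False using winding_number_circlepath_centre[of 1 0] by simp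
qed

section \<open>The unions of the orbits\<close>

definition typed_cone :: "chamber_type \<Rightarrow> (real ^ 4) set" where
  "typed_cone T = \<Union> (closed_cone ` {w. generic w \<and> type_of w = T})"

lemma Union_chambers_typed: "\<Union> (chambers_typed T) = proj_set (typed_cone T)"
  by (auto simp: chambers_typed_def chamber_def proj_set_def typed_cone_def)

lemma type_of_minus: "generic w \<Longrightarrow> type_of (- w) = type_of w"
  using pattern_in_patterns[of w] pattern_type_invariant
  by (simp add: type_of_def pattern_minus list_all_iff)

lemma typed_cone_scaleR:
  assumes "v \<in> typed_cone T" shows "c *\<^sub>R v \<in> typed_cone T"
proof -
  obtain w where w: "generic w" "type_of w = T" "v \<in> closed_cone w"
    using assms by (auto simp: typed_cone_def)
  consider "0 < c" | "c = 0" | "c < 0" by linarith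
  then show ?thesis
  proof cases
    case 1
    then show ?thesis using w closed_cone_scaleR by (auto simp: typed_cone_def)
  next
    case 2
    then have "c *\<^sub>R v \<in> closed_cone w" by (simp add: closed_cone_def)
    then show ?thesis using w by (auto simp: typed_cone_def)
  next
    case 3
    then have "c *\<^sub>R v \<in> closed_cone (- w)"
      using closed_cone_scaleR[OF w(3), of "- c"] by (simp add: closed_cone_def)
    moreover have "generic (- w)" using generic_scaleR[OF w(1), of "- 1"] by simp
    ultimately show ?thesis using w type_of_minus by (auto simp: typed_cone_def)
  qed
qed

lemma homog_typed_cone: "homog (typed_cone T)"
  using typed_cone_scaleR by (simp add: homog_def)

lemma typed_cone_cover: "\<exists>T. v \<in> typed_cone T"
proof -
  obtain e where "generic (v + e *\<^sub>R rep Cube)" "v \<in> closed_cone (v + e *\<^sub>R rep Cube)"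
    using that by (rule generic_perturbation[OF generic_rep zero_less_one])
  then show ?thesis by (auto simp: typed_cone_def)
qed

lemma type_of_generic:
  assumes "generic v" "v \<in> typed_cone T" shows "type_of v = T"
proof -
  obtain w where w: "generic w" "type_of w = T" "v \<in> closed_cone w"
    using assms(2) by (auto simp: typed_cone_def)
  then have "pattern v = pattern w"
    using assms(1) closed_cone_generic_iff pattern_eq_iff by blast
  then show ?thesis using w by (simp add: type_of_def)
qed

section \<open>Inequalities satisfied by the unions of the orbits\<close>

definition same_sign :: "real \<Rightarrow> real \<Rightarrow> real \<Rightarrow> bool" where
  "same_sign a b c \<longleftrightarrow> (0 \<le> a \<and> 0 \<le> b \<and> 0 \<le> c) \<or> (a \<le> 0 \<and> b \<le> 0 \<and> c \<le> 0)"

definition in_U1 :: "real \<Rightarrow> real \<Rightarrow> real \<Rightarrow> real \<Rightarrow> bool" where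
  "in_U1 x y z t \<longleftrightarrow> same_sign x y z \<or> same_sign (y - z - t) (z - x - t) (x - y - t)"

text \<open>The sign of x - y - t is left free, so this cone is the union of two adjacent dumpling
  cones. Its six images under \<open>cyclic_pm\<close> are three opposite pairs, which accounts for
  all six dumplings. Likewise \<open>tetra\<close> comprises two tetrahedra.\<close>

definition dump :: "real \<Rightarrow> real \<Rightarrow> real \<Rightarrow> real \<Rightarrow> bool" where
  "dump x y z t \<longleftrightarrow> 0 \<le> x \<and> 0 \<le> y \<and> z \<le> 0 \<and> z - x \<le> t \<and> t \<le> y - z"

definition tetra :: "real \<Rightarrow> real \<Rightarrow> real \<Rightarrow> real \<Rightarrow> bool" where
  "tetra x y z t \<longleftrightarrow> 0 \<le> x \<and> 0 \<le> y \<and> z \<le> 0 \<and>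
     ((t \<le> y - z \<and> t \<le> z - x \<and> x - y \<le> t) \<or> (y - z \<le> t \<and> z - x \<le> t \<and> t \<le> x - y))"

definition cyclic_pm :: "(real \<Rightarrow> real \<Rightarrow> real \<Rightarrow> real \<Rightarrow> bool) \<Rightarrow> real \<Rightarrow> real \<Rightarrow> real \<Rightarrow> real \<Rightarrow> bool" where
  "cyclic_pm P x y z t \<longleftrightarrow> P x y z t \<or> P y z x t \<or> P z x y t \<or>
     P (- x) (- y) (- z) (- t) \<or> P (- y) (- z) (- x) (- t) \<or> P (- z) (- x) (- y) (- t)"

abbreviation "in_U2 \<equiv> cyclic_pm dump"
abbreviation "in_U3 \<equiv> cyclic_pm tetra"

lemma dump_minus:
  "dump (- x) (- y) (- z) (- t) \<longleftrightarrow> x \<le> 0 \<and> y \<le> 0 \<and> 0 \<le> z \<and> y - z \<le> t \<and> t \<le> z - x"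
  by (auto simp: dump_def)

lemma tetra_minus:
  "tetra (- x) (- y) (- z) (- t) \<longleftrightarrow> x \<le> 0 \<and> y \<le> 0 \<and> 0 \<le> z \<and>
     ((t \<le> y - z \<and> t \<le> z - x \<and> x - y \<le> t) \<or> (y - z \<le> t \<and> z - x \<le> t \<and> t \<le> x - y))"
  by (auto simp: tetra_def)

lemma in_U1_iff:
  "in_U1 x y z t \<longleftrightarrow> (0 \<le> x \<and> 0 \<le> y \<and> 0 \<le> z) \<or> (x \<le> 0 \<and> y \<le> 0 \<and> z \<le> 0) \<or>
     (t \<le> y - z \<and> t \<le> z - x \<and> t \<le> x - y) \<or> (y - z \<le> t \<and> z - x \<le> t \<and> x - y \<le> t)"
  by (auto simp: in_U1_def same_sign_def)

lemma in_U2_iff: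
  "in_U2 x y z t \<longleftrightarrow>
     (0 \<le> x \<and> 0 \<le> y \<and> z \<le> 0 \<and> z - x \<le> t \<and> t \<le> y - z) \<or>
     (0 \<le> y \<and> 0 \<le> z \<and> x \<le> 0 \<and> x - y \<le> t \<and> t \<le> z - x) \<or>
     (0 \<le> z \<and> 0 \<le> x \<and> y \<le> 0 \<and> y - z \<le> t \<and> t \<le> x - y) \<or>
     (x \<le> 0 \<and> y \<le> 0 \<and> 0 \<le> z \<and> y - z \<le> t \<and> t \<le> z - x) \<or>
     (y \<le> 0 \<and> z \<le> 0 \<and> 0 \<le> x \<and> z - x \<le> t \<and> t \<le> x - y) \<or>
     (z \<le> 0 \<and> x \<le> 0 \<and> 0 \<le> y \<and> x - y \<le> t \<and> t \<le> y - z)"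
  unfolding cyclic_pm_def dump_minus unfolding dump_def by simp

lemma in_U3_iff:
  "in_U3 x y z t \<longleftrightarrow>
     (0 \<le> x \<and> 0 \<le> y \<and> z \<le> 0 \<and> ((t \<le> y - z \<and> t \<le> z - x \<and> x - y \<le> t) \<or> (y - z \<le> t \<and> z - x \<le> t \<and> t \<le> x - y))) \<or>
     (0 \<le> y \<and> 0 \<le> z \<and> x \<le> 0 \<and> ((t \<le> z - x \<and> t \<le> x - y \<and> y - z \<le> t) \<or> (z - x \<le> t \<and> x - y \<le> t \<and> t \<le> y - z))) \<or>
     (0 \<le> z \<and> 0 \<le> x \<and> y \<le> 0 \<and> ((t \<le> x - y \<and> t \<le> y - z \<and> z - x \<le> t) \<or> (x - y \<le> t \<and> y - z \<le> t \<and> t \<le> z - x))) \<or>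
     (x \<le> 0 \<and> y \<le> 0 \<and> 0 \<le> z \<and> ((t \<le> y - z \<and> t \<le> z - x \<and> x - y \<le> t) \<or> (y - z \<le> t \<and> z - x \<le> t \<and> t \<le> x - y))) \<or>
     (y \<le> 0 \<and> z \<le> 0 \<and> 0 \<le> x \<and> ((t \<le> z - x \<and> t \<le> x - y \<and> y - z \<le> t) \<or> (z - x \<le> t \<and> x - y \<le> t \<and> t \<le> y - z))) \<or>
     (z \<le> 0 \<and> x \<le> 0 \<and> 0 \<le> y \<and> ((t \<le> x - y \<and> t \<le> y - z \<and> z - x \<le> t) \<or> (x - y \<le> t \<and> y - z \<le> t \<and> t \<le> z - x)))"
  unfolding cyclic_pm_def tetra_minus unfolding tetra_def by (rule refl)

lemma closed_cone_signs:
  assumes "generic w" "v \<in> closed_cone w"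
  shows "if 0 < w $ 1 then 0 \<le> v $ 1 else v $ 1 \<le> 0"
    "if 0 < w $ 2 then 0 \<le> v $ 2 else v $ 2 \<le> 0"
    "if 0 < w $ 3 then 0 \<le> v $ 3 else v $ 3 \<le> 0"
    "if 0 < w $ 2 - w $ 3 - w $ 4 then v $ 4 \<le> v $ 2 - v $ 3 else v $ 2 - v $ 3 \<le> v $ 4"
    "if 0 < w $ 3 - w $ 1 - w $ 4 then v $ 4 \<le> v $ 3 - v $ 1 else v $ 3 - v $ 1 \<le> v $ 4"
    "if 0 < w $ 1 - w $ 2 - w $ 4 then v $ 4 \<le> v $ 1 - v $ 2 else v $ 1 - v $ 2 \<le> v $ 4"
proof -
  have *: "if 0 < r then 0 \<le> s else s \<le> 0" if "0 \<le> r * s" "r \<noteq> 0" for r s :: real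
    using that by (auto simp: zero_le_mult_iff)
  have **: "if 0 < r then t \<le> s else s \<le> t" if "0 \<le> r * (s - t)" "r \<noteq> 0" for r s t :: real
    using *[OF that] by (simp split: if_splits)
  note c = assms(2)[unfolded closed_cone_iff] and g = assms(1)[unfolded generic_iff]
  show "if 0 < w $ 1 then 0 \<le> v $ 1 else v $ 1 \<le> 0" by (rule *) (use c g in \<open>blast+\<close>)
  show "if 0 < w $ 2 then 0 \<le> v $ 2 else v $ 2 \<le> 0" by (rule *) (use c g in \<open>blast+\<close>)
  show "if 0 < w $ 3 then 0 \<le> v $ 3 else v $ 3 \<le> 0" by (rule *) (use c g in \<open>blast+\<close>)
  show "if 0 < w $ 2 - w $ 3 - w $ 4 then v $ 4 \<le> v $ 2 - v $ 3 else v $ 2 - v $ 3 \<le> v $ 4"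
    by (rule **) (use c g in \<open>blast+\<close>)
  show "if 0 < w $ 3 - w $ 1 - w $ 4 then v $ 4 \<le> v $ 3 - v $ 1 else v $ 3 - v $ 1 \<le> v $ 4"
    by (rule **) (use c g in \<open>blast+\<close>)
  show "if 0 < w $ 1 - w $ 2 - w $ 4 then v $ 4 \<le> v $ 1 - v $ 2 else v $ 1 - v $ 2 \<le> v $ 4"
    by (rule **) (use c g in \<open>blast+\<close>)
qed

text \<open>All later arguments pass from membership in a cone to inequalities, also when excluding
  a point from a cone. The proof is a finite case check over the six signs.\<close>

lemma typed_cone_imp:
  assumes v: "v \<in> typed_cone T"
  shows "T = Cube \<or> T = Prism \<Longrightarrow> in_U1 (v $ 1) (v $ 2) (v $ 3) (v $ 4)"
    "T = Dumpling \<Longrightarrow> in_U2 (v $ 1) (v $ 2) (v $ 3) (v $ 4)"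
    "T = Tetrahedron \<Longrightarrow> in_U3 (v $ 1) (v $ 2) (v $ 3) (v $ 4)"
proof -
  obtain w where w: "generic w" "type_of w = T" "v \<in> closed_cone w"
    using v by (auto simp: typed_cone_def)
  obtain x y z a b c where abc: "pattern w = [x, y, z, a, b, c]" unfolding pattern_def by blast
  have valid: "valid_pattern [x, y, z, a, b, c]"
    using pattern_in_patterns[OF w(1)] by (simp add: patterns_def abc)
  have T: "pattern_type [x, y, z, a, b, c] = T" using w(2) by (simp add: type_of_def abc)
  have s: "if x then 0 \<le> v $ 1 else v $ 1 \<le> 0" "if y then 0 \<le> v $ 2 else v $ 2 \<le> 0"
    "if z then 0 \<le> v $ 3 else v $ 3 \<le> 0"
    "if a then v $ 4 \<le> v $ 2 - v $ 3 else v $ 2 - v $ 3 \<le> v $ 4"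
    "if b then v $ 4 \<le> v $ 3 - v $ 1 else v $ 3 - v $ 1 \<le> v $ 4"
    "if c then v $ 4 \<le> v $ 1 - v $ 2 else v $ 1 - v $ 2 \<le> v $ 4"
    using closed_cone_signs[OF w(1,3)] abc[unfolded pattern_def list.inject] by blast+
  show "in_U1 (v $ 1) (v $ 2) (v $ 3) (v $ 4)" if "T = Cube \<or> T = Prism"
    using that T s unfolding in_U1_iff
    by (cases x; cases y; cases z; cases a; cases b; cases c;
        simp only: pattern_type.simps valid_pattern.simps simp_thms if_True if_False chamber_type.distinct;
        blast)
  show "in_U2 (v $ 1) (v $ 2) (v $ 3) (v $ 4)" if "T = Dumpling"
    using that T s unfolding in_U2_iff
    by (cases x; cases y; cases z; cases a; cases b; cases c;
        simp only: pattern_type.simps valid_pattern.simps simp_thms if_True if_False chamber_type.distinct;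
        blast)
  show "in_U3 (v $ 1) (v $ 2) (v $ 3) (v $ 4)" if "T = Tetrahedron"
    using that T s valid unfolding in_U3_iff
    by (cases x; cases y; cases z; cases a; cases b; cases c;
        simp only: pattern_type.simps valid_pattern.simps simp_thms if_True if_False chamber_type.distinct;
        blast)
qed

text \<open>A closed cone depends only on the sign pattern, so the union over infinitely many
  \<open>w\<close> is a finite one.\<close>

lemma closed_typed_cone: "closed (typed_cone T)"
proof -
  let ?W = "{w. generic w \<and> type_of w = T}"
  define f where "f p = closed_cone (SOME w. generic w \<and> pattern w = p)" for p
  have "closed_cone w = f (pattern w)" if w: "generic w" for w
  proof -
    have "generic (SOME u. generic u \<and> pattern u = pattern w) \<and>
        pattern (SOME u. generic u \<and> pattern u = pattern w) = pattern w"
      by (rule someI[of _ w]) (simp add: w)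
    then show ?thesis unfolding f_def using w pattern_eq_iff[OF w] open_cone_cong by metis
  qed
  then have "closed_cone ` ?W \<subseteq> f ` set patterns" using pattern_in_patterns by blast
  then have "finite (closed_cone ` ?W)" using finite_subset by blast
  then show ?thesis unfolding typed_cone_def by (rule closed_Union) (auto intro: closed_closed_cone)
qed

lemma closed_typed_cones:
  "closed (typed_cone Cube \<union> typed_cone Prism)" "closed (typed_cone Dumpling)" "closed (typed_cone Tetrahedron)"
  by (intro closed_Un closed_typed_cone)+

section \<open>The orbits along the rays of the join structure\<close>

definition mixed_sign :: "real \<Rightarrow> real \<Rightarrow> real \<Rightarrow> bool" where
  "mixed_sign a b c \<longleftrightarrow> (a \<le> 0 \<or> b \<le> 0 \<or> c \<le> 0) \<and> (0 \<le> a \<or> 0 \<le> b \<or> 0 \<le> c)"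

lemma mixed_sign_of_U23:
  assumes "in_U2 x y z t \<or> in_U3 x y z t"
  shows "mixed_sign x y z" "mixed_sign (y - z - t) (z - x - t) (x - y - t)"
  using assms unfolding in_U2_iff in_U3_iff mixed_sign_def by auto

text \<open>Nonzero deviations with sum zero have a negative minimum and a positive maximum. The
  smallest entry is at most 0 and the largest at least 0, and amplifying the deviations makes both
  strict.\<close>

lemma mixed_sign_scale:
  assumes mix: "mixed_sign (s + a) (s + b) (s + c)" and sum: "a + b + c = 0"
    and nz: "a \<noteq> 0 \<or> b \<noteq> 0 \<or> c \<noteq> 0" and k: "0 < k"
  shows "\<not> same_sign (s + a + k * a) (s + b + k * b) (s + c + k * c)"
proof -
  have sg: "0 \<le> k * r \<longleftrightarrow> 0 \<le> r" "k * r \<le> 0 \<longleftrightarrow> r \<le> 0" for r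
    using k by (auto simp: zero_le_mult_iff mult_le_0_iff)
  have ksum: "k * a + k * b + k * c = 0" using sum by (metis distrib_left mult_zero_right)
  show ?thesis
    using mix sum nz ksum sg[of a] sg[of b] sg[of c]
    unfolding mixed_sign_def same_sign_def by smt
qed

text \<open>Up to the symmetries it suffices to treat \<open>x \<ge> y \<ge> z\<close> and \<open>x + y + z \<ge> 0\<close>, where membership in
  the union of the dumplings is governed by the position of \<open>t\<close> relative to the gap between
  the coordinate of odd sign and its neighbour.\<close>

lemma in_U2_sorted:
  assumes "in_U2 x y z t" "z \<le> y" "y \<le> x" "0 \<le> x + y + z"
  shows "z \<le> 0" "z - x \<le> t" "(0 \<le> y \<and> t \<le> y - z) \<or> (y \<le> 0 \<and> t \<le> x - y)"
  using assms unfolding in_U2_iff by (elim disjE conjE; linarith)+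

lemma not_in_U13_sorted:
  assumes "z \<le> y" "y \<le> x" "z < 0" "0 < x" "z - x < t" "0 \<le> y \<longrightarrow> t < y - z" "y \<le> 0 \<longrightarrow> t < x - y"
  shows "\<not> in_U1 x y z t" "\<not> in_U3 x y z t"
  using assms unfolding in_U1_iff in_U3_iff by (intro notI, elim disjE conjE; smt)+

text \<open>Deviations from the mean m are stretched by 1 + k. This pushes every bound on t
  outwards; the delicate point is that the middle coordinate may change sign and thereby exchange
  the relevant gap.\<close>

lemma U2_ray_sorted:
  assumes U2: "in_U2 x y z t" and ord: "z \<le> y" "y \<le> x" "z < x" and s: "0 \<le> x + y + z" and k: "0 < k"
  defines "m \<equiv> (x + y + z) / 3"
  shows "\<not> in_U1 (x + k * (x - m)) (y + k * (y - m)) (z + k * (z - m)) t"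
    "\<not> in_U3 (x + k * (x - m)) (y + k * (y - m)) (z + k * (z - m)) t"
proof -
  define a where "a = k * (x - m)"
  define b where "b = k * (y - m)"
  define c where "c = k * (z - m)"
  note abc = a_def b_def c_def
  have m: "3 * m = x + y + z" by (simp add: m_def)
  have ab: "a - b = k * (x - y)" "b - c = k * (y - z)" "a - c = k * (x - z)"
    by (simp_all add: abc algebra_simps)
  have ord': "c \<le> b" "b \<le> a" "c < a" "b = c \<Longrightarrow> y = z" "a = b \<Longrightarrow> x = y"
  proof -
    have "0 \<le> k * (x - y)" "0 \<le> k * (y - z)" "0 < k * (x - z)" using ord k by simp_all
    then have "0 \<le> a - b" "0 \<le> b - c" "0 < a - c" unfolding ab by blast+
    then show "c \<le> b" "b \<le> a" "c < a" by simp_all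
    show "y = z" if "b = c" using ab(2) that k by simp
    show "x = y" if "a = b" using ab(1) that k by simp
  qed
  have "a + b + c = k * (x + y + z - 3 * m)" by (simp add: abc algebra_simps)
  then have sum: "a + b + c = 0" using m by simp
  have b: "0 \<le> b \<Longrightarrow> m \<le> y" "b \<le> 0 \<Longrightarrow> y \<le> m"
    using k by (auto simp: abc zero_le_mult_iff mult_le_0_iff)
  have m0: "0 \<le> m" using s m by linarith
  note U = in_U2_sorted[OF U2 ord(1,2) s]
  have 1: "z + c \<le> y + b" "y + b \<le> x + a" "z + c < 0" "0 < x + a" "(z + c) - (x + a) < t"
    using ord ord' sum U(1,2) m0 m by linarith+
  have 2: "t < (y + b) - (z + c)" if "0 \<le> y + b"
    using U(3)
  proof
    assume *: "0 \<le> y \<and> t \<le> y - z"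
    show ?thesis
    proof (cases "b = c")
      case True
      then have "y = z" by (rule ord'(4))
      then show ?thesis using True * U(1) ord' sum that by linarith
    next
      case False
      then show ?thesis using * ord'(1) by linarith
    qed
  next
    \<comment> \<open>A nonpositive middle coordinate can end nonnegative only if it is at least the
      mean, which is itself nonnegative. So y = m = 0, where the two gaps coincide.\<close>
    assume *: "y \<le> 0 \<and> t \<le> x - y"
    then have "0 \<le> b" using that by linarith
    then have "m \<le> y" by (rule b(1))
    then have "y = 0" "m = 0" using * m0 by linarith+
    then show ?thesis using * m ord' sum \<open>0 \<le> b\<close> by linarith
  qed
  have 3: "t < (x + a) - (y + b)" if "y + b \<le> 0"
    using U(3)
  proof
    \<comment> \<open>Here the middle coordinate does not exceed the mean, which means y - z \<le> x
      - y, so the old bound implies the one for the other gap.\<close>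
    assume *: "0 \<le> y \<and> t \<le> y - z"
    then have "b \<le> 0" using that by linarith
    then have "y \<le> m" by (rule b(2))
    then show ?thesis using * m ord' sum \<open>b \<le> 0\<close> by linarith
  next
    assume *: "y \<le> 0 \<and> t \<le> x - y"
    show ?thesis
    proof (cases "a = b")
      case True
      then have "x = y" by (rule ord'(5))
      then show ?thesis using * m m0 ord(3) U(1) s by linarith
    next
      case False
      then show ?thesis using * ord'(2) by linarith
    qed
  qed
  show "\<not> in_U1 (x + k * (x - m)) (y + k * (y - m)) (z + k * (z - m)) t"
    "\<not> in_U3 (x + k * (x - m)) (y + k * (y - m)) (z + k * (z - m)) t"
    unfolding abc[symmetric] using 1 2 3 by (intro not_in_U13_sorted; blast)+
qed

lemma in_U_cyclic:
  "in_U1 y z x t = in_U1 x y z t" "in_U2 y z x t = in_U2 x y z t" "in_U3 y z x t = in_U3 x y z t"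
  unfolding in_U1_def same_sign_def cyclic_pm_def by (simp_all only: conj_ac disj_ac)

lemma cyclic_pm_swap:
  assumes "\<And>x y z t. P y x z (- t) = P x y z t"
  shows "cyclic_pm P y x z (- t) = cyclic_pm P x y z t"
proof -
  have "P y x z (- t) = P x y z t" "P x z y (- t) = P z x y t" "P z y x (- t) = P y z x t"
    by (rule assms)+
  moreover have "P (- y) (- x) (- z) (- (- t)) = P (- x) (- y) (- z) (- t)"
    "P (- x) (- z) (- y) (- (- t)) = P (- z) (- x) (- y) (- t)"
    "P (- z) (- y) (- x) (- (- t)) = P (- y) (- z) (- x) (- t)"
    by (rule assms)+
  ultimately show ?thesis unfolding cyclic_pm_def by (simp only: disj_ac)
qed

text \<open>Up to the factor -1 this is the action of \<open>sigma\<close>.\<close>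

lemma in_U_swap:
  "in_U1 y x z (- t) = in_U1 x y z t" "in_U2 y x z (- t) = in_U2 x y z t" "in_U3 y x z (- t) = in_U3 x y z t"
proof -
  show "in_U1 y x z (- t) = in_U1 x y z t"
    unfolding in_U1_def same_sign_def by (auto simp: algebra_simps)
  show "in_U2 y x z (- t) = in_U2 x y z t" by (rule cyclic_pm_swap) (auto simp: dump_def)
  show "in_U3 y x z (- t) = in_U3 x y z t" by (rule cyclic_pm_swap) (auto simp: tetra_def)
qed

lemma in_U_minus:
  "in_U1 (- x) (- y) (- z) (- t) = in_U1 x y z t" "in_U2 (- x) (- y) (- z) (- t) = in_U2 x y z t"
  "in_U3 (- x) (- y) (- z) (- t) = in_U3 x y z t"
proof -
  show "in_U1 (- x) (- y) (- z) (- t) = in_U1 x y z t" unfolding in_U1_iff by auto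
  show "in_U2 (- x) (- y) (- z) (- t) = in_U2 x y z t" unfolding cyclic_pm_def by (simp only: minus_minus disj_ac)
  show "in_U3 (- x) (- y) (- z) (- t) = in_U3 x y z t" unfolding cyclic_pm_def by (simp only: minus_minus disj_ac)
qed

text \<open>The claim is packaged as a predicate \<open>Q\<close> invariant under cyclic shifts, the
  swap and negation; these bring any vector into the sorted position with nonnegative sum.\<close>

lemma U2_ray:
  assumes "in_U2 x y z t" "\<not> (x = y \<and> y = z)" "0 < k"
  defines "m \<equiv> (x + y + z) / 3"
  shows "\<not> in_U1 (x + k * (x - m)) (y + k * (y - m)) (z + k * (z - m)) t \<and>
    \<not> in_U3 (x + k * (x - m)) (y + k * (y - m)) (z + k * (z - m)) t"
proof -
  let ?m = "\<lambda>x y z. (x + y + z) / (3::real)"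
  define Q where "Q x y z t \<longleftrightarrow> (in_U2 x y z t \<and> \<not> (x = y \<and> y = z) \<longrightarrow>
    \<not> in_U1 (x + k * (x - ?m x y z)) (y + k * (y - ?m x y z)) (z + k * (z - ?m x y z)) t \<and>
    \<not> in_U3 (x + k * (x - ?m x y z)) (y + k * (y - ?m x y z)) (z + k * (z - ?m x y z)) t)" for x y z t
  have cyc: "Q y z x t = Q x y z t" for x y z t
  proof -
    have "?m y z x = ?m x y z" by simp
    then show ?thesis unfolding Q_def by (simp only: in_U_cyclic) metis
  qed
  have swap: "Q y x z (- t) = Q x y z t" for x y z t
  proof -
    have "?m y x z = ?m x y z" by simp
    then show ?thesis unfolding Q_def by (simp only: in_U_swap) metis
  qed
  have neg: "Q (- x) (- y) (- z) (- t) = Q x y z t" for x y z t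
  proof -
    have m: "?m (- x) (- y) (- z) = - ?m x y z" by (simp add: field_simps)
    have "- r + k * (- r - ?m (- x) (- y) (- z)) = - (r + k * (r - ?m x y z))" for r
      unfolding m by (simp only: minus_diff_minus mult_minus_right minus_add_distrib)
    then show ?thesis unfolding Q_def by (simp only: in_U_minus neg_equal_iff_equal)
  qed
  have sorted_nonneg: "Q x y z t" if "z \<le> y" "y \<le> x" "0 \<le> x + y + z" for x y z t
    unfolding Q_def using U2_ray_sorted[of x y z t k] that assms(3) by force
  have sorted: "Q x y z t" if "z \<le> y" "y \<le> x" for x y z t
  proof (cases "0 \<le> x + y + z")
    case False
    \<comment> \<open>Negation reverses the order and the sign of the sum; the odd permutation
      restoring the order of the arguments accounts for the sign of t.\<close>
    have "Q (- z) (- y) (- x) t" using that False by (intro sorted_nonneg) auto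
    then have "Q (- x) (- y) (- z) (- t)" using cyc swap by metis
    then show ?thesis using neg by blast
  qed (use sorted_nonneg that in blast)
  have "Q x y z t"
  proof -
    consider "z \<le> y" "y \<le> x" | "y \<le> z" "z \<le> x" | "z \<le> x" "x \<le> y" | "x \<le> z" "z \<le> y"
      | "y \<le> x" "x \<le> z" | "x \<le> y" "y \<le> z" by linarith
    then show ?thesis
    proof cases
      case 1 then show ?thesis by (rule sorted)
    next
      case 2
      then have "Q x z y (- t)" by (rule sorted)
      then show ?thesis using cyc swap by metis
    next
      case 3
      then have "Q y x z (- t)" by (rule sorted)
      then show ?thesis using swap by blast
    next
      case 4
      then have "Q y z x t" by (rule sorted)
      then show ?thesis using cyc by blast
    next
      case 5
      then have "Q z x y t" by (rule sorted)
      then show ?thesis using cyc by blast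
    next
      case 6
      then have "Q z y x (- t)" by (rule sorted)
      then show ?thesis using cyc swap by metis
    qed
  qed
  then show ?thesis unfolding Q_def m_def using assms(1,2) by blast
qed

section \<open>The splittings\<close>

text \<open>Real coordinates of the two skew lines written as complex numbers: the first is (s, t)
  on x = y = z = s, the second gives the deviations of x and y, that of z being fixed by sum
  zero.\<close>

definition join_coords :: "complex \<times> complex \<Rightarrow> real ^ 4" where
  "join_coords p = vector [Re (fst p) + Re (snd p), Re (fst p) + Im (snd p),
     Re (fst p) - Re (snd p) - Im (snd p), Im (fst p)]"

lemma linear_join_coords: "linear join_coords"
  by (rule linearI) (simp_all add: join_coords_def vec_eq_iff forall_4 algebra_simps)

lemma bij_join_coords: "bij join_coords"
proof (rule bij_betw_byWitness[where f' = "\<lambda>v. let m = (v $ 1 + v $ 2 + v $ 3) / 3 in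
    (Complex m (v $ 4), Complex (v $ 1 - m) (v $ 2 - m))"])
  show "\<forall>v\<in>UNIV. join_coords (let m = (v $ 1 + v $ 2 + v $ 3) / 3 in
    (Complex m (v $ 4), Complex (v $ 1 - m) (v $ 2 - m))) = v"
    by (simp add: join_coords_def Let_def vec_eq_iff forall_4 field_simps)
qed (auto simp: join_coords_def Let_def complex_eq_iff)

lemma join_coords_image: "join_coords ` (join_coords -` S) = S"
  using bij_join_coords by (simp add: bij_is_surj surj_image_vimage_eq)

abbreviation "cone1 \<equiv> typed_cone Cube \<union> typed_cone Prism"
abbreviation "cone2 \<equiv> typed_cone Dumpling"
abbreviation "cone3 \<equiv> typed_cone Tetrahedron"

lemma cones_cover: "cone1 \<union> cone2 \<union> cone3 = UNIV"
proof -
  have "v \<in> cone1 \<union> cone2 \<union> cone3" for v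
  proof -
    obtain T where "v \<in> typed_cone T" using typed_cone_cover by blast
    then show ?thesis by (cases T) auto
  qed
  then show ?thesis by blast
qed

lemma cone_scaleR:
  "v \<in> cone1 \<Longrightarrow> c *\<^sub>R v \<in> cone1" "v \<in> cone2 \<Longrightarrow> c *\<^sub>R v \<in> cone2" "v \<in> cone3 \<Longrightarrow> c *\<^sub>R v \<in> cone3"
  using typed_cone_scaleR by blast+

text \<open>On this core the two triples are constant, equal to s and to -t, and a constant triple
  is of mixed sign only if it vanishes.\<close>

lemma core_not_in_cone23: assumes "z \<noteq> 0" shows "join_coords (z, 0) \<notin> cone2 \<union> cone3"
proof
  assume "join_coords (z, 0) \<in> cone2 \<union> cone3"
  then have *: "in_U2 (Re z) (Re z) (Re z) (Im z) \<or> in_U3 (Re z) (Re z) (Re z) (Im z)"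
    using typed_cone_imp(2)[of _ Dumpling] typed_cone_imp(3)[of _ Tetrahedron] by (force simp: join_coords_def)
  have "Re z = 0" "Im z = 0"
    using mixed_sign_of_U23[OF *] by (auto simp: mixed_sign_def)
  then show False using assms by (simp add: complex_eq_iff)
qed

text \<open>For t = 0 and x + y + z = 0 both triples sum to zero, so weakly constant sign forces a
  triple to vanish, and with it the vector. The tetrahedron inequalities have no other solution here
  either.\<close>

lemma core_not_in_cone13: assumes "w \<noteq> 0" shows "join_coords (0, w) \<notin> cone1 \<union> cone3"
proof
  assume "join_coords (0, w) \<in> cone1 \<union> cone3"
  then have "in_U1 (Re w) (Im w) (- Re w - Im w) 0 \<or> in_U3 (Re w) (Im w) (- Re w - Im w) 0"
    using typed_cone_imp(1)[of _ Cube] typed_cone_imp(1)[of _ Prism] typed_cone_imp(3)[of _ Tetrahedron]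
    by (force simp: join_coords_def)
  then have "Re w = 0 \<and> Im w = 0"
    unfolding in_U1_iff in_U3_iff by (elim disjE conjE; linarith)
  then show False using assms by (simp add: complex_eq_iff)
qed

text \<open>Both triples are a constant plus zero-sum deviations, the constants being Re z and -Im
  z. Stretching w amplifies just the deviations, so \<open>mixed_sign_scale\<close> applies to
  each.\<close>

lemma cone23_ray:
  assumes "join_coords (z, w) \<in> cone2 \<union> cone3" "w \<noteq> 0" "1 < \<mu>"
  shows "join_coords (z, \<mu> *\<^sub>R w) \<notin> cone1"
proof -
  let ?s = "Re z" and ?a = "Re w" and ?b = "Im w" and ?c = "- Re w - Im w" and ?k = "\<mu> - 1"
  have nz: "?a \<noteq> 0 \<or> ?b \<noteq> 0 \<or> ?c \<noteq> 0" using assms(2) by (auto simp: complex_eq_iff)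
  have "in_U2 (?s + ?a) (?s + ?b) (?s + ?c) (Im z) \<or> in_U3 (?s + ?a) (?s + ?b) (?s + ?c) (Im z)"
    using assms(1) typed_cone_imp(2)[of _ Dumpling] typed_cone_imp(3)[of _ Tetrahedron]
    by (force simp: join_coords_def algebra_simps)
  note mix = mixed_sign_of_U23[OF this]
  have "\<not> same_sign (?s + ?a + ?k * ?a) (?s + ?b + ?k * ?b) (?s + ?c + ?k * ?c)"
    using mix(1) nz assms(3) by (intro mixed_sign_scale) auto
  moreover have "\<not> same_sign (- Im z + (?b - ?c) + ?k * (?b - ?c)) (- Im z + (?c - ?a) + ?k * (?c - ?a))
      (- Im z + (?a - ?b) + ?k * (?a - ?b))"
    using mix(2) nz assms(3) by (intro mixed_sign_scale) (auto simp: algebra_simps)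
  moreover have "?s + r + ?k * r = ?s + \<mu> * r" for r by (simp add: algebra_simps)
  moreover have "- Im z + (q - r) + ?k * (q - r) = (?s + \<mu> * q) - (?s + \<mu> * r) - Im z" for q r
    by (simp add: algebra_simps)
  ultimately have "\<not> in_U1 (?s + \<mu> * ?a) (?s + \<mu> * ?b) (?s + \<mu> * ?c) (Im z)"
    unfolding in_U1_def by (simp only: simp_thms)
  then show ?thesis
    using typed_cone_imp(1)[of _ Cube] typed_cone_imp(1)[of _ Prism]
    by (force simp: join_coords_def algebra_simps)
qed

lemma cone2_ray:
  assumes "join_coords (z, w) \<in> cone2" "w \<noteq> 0" "1 < \<mu>"
  shows "join_coords (z, \<mu> *\<^sub>R w) \<notin> cone1 \<union> cone3"
proof -
  let ?x = "Re z + Re w" and ?y = "Re z + Im w" and ?z = "Re z - Re w - Im w" and ?k = "\<mu> - 1"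
  \<comment> \<open>The deviations have sum zero, so Re z is the mean m of
    \<open>U2_ray\<close>.\<close>
  have m: "(?x + ?y + ?z) / 3 = Re z" by simp
  have e: "?x + ?k * (?x - Re z) = Re z + \<mu> * Re w" "?y + ?k * (?y - Re z) = Re z + \<mu> * Im w"
    "?z + ?k * (?z - Re z) = Re z - \<mu> * Re w - \<mu> * Im w" by (simp_all add: algebra_simps)
  have "in_U2 ?x ?y ?z (Im z)"
    using typed_cone_imp(2)[OF assms(1)] by (simp add: join_coords_def)
  moreover have "\<not> (?x = ?y \<and> ?y = ?z)" using assms(2) by (auto simp: complex_eq_iff)
  moreover have "0 < ?k" using assms(3) by simp
  ultimately have "\<not> in_U1 (?x + ?k * (?x - Re z)) (?y + ?k * (?y - Re z)) (?z + ?k * (?z - Re z)) (Im z) \<and>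
    \<not> in_U3 (?x + ?k * (?x - Re z)) (?y + ?k * (?y - Re z)) (?z + ?k * (?z - Re z)) (Im z)"
    using U2_ray[of ?x ?y ?z "Im z" ?k] unfolding m by blast
  then have "\<not> in_U1 (Re z + \<mu> * Re w) (Re z + \<mu> * Im w) (Re z - \<mu> * Re w - \<mu> * Im w) (Im z) \<and>
    \<not> in_U3 (Re z + \<mu> * Re w) (Re z + \<mu> * Im w) (Re z - \<mu> * Re w - \<mu> * Im w) (Im z)"
    unfolding e .
  then show ?thesis
    using typed_cone_imp(1)[of _ Cube] typed_cone_imp(1)[of _ Prism] typed_cone_imp(3)[of _ Tetrahedron]
    by (force simp: join_coords_def)
qed

lemma continuous_on_join_coords: "continuous_on S join_coords"
  by (rule linear_continuous_on) (use linear_join_coords in \<open>simp add: linear_conv_bounded_linear\<close>)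

lemma closed_vimage_join_coords: "closed S \<Longrightarrow> closed (join_coords -` S)"
  by (rule closed_vimage[OF _ continuous_on_join_coords])

lemma join_coords_scaleR: "join_coords (c *\<^sub>R p) = c *\<^sub>R join_coords p"
  by (rule linear_scale[OF linear_join_coords])

text \<open>Each splitting yields two solid tori, one from either side: this one the prisms with
  cubes and their complementary union, the next one the dumplings and theirs.\<close>

interpretation splitting1: join_splitting "join_coords -` cone1" "join_coords -` (cone2 \<union> cone3)"
proof
  show "closed (join_coords -` cone1)"
    by (rule closed_vimage_join_coords[OF closed_typed_cones(1)])
  show "closed (join_coords -` (cone2 \<union> cone3))"
    by (rule closed_vimage_join_coords[OF closed_Un[OF closed_typed_cones(2,3)]])
  show "join_coords -` cone1 \<union> join_coords -` (cone2 \<union> cone3) = UNIV"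
    unfolding vimage_Un[symmetric] using cones_cover by (simp add: Un_assoc)
  show "c *\<^sub>R x \<in> join_coords -` cone1" if "x \<in> join_coords -` cone1" for x c
    using that cone_scaleR(1) unfolding vimage_eq join_coords_scaleR by blast
  show "c *\<^sub>R x \<in> join_coords -` (cone2 \<union> cone3)" if "x \<in> join_coords -` (cone2 \<union> cone3)" for x c
    using that cone_scaleR(2,3) unfolding vimage_eq join_coords_scaleR by blast
  show "(z, 0) \<notin> join_coords -` (cone2 \<union> cone3)" if "z \<noteq> 0" for z
    using core_not_in_cone23[OF that] by simp
  show "(0, w) \<notin> join_coords -` cone1" if "w \<noteq> 0" for w
    using core_not_in_cone13[OF that] by simp
  show "(z, \<mu> *\<^sub>R w) \<notin> join_coords -` cone1"
    if "(z, w) \<in> join_coords -` (cone2 \<union> cone3)" "z \<noteq> 0" "w \<noteq> 0" "1 < \<mu>" for z w \<mu>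
    using cone23_ray[of z w \<mu>] that by simp
qed

interpretation splitting2: join_splitting "join_coords -` (cone1 \<union> cone3)" "join_coords -` cone2"
proof
  show "closed (join_coords -` (cone1 \<union> cone3))"
    by (rule closed_vimage_join_coords[OF closed_Un[OF closed_typed_cones(1,3)]])
  show "closed (join_coords -` cone2)"
    by (rule closed_vimage_join_coords[OF closed_typed_cones(2)])
  show "join_coords -` (cone1 \<union> cone3) \<union> join_coords -` cone2 = UNIV"
    unfolding vimage_Un[symmetric] using cones_cover by auto
  show "c *\<^sub>R x \<in> join_coords -` (cone1 \<union> cone3)" if "x \<in> join_coords -` (cone1 \<union> cone3)" for x c
    using that cone_scaleR(1,3) unfolding vimage_eq join_coords_scaleR by blast
  show "c *\<^sub>R x \<in> join_coords -` cone2" if "x \<in> join_coords -` cone2" for x c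
    using that cone_scaleR(2) unfolding vimage_eq join_coords_scaleR by blast
  show "(z, 0) \<notin> join_coords -` cone2" if "z \<noteq> 0" for z
    using core_not_in_cone23[OF that] by simp
  show "(0, w) \<notin> join_coords -` (cone1 \<union> cone3)" if "w \<noteq> 0" for w
    using core_not_in_cone13[OF that] by simp
  show "(z, \<mu> *\<^sub>R w) \<notin> join_coords -` (cone1 \<union> cone3)"
    if "(z, w) \<in> join_coords -` cone2" "z \<noteq> 0" "w \<noteq> 0" "1 < \<mu>" for z w \<mu>
    using cone2_ray[of z w \<mu>] that by simp
qed

lemma linear_join_coords_swap: "linear (join_coords \<circ> prod.swap)"
  by (rule linear_compose[OF _ linear_join_coords]) (auto intro: linearI)

lemma bij_join_coords_swap: "bij (join_coords \<circ> prod.swap)"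
  by (rule bij_comp[OF _ bij_join_coords]) (auto intro: o_bij[of prod.swap])

lemma join_coords_swap_image: "(join_coords \<circ> prod.swap) ` prod.swap ` (join_coords -` S) = S"
  using join_coords_image[of S] by (simp add: image_comp o_assoc[symmetric])

lemma solid_tori:
  "solid_torus_in proj_space (proj_set cone1)" "solid_torus_in proj_space (proj_set (cone2 \<union> cone3))"
  "solid_torus_in proj_space (proj_set (cone1 \<union> cone3))" "solid_torus_in proj_space (proj_set cone2)"
  using splitting1.solid_torus[OF linear_join_coords bij_join_coords]
    splitting2.solid_torus[OF linear_join_coords bij_join_coords]
    join_splitting.solid_torus[OF splitting1.swap linear_join_coords_swap bij_join_coords_swap]
    join_splitting.solid_torus[OF splitting2.swap linear_join_coords_swap bij_join_coords_swap]
  unfolding join_coords_image join_coords_swap_image by blast+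

lemma homog_cones: "homog cone1" "homog cone2" "homog cone3"
  by (simp_all add: homog_Un homog_typed_cone)

lemma proj_pt_in_interior:
  assumes "homog B" "closed B" "A \<union> B = UNIV" "v \<notin> B" "v \<noteq> 0"
  shows "proj_pt v \<in> proj_space interior_of (proj_set A)"
proof -
  have "openin proj_space (proj_set (- B))"
    using assms by (intro openin_proj_set homog_Compl open_Compl)
  moreover have "proj_set (- B) \<subseteq> proj_set A" using assms(3) by (intro proj_set_mono) blast
  moreover have "proj_pt v \<in> proj_set (- B)" using assms(4,5) by (auto simp: proj_set_def)
  ultimately show ?thesis using interior_of_maximal by blast
qed

text \<open>A nonempty open intersection would contain a generic point, whose type is
  unique.\<close>

lemma disjnt_interiors:
  "disjnt (proj_space interior_of (proj_set cone1)) (proj_space interior_of (proj_set cone2))"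
proof (rule ccontr)
  let ?O = "proj_space interior_of (proj_set cone1) \<inter> proj_space interior_of (proj_set cone2)"
  assume "\<not> ?thesis"
  then obtain p where p: "p \<in> ?O" unfolding disjnt_def by blast
  have "openin proj_space ?O" by (intro openin_Int openin_interior_of)
  then have op: "open {v. v \<noteq> 0 \<and> proj_pt v \<in> ?O}" and sub: "?O \<subseteq> topspace proj_space"
    unfolding openin_proj_space topspace_proj_space by blast+
  obtain v where v: "v \<noteq> 0" "p = proj_pt v" using p sub by (auto simp: topspace_proj_space)
  have "((\<lambda>e. v + e *\<^sub>R rep Cube) \<longlongrightarrow> v + 0 *\<^sub>R rep Cube) (at_right 0)" by (intro tendsto_intros)
  then have "\<forall>\<^sub>F e in at_right 0. v + e *\<^sub>R rep Cube \<in> {v. v \<noteq> 0 \<and> proj_pt v \<in> ?O}"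
    using p v by (intro topological_tendstoD[OF _ op]) simp_all
  then obtain d where d: "0 < d" "\<And>e. 0 < e \<Longrightarrow> e < d \<Longrightarrow> proj_pt (v + e *\<^sub>R rep Cube) \<in> ?O"
    unfolding eventually_at_right_field by blast
  obtain e where e: "0 < e" "e < d" "generic (v + e *\<^sub>R rep Cube)"
    using that by (rule generic_perturbation[OF generic_rep d(1)])
  define u where "u = v + e *\<^sub>R rep Cube"
  have u: "generic u" "u \<noteq> 0" using e(3) generic_nonzero by (auto simp: u_def)
  have "proj_pt u \<in> proj_set cone1" "proj_pt u \<in> proj_set cone2"
    using d(2)[OF e(1,2)] interior_of_subset[of proj_space] unfolding u_def[symmetric] by blast+
  then have "u \<in> cone1" "u \<in> cone2"
    using proj_pt_in_proj_set[OF homog_cones(1) u(2)] proj_pt_in_proj_set[OF homog_cones(2) u(2)] by blast+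
  then have "type_of u = Cube \<or> type_of u = Prism" "type_of u = Dumpling"
    by (auto dest: type_of_generic[OF u(1)])
  then show False by simp
qed

text \<open>Each core lies in the interior of its own solid torus, so
  \<open>not_contractible_within_core\<close> applies with the coordinates in either order.\<close>

lemma linked_cones: "linked_in proj_space (proj_set cone1) (proj_set cone2)"
proof -
  have nz: "join_coords p \<noteq> 0" if "p \<noteq> 0" for p
    using that linear_0[OF linear_join_coords] bij_join_coords by (metis bij_is_inj injD)
  have 1: "proj_pt (join_coords (z, 0)) \<in> proj_space interior_of (proj_set cone1)" if "z \<noteq> 0" for z
  proof (rule proj_pt_in_interior[of "cone2 \<union> cone3"])
    show "closed (cone2 \<union> cone3)" by (rule closed_Un[OF closed_typed_cones(2,3)])
    show "cone1 \<union> (cone2 \<union> cone3) = UNIV" using cones_cover by blast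
  qed (use homog_cones homog_Un core_not_in_cone23[OF that] nz that in \<open>auto simp: zero_prod_def\<close>)
  have 2: "proj_pt (join_coords (0, w)) \<in> proj_space interior_of (proj_set cone2)" if "w \<noteq> 0" for w
  proof (rule proj_pt_in_interior[of "cone1 \<union> cone3"])
    show "closed (cone1 \<union> cone3)" by (rule closed_Un[OF closed_typed_cones(1,3)])
    show "cone2 \<union> (cone1 \<union> cone3) = UNIV" using cones_cover by blast
    show "homog (cone1 \<union> cone3)" by (rule homog_Un[OF homog_cones(1,3)])
    show "join_coords (0, w) \<notin> cone1 \<union> cone3" by (rule core_not_in_cone13[OF that])
    show "join_coords (0, w) \<noteq> 0" using that by (intro nz) (simp add: zero_prod_def)
  qed
  show ?thesis
    unfolding linked_in_def
  proof (intro conjI disjnt_interiors)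
    show "\<not> contractible_within proj_space (proj_space interior_of (proj_set cone1))
        (topspace proj_space - proj_space interior_of (proj_set cone2))"
      using interior_of_subset_topspace 1 2
      by (rule not_contractible_within_core[OF linear_join_coords bij_join_coords])
    show "\<not> contractible_within proj_space (proj_space interior_of (proj_set cone2))
        (topspace proj_space - proj_space interior_of (proj_set cone1))"
      by (rule not_contractible_within_core[OF linear_join_coords_swap bij_join_coords_swap
            interior_of_subset_topspace]) (simp_all add: 1 2)
  qed
qed

text \<open>One inclusion holds because \<open>cone3\<close> is closed and contains the complement
  of the other two. For the other, a tetrahedron is the closure of its open cell, whose generic
  points lie in neither \<open>cone1\<close> nor \<open>cone2\<close>.\<close>

lemma cone3_closure:
  "proj_set cone3 = proj_space closure_of (topspace proj_space - (proj_set cone1 \<union> proj_set cone2))"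
proof -
  have compl: "topspace proj_space - (proj_set cone1 \<union> proj_set cone2) = proj_set (- (cone1 \<union> cone2))"
    unfolding proj_set_Un[symmetric] by (rule topspace_Diff_proj_set[OF homog_Un[OF homog_cones(1,2)]])
  show ?thesis
    unfolding compl
  proof
    show "proj_space closure_of proj_set (- (cone1 \<union> cone2)) \<subseteq> proj_set cone3"
    proof (rule closure_of_minimal)
      show "proj_set (- (cone1 \<union> cone2)) \<subseteq> proj_set cone3"
        using cones_cover by (intro proj_set_mono) blast
    qed (rule closedin_proj_set[OF homog_cones(3) closed_typed_cones(3)])
    show "proj_set cone3 \<subseteq> proj_space closure_of proj_set (- (cone1 \<union> cone2))"
    proof
      fix p assume "p \<in> proj_set cone3"
      then obtain w where w: "generic w" "type_of w = Tetrahedron" "p \<in> chamber w"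
        unfolding Union_chambers_typed[symmetric] chambers_typed_def by blast
      have "cell w \<subseteq> proj_set (- (cone1 \<union> cone2))"
        unfolding cell_def
      proof (rule proj_set_mono, rule subsetI)
        fix v assume v: "v \<in> open_cone w"
        then have g: "generic v" by (rule open_cone_generic)
        have "type_of v = Tetrahedron"
          using v pattern_eq_iff[OF w(1) g] w(2) by (simp add: type_of_def)
        then show "v \<in> - (cone1 \<union> cone2)" using type_of_generic[OF g] by fastforce
      qed
      then have "proj_space closure_of cell w \<subseteq> proj_space closure_of proj_set (- (cone1 \<union> cone2))"
        by (rule closure_of_mono)
      then show "p \<in> proj_space closure_of proj_set (- (cone1 \<union> cone2))"
        using w closure_of_cell by blast
    qed
  qed
qed

theorem mainTheorem1:
  shows "G \<cong> sym_group 3 \<times>\<times> integer_mod_group 2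
    \<and> (\<forall>g\<in>carrier G. orientation_preserving_proj g)
    \<and> (\<forall>g\<in>carrier G. (`) g ` arrangement = arrangement)
    \<and> card chambers = 26
    \<and> group_action G chambers chamber_action
    \<and> card (orbits G chambers chamber_action) = 4
    \<and> orbits G chambers chamber_action =
        {chambers_of_type triangular_prism, chambers_of_type tetrahedron,
         chambers_of_type dumpling, chambers_of_type cube}
    \<and> card (chambers_of_type triangular_prism) = 12
    \<and> card (chambers_of_type tetrahedron) = 6
    \<and> card (chambers_of_type dumpling) = 6
    \<and> card (chambers_of_type cube) = 2
    \<and> (let U1 = \<Union>(chambers_of_type triangular_prism \<union> chambers_of_type cube);
           U2 = \<Union>(chambers_of_type dumpling);
           U3 = \<Union>(chambers_of_type tetrahedron)
       in solid_torus_in proj_space U1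
        \<and> solid_torus_in proj_space U2
        \<and> linked_in proj_space U1 U2
        \<and> U3 = proj_space closure_of (topspace proj_space - (U1 \<union> U2))
        \<and> solid_torus_in proj_space (U1 \<union> U3)
        \<and> solid_torus_in proj_space (U2 \<union> U3))"
proof -
  note types = chambers_of_types[unfolded type_polytope.simps]
  have U1: "\<Union> (chambers_typed Prism \<union> chambers_typed Cube) = proj_set cone1"
    by (simp add: Union_Un_distrib Union_chambers_typed proj_set_Un Un_commute)
  have orb: "orbits G chambers chamber_action =
      {chambers_typed Prism, chambers_typed Tetrahedron, chambers_typed Dumpling, chambers_typed Cube}"
    by (simp add: orbits_eq range_chamber_type)
  show ?thesis
    unfolding types Let_def U1 Union_chambers_typed
  proof (intro conjI ballI)
    show "proj_set cone3 = proj_space closure_of (topspace proj_space - (proj_set cone1 \<union> proj_set cone2))"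
      by (rule cone3_closure)
    show "card (orbits G chambers chamber_action) = 4" by (rule card_orbits)
  qed (simp_all add: G_iso orientation_preserving_G arrangement_invariant card_chambers
      group_action_chambers orb card_chambers_typed solid_tori linked_cones
      proj_set_Un[symmetric])
qed

end
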